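(* Let $\mathbb{F}$ be a field and let $n\geq 2$. Let $A(s)=sA_1+A_0,\ B(s)=sB_1+B_0\in \mathbb{F}[s]^{n \times n}$ be regular matrix pencils. Let $\phi_1(s,t)\mid \dots\mid \phi_n(s, t)$ and $\psi_1(s,t)\mid \dots\mid \psi_n(s, t)$ be the homogeneous invariant factors of $A(s)$ and $B(s)$, respectively, and assume that $\mathbb{F}\cup \{\infty\}\not\subseteq \Lambda(A(s))\cup \Lambda(B(s))$. Let $r$ be a nonnegative integer, $r\leq n$. There exists a matrix pencil $P(s)\in \mathbb{F}[s]^{n \times n}$ such that $\operatorname{rank}(P(s))=r$ and $A(s)+P(s)$ is strictly equivalent to $B(s)$ if and only if $$\phi_{i-r}(s, t)\mid \psi_i(s, t)\mid\phi_{i+r}(s, t), \quad 1\leq i \leq n,$$ where $\phi_j(s,t):=1$ for $j<1$ and $\phi_j(s,t):=0$ for $j>n$.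
   Context: A matrix pencil is a polynomial matrix $G(s)=G_0+sG_1\in\mathbb{F}[s]^{m\times n}$ of degree at most $1$ ($G_0,G_1\in\mathbb{F}^{m\times n}$). It is regular if $m=n$ and $\det G(s)$ is a nonzero polynomial. $\operatorname{rank}(G(s))$ denotes the normal rank, i.e. the rank of $G(s)$ over the field of fractions of $\mathbb{F}[s]$. Two pencils $G(s),H(s)\in\mathbb{F}[s]^{m\times n}$ are strictly equivalent if $G(s)=QH(s)R$ for some invertible constant matrices $Q\in\mathrm{GL}_m(\mathbb{F})$, $R\in\mathrm{GL}_n(\mathbb{F})$. For a pencil $G(s)=G_0+sG_1$ of normal rank $\rho$, put $G(s,t)=tG_0+sG_1\in\mathbb{F}[s,t]^{m\times n}$. For $1\le k\le\rho$, let $\Delta_k(s,t)$ be the greatest common divisor of the $k\times k$ minors of $G(s,t)$, a homogeneous polynomial normalized to be monic with respect to $s$ (the monomial of highest degree in $s$ has coefficient $1$), and $\Delta_0:=1$. The homogeneous invariant factors of $G(s)$ are $\Gamma_k(s,t)=\Delta_k(s,t)/\Delta_{k-1}(s,t)$, $1\le k\le\rho$; they satisfy $\Gamma_1\mid\dots\mid\Gamma_\rho$. With $\overline{\mathbb{F}}$ the algebraic closure of $\mathbb{F}$, the spectrum of $G(s)$ is $\Lambda(G(s))=\{\lambda\in\overline{\mathbb{F}}\cup\{\infty\} : \operatorname{rank}(G(\lambda))<\operatorname{rank}(G(s))\}$, where $G(\infty):=G_1$. *)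

theory Defs
  imports
    "HOL-Computational_Algebra.Computational_Algebra"
    "HOL-Computational_Algebra.Field_as_Ring"
    "HOL-Algebra.Algebraic_Closure_Type"
    "Jordan_Normal_Form.Determinant"
    "Jordan_Normal_Form.DL_Rank"
    "Jordan_Normal_Form.DL_Submatrix"
begin

definition matrix_pencil :: "nat \<Rightarrow> nat \<Rightarrow> 'a::field poly mat \<Rightarrow> bool" where
  "matrix_pencil m n G \<longleftrightarrow>
     G \<in> carrier_mat m n \<and> (\<forall>i<m. \<forall>j<n. Polynomial.degree (G $$ (i, j)) \<le> 1)"

definition regular_pencil :: "nat \<Rightarrow> 'a::field poly mat \<Rightarrow> bool" where
  "regular_pencil n G \<longleftrightarrow> matrix_pencil n n G \<and> Determinant.det G \<noteq> 0"

definition normal_rank :: "'a::field poly mat \<Rightarrow> nat" where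
  "normal_rank G = vec_space.rank (dim_row G) (map_mat to_fract G)"

definition strictly_equivalent :: "'a::field poly mat \<Rightarrow> 'a poly mat \<Rightarrow> bool" where
  "strictly_equivalent G H \<longleftrightarrow>
     H \<in> carrier_mat (dim_row G) (dim_col G) \<and>
     (\<exists>Q R. Q \<in> carrier_mat (dim_row G) (dim_row G) \<and> invertible_mat Q \<and>
            R \<in> carrier_mat (dim_col G) (dim_col G) \<and> invertible_mat R \<and>
            G = map_mat (\<lambda>c. [:c:]) Q * H * map_mat (\<lambda>c. [:c:]) R)"

text \<open>
  The ring \<open>F[s,t]\<close> is represented by \<^typ>\<open>'a poly poly\<close>, read as \<open>F[t][s]\<close>: the outer
  polynomial variable is \<open>s\<close> and the coefficients are polynomials in \<open>t\<close>. For
  \<open>G(s) = G\<^sub>0 + s G\<^sub>1\<close> the matrix below is therefore \<open>t G\<^sub>0 + s G\<^sub>1\<close>.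
\<close>

definition homogenization :: "'a::field poly mat \<Rightarrow> 'a poly poly mat" where
  "homogenization G =
     map_mat (\<lambda>p. [: [:0, Polynomial.coeff p 0:], [:Polynomial.coeff p 1:] :]) G"

definition minors :: "nat \<Rightarrow> 'b::comm_ring_1 mat \<Rightarrow> 'b set" where
  "minors k M =
     {Determinant.det (submatrix M I J) | I J.
        I \<subseteq> {..<dim_row M} \<and> J \<subseteq> {..<dim_col M} \<and> card I = k \<and> card J = k}"

text \<open>
  The class \<^class>\<open>field\<close> does not provide \<open>gcd\<close> on \<^typ>\<open>'a poly poly\<close>, so greatest common
  divisors are described by their divisibility property. In \<open>F[t][s]\<close> a nonzero homogeneous
  polynomial has exactly one monomial of highest degree in \<open>s\<close>; its coefficient is the leading
  coefficient of the leading coefficient. This normalization fixes the remaining scalar factor.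
\<close>

definition is_gcd_of :: "'b::comm_ring_1 \<Rightarrow> 'b set \<Rightarrow> bool" where
  "is_gcd_of d S \<longleftrightarrow> (\<forall>x\<in>S. d dvd x) \<and> (\<forall>e. (\<forall>x\<in>S. e dvd x) \<longrightarrow> e dvd d)"

definition monic_wrt_s :: "'a::field poly poly \<Rightarrow> bool" where
  "monic_wrt_s p \<longleftrightarrow> lead_coeff (lead_coeff p) = 1"

text \<open>Both of the following are meaningful only up to the normal rank of \<open>G\<close>.\<close>

definition determinantal_divisor :: "'a::field poly mat \<Rightarrow> nat \<Rightarrow> 'a poly poly" where
  "determinantal_divisor G k =
     (if k = 0 then 1
      else THE d. is_gcd_of d (minors k (homogenization G)) \<and> monic_wrt_s d)"

definition hom_invariant_factor :: "'a::field poly mat \<Rightarrow> nat \<Rightarrow> 'a poly poly" where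
  "hom_invariant_factor G k = determinantal_divisor G k div determinantal_divisor G (k - 1)"

datatype 'a ext_point = Fin 'a | Infty

fun pencil_at :: "'a::field poly mat \<Rightarrow> 'a alg_closure ext_point \<Rightarrow> 'a alg_closure mat" where
  "pencil_at G (Fin x) = map_mat (\<lambda>p. poly (map_poly to_ac p) x) G"
| "pencil_at G Infty = map_mat (\<lambda>p. to_ac (Polynomial.coeff p 1)) G"

definition spectrum_pencil :: "'a::field poly mat \<Rightarrow> 'a alg_closure ext_point set" where
  "spectrum_pencil G = {x. vec_space.rank (dim_row G) (pencil_at G x) < normal_rank G}"

definition ground_points :: "'a::field alg_closure ext_point set" where
  "ground_points = insert Infty (range (\<lambda>c. Fin (to_ac c)))"

end

theory Submission
  imports Defs "HOL-Library.Function_Algebras" "Jordan_Normal_Form.Char_Poly" "Jordan_Normal_Form.DL_Rank_Submatrix"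
begin

text \<open>
  Choose a point of the ground field or infinity at which both pencils are invertible. In
  coordinates \<open>u, v\<close> of the pencil variable in which \<open>v\<close> vanishes at this point,
  \<open>A = M\<^sub>A (u I - v N\<^sub>A)\<close> and \<open>B = M\<^sub>B (u I - v N\<^sub>B)\<close>. The homogeneous invariant factors
  of \<open>A\<close> are then the homogenizations of the invariant factors of the matrix \<open>N\<^sub>A\<close>, so divisibility
  can be tested on ordinary polynomials.

  Necessity: after the substitution \<open>u = x, v = 1\<close>, the pencil \<open>P\<close> becomes a polynomial matrix of rank
  at most \<open>r\<close>, and adding a matrix of rank \<open>r\<close> shifts the Smith form by at most \<open>r\<close> places.

  Sufficiency: a chain of rank one perturbations leads from \<open>N\<^sub>A\<close> to a matrix \<open>N\<close> with the invariant
  factors of \<open>N\<^sub>B\<close>, hence similar to \<open>N\<^sub>B\<close>. Write \<open>N - N\<^sub>A = T Z\<close> with \<open>T\<close> invertible and only the first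
  \<open>r\<close> rows of \<open>Z\<close> nonzero. For any \<open>Y\<close> of rank \<open>r\<close> supported on the same rows with \<open>I + Y\<close> invertible,
  \<open>P = M\<^sub>A T (Y T\<^sup>-\<^sup>1 (u I - v N) - v Z)\<close> satisfies \<open>A + P = M\<^sub>A T (I + Y) T\<^sup>-\<^sup>1 (u I - v N)\<close>. Its
  rank is at most \<open>r\<close>, and it is exactly \<open>r\<close> because the value of \<open>P\<close> at \<open>v = 0\<close> has the rank of \<open>Y\<close>.
\<close>

section \<open>Smith normal form\<close>

text \<open>The chosen point must lie in the ground field or be infinity, because
  \<open>M\<^sub>A\<close>, \<open>N\<^sub>A\<close> and all later transformations must have entries
  in that field; the algebraic closure only serves to count root multiplicities.

  The divisibility conditions bound the rank of \<open>N - N\<^sub>A\<close> only from above: for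
  equal pencils it may be zero. The remedy is the freedom in strict equivalence: the constant factor
  built from \<open>I + Y\<close> keeps the class of the perturbed pencil, and since
  \<open>Y\<close> occupies the rows that already carry \<open>Z\<close>, the rank of the difference
  can be raised to \<open>r\<close> but not beyond.

  Invariant factors are identified by a degree argument: two monic chains of total degree
  \<open>n\<close>, one dividing the other termwise, are equal. A construction thus has to supply
  one-sided divisibility and a degree count. The same count is the obstacle in splitting a change of
  rank \<open>r\<close> into changes of rank one: an intermediate chain must fit both ends and have
  total degree exactly \<open>n\<close>, over a field in which polynomials need not split.\<close>

definition inverse_pair :: "nat \<Rightarrow> 'b::comm_ring_1 mat \<Rightarrow> 'b mat \<Rightarrow> bool" where
  "inverse_pair n P Q \<longleftrightarrow> P \<in> carrier_mat n n \<and> Q \<in> carrier_mat n n \<and>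
     P * Q = 1\<^sub>m n \<and> Q * P = 1\<^sub>m n"

lemma inverse_pair_sym: "inverse_pair n P Q \<Longrightarrow> inverse_pair n Q P"
  by (auto simp: inverse_pair_def)

lemma inverse_pairD:
  assumes "inverse_pair n P Q"
  shows "P \<in> carrier_mat n n" "Q \<in> carrier_mat n n" "P * Q = 1\<^sub>m n" "Q * P = 1\<^sub>m n"
  using assms by (auto simp: inverse_pair_def)

lemma inverse_pair_one: "inverse_pair n (1\<^sub>m n) (1\<^sub>m n)"
  by (auto simp: inverse_pair_def)

lemma inverse_pair_cancel:
  assumes P: "inverse_pair n P Q" and A: "A \<in> carrier_mat n m"
  shows "P * (Q * A) = A" "Q * (P * A) = A"
  using assoc_mult_mat[OF inverse_pairD(1,2)[OF P] A] assoc_mult_mat[OF inverse_pairD(2,1)[OF P] A]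
    inverse_pairD(3,4)[OF P] left_mult_one_mat[OF A] by metis+

lemma inverse_pair_cancel_right:
  assumes P: "inverse_pair n P Q" and A: "A \<in> carrier_mat m n"
  shows "A * P * Q = A" "A * Q * P = A"
  using assoc_mult_mat[OF A inverse_pairD(1,2)[OF P]] assoc_mult_mat[OF A inverse_pairD(2,1)[OF P]]
    inverse_pairD(3,4)[OF P] right_mult_one_mat[OF A] by metis+

lemma inverse_pair_mult:
  assumes "inverse_pair n P P'" and "inverse_pair n Q Q'"
  shows "inverse_pair n (P * Q) (Q' * P')"
proof -
  note c = inverse_pairD(1,2)[OF assms(1)] inverse_pairD(1,2)[OF assms(2)]
  have "P * Q * (Q' * P') = P * (Q * (Q' * P'))"
    using c by (intro assoc_mult_mat) auto
  moreover have "Q' * P' * (P * Q) = Q' * (P' * (P * Q))"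
    using c by (intro assoc_mult_mat) auto
  ultimately show ?thesis
    using c assms by (auto simp: inverse_pair_def inverse_pair_cancel[OF assms(1)]
        inverse_pair_cancel[OF assms(2)])
qed

lemma inverse_pair_transpose:
  assumes "inverse_pair n P Q"
  shows "inverse_pair n (transpose_mat P) (transpose_mat Q)"
proof -
  note P = inverse_pairD[OF assms]
  have "transpose_mat P * transpose_mat Q = 1\<^sub>m n" "transpose_mat Q * transpose_mat P = 1\<^sub>m n"
    using transpose_mult[OF P(1,2)] transpose_mult[OF P(2,1)] P(3,4) by (metis transpose_one)+
  then show ?thesis using P by (simp add: inverse_pair_def)
qed

lemma mult_mat_index:
  assumes "A \<in> carrier_mat n m" "B \<in> carrier_mat m p" "i < n" "j < p"
  shows "(A * B) $$ (i, j) = (\<Sum>l<m. A $$ (i, l) * B $$ (l, j))"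
  using assms by (auto simp: scalar_prod_def atLeast0LessThan intro!: sum.cong)

definition equiv_mat :: "nat \<Rightarrow> 'b::comm_ring_1 mat \<Rightarrow> 'b mat \<Rightarrow> bool" where
  "equiv_mat n A B \<longleftrightarrow>
     (\<exists>P P' Q Q'. inverse_pair n P P' \<and> inverse_pair n Q Q' \<and> A = P * B * Q)"

lemma equiv_mat_refl: "A \<in> carrier_mat n n \<Longrightarrow> equiv_mat n A A"
  unfolding equiv_mat_def
  by (rule exI[of _ "1\<^sub>m n"], rule exI[of _ "1\<^sub>m n"], rule exI[of _ "1\<^sub>m n"],
      rule exI[of _ "1\<^sub>m n"]) (auto simp: inverse_pair_one)

lemma equiv_mat_mult_left:
  assumes "equiv_mat n A B" "inverse_pair n U U'" "B \<in> carrier_mat n n"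
  shows "equiv_mat n A (U * B)"
proof -
  obtain P P' Q Q' where P: "inverse_pair n P P'" and Q: "inverse_pair n Q Q'"
    and A: "A = P * B * Q" using assms(1) unfolding equiv_mat_def by blast
  note c = inverse_pairD(1,2)[OF P] inverse_pairD(1,2)[OF assms(2)]
  have "P * U' * (U * B) = P * (U' * (U * B))"
    using c assms(3) by (intro assoc_mult_mat) auto
  then have "A = P * U' * (U * B) * Q"
    using A by (simp add: inverse_pair_cancel[OF assms(2,3)])
  then show ?thesis
    using inverse_pair_mult[OF P inverse_pair_sym[OF assms(2)]] Q
    unfolding equiv_mat_def by blast
qed

text \<open>Block matrices with an identity block of size \<open>k\<close> in the top left corner
  and zeros beside it: the operations allowed once \<open>k\<close> pivots are finished.\<close>

definition fixes_below :: "nat \<Rightarrow> nat \<Rightarrow> 'b::comm_ring_1 mat \<Rightarrow> bool" where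
  "fixes_below n k U \<longleftrightarrow>
     (\<forall>i<n. \<forall>j<n. i < k \<or> j < k \<longrightarrow> U $$ (i, j) = (if i = j then 1 else 0))"

text \<open>The state of the elimination after \<open>k\<close> pivots. Divisibility of the whole
  remaining block by every earlier pivot belongs to the invariant, so the diagonal comes out as a
  divisor chain without a second pass.\<close>

definition reduced_upto :: "nat \<Rightarrow> nat \<Rightarrow> 'b::comm_ring_1 mat \<Rightarrow> 'b mat \<Rightarrow> bool" where
  "reduced_upto n k A B \<longleftrightarrow> B \<in> carrier_mat n n \<and> equiv_mat n A B \<and>
     (\<forall>i<n. \<forall>j<n. i < k \<or> j < k \<longrightarrow> i \<noteq> j \<longrightarrow> B $$ (i, j) = 0) \<and>
     (\<forall>t<k. \<forall>i<n. \<forall>j<n. t \<le> i \<longrightarrow> t \<le> j \<longrightarrow> B $$ (t, t) dvd B $$ (i, j))"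

lemma reduced_upto_mult_left:
  assumes red: "reduced_upto n k A B" and U: "inverse_pair n U U'" and low: "fixes_below n k U"
    and k: "k \<le> n"
  shows "reduced_upto n k A (U * B)"
proof -
  have B: "B \<in> carrier_mat n n" and Uc: "U \<in> carrier_mat n n"
    using red U by (auto simp: reduced_upto_def inverse_pair_def)
  have zero: "B $$ (i, j) = 0" if "i < n" "j < n" "i < k \<or> j < k" "i \<noteq> j" for i j
    using red that by (auto simp: reduced_upto_def)
  have dv: "B $$ (t, t) dvd B $$ (i, j)" if "t < k" "i < n" "j < n" "t \<le> i" "t \<le> j" for t i j
    using red that unfolding reduced_upto_def by blast
  have ix: "(U * B) $$ (i, j) = (\<Sum>l<n. U $$ (i, l) * B $$ (l, j))" if "i < n" "j < n" for i j
    by (rule mult_mat_index[OF Uc B that])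
  have u: "U $$ (i, j) = (if i = j then 1 else 0)" if "i < n" "j < n" "i < k \<or> j < k" for i j
    using low that by (auto simp: fixes_below_def)
  have same: "(U * B) $$ (i, j) = B $$ (i, j)" if "i < k" "i < n" "j < n" for i j
  proof -
    have "(\<Sum>l<n. U $$ (i, l) * B $$ (l, j)) = (\<Sum>l<n. if l = i then B $$ (l, j) else 0)"
      using that by (intro sum.cong refl) (auto simp: u)
    then show ?thesis using that by (simp add: ix)
  qed
  have z: "(U * B) $$ (i, j) = 0" if "i < n" "j < n" "i < k \<or> j < k" "i \<noteq> j" for i j
  proof (cases "i < k")
    case True
    then show ?thesis using same[of i j] zero[of i j] that by simp
  next
    case False
    then have j: "j < k" using that by simp
    have "U $$ (i, l) * B $$ (l, j) = 0" if "l < n" for l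
      using zero[of l j] u[of i l] False j that \<open>i < n\<close> \<open>j < n\<close> \<open>i \<noteq> j\<close> by (cases "l = j") auto
    then show ?thesis using that by (simp add: ix)
  qed
  have d: "(U * B) $$ (t, t) dvd (U * B) $$ (i, j)"
    if "t < k" "i < n" "j < n" "t \<le> i" "t \<le> j" for t i j
  proof -
    have "B $$ (t, t) dvd U $$ (i, l) * B $$ (l, j)" if "l < n" for l
    proof (cases "t \<le> l")
      case True
      then show ?thesis using dv[of t l j] that \<open>t < k\<close> \<open>j < n\<close> \<open>t \<le> j\<close> by simp
    next
      case False
      then show ?thesis using u[of i l] that \<open>i < n\<close> \<open>t \<le> i\<close> \<open>t < k\<close> by auto
    qed
    then have "B $$ (t, t) dvd (\<Sum>l<n. U $$ (i, l) * B $$ (l, j))"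
      by (intro dvd_sum) auto
    then show ?thesis using that k same[of t t] ix[of i j] by simp
  qed
  have "equiv_mat n A (U * B)"
    using equiv_mat_mult_left[OF _ U B, of A] red by (simp add: reduced_upto_def)
  moreover have "U * B \<in> carrier_mat n n" using Uc B by simp
  ultimately show ?thesis
    unfolding reduced_upto_def using z d by blast
qed

lemma equiv_mat_transpose:
  assumes "equiv_mat n A B" "B \<in> carrier_mat n n"
  shows "equiv_mat n (transpose_mat A) (transpose_mat B)"
proof -
  obtain P P' Q Q' where P: "inverse_pair n P P'" and Q: "inverse_pair n Q Q'"
    and A: "A = P * B * Q" using assms(1) unfolding equiv_mat_def by blast
  note c = inverse_pairD(1,2)[OF P] inverse_pairD(1,2)[OF Q]
  have "transpose_mat A = transpose_mat Q * transpose_mat (P * B)"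
    unfolding A using c assms(2) by (intro transpose_mult) auto
  also have "transpose_mat (P * B) = transpose_mat B * transpose_mat P"
    using c assms(2) by (intro transpose_mult) auto
  also have "transpose_mat Q * (transpose_mat B * transpose_mat P) =
      transpose_mat Q * transpose_mat B * transpose_mat P"
    using c assms(2) by (intro assoc_mult_mat[symmetric]) auto
  finally show ?thesis
    using inverse_pair_transpose[OF P] inverse_pair_transpose[OF Q]
    unfolding equiv_mat_def by blast
qed

lemma reduced_upto_transpose:
  assumes "reduced_upto n k A B" "k \<le> n"
  shows "reduced_upto n k (transpose_mat A) (transpose_mat B)"
proof -
  have B: "B \<in> carrier_mat n n" and e: "equiv_mat n A B"
    and z: "\<And>i j. i < n \<Longrightarrow> j < n \<Longrightarrow> i < k \<or> j < k \<Longrightarrow> i \<noteq> j \<Longrightarrow> B $$ (i, j) = 0"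
    and d: "\<And>t i j. t < k \<Longrightarrow> i < n \<Longrightarrow> j < n \<Longrightarrow> t \<le> i \<Longrightarrow> t \<le> j \<Longrightarrow> B $$ (t, t) dvd B $$ (i, j)"
    using assms(1) unfolding reduced_upto_def by blast+
  show ?thesis
    unfolding reduced_upto_def
  proof (intro conjI allI impI)
    show "equiv_mat n (transpose_mat A) (transpose_mat B)" by (rule equiv_mat_transpose[OF e B])
  qed (use B z d assms(2) in auto)
qed

lemma reduced_upto_mult_right:
  assumes red: "reduced_upto n k A B" and U: "inverse_pair n U U'" and low: "fixes_below n k U"
    and k: "k \<le> n"
  shows "reduced_upto n k A (B * transpose_mat U)"
proof -
  have B: "B \<in> carrier_mat n n" and Uc: "U \<in> carrier_mat n n"
    using red U by (auto simp: reduced_upto_def inverse_pair_def)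
  have "reduced_upto n k (transpose_mat A) (U * transpose_mat B)"
    by (rule reduced_upto_mult_left[OF reduced_upto_transpose[OF red k] U low k])
  from reduced_upto_transpose[OF this k]
  have "reduced_upto n k A (transpose_mat (U * transpose_mat B))" by simp
  also have "transpose_mat (U * transpose_mat B) = B * transpose_mat U"
    using transpose_mult[of U n n "transpose_mat B" n] B Uc by simp
  finally show ?thesis .
qed

text \<open>Left multiplication adds \<open>q i\<close> times row \<open>c\<close> to all other rows
  \<open>i\<close> at once; the transpose on the right does the same for columns. The diagonal is
  tested first, so the value \<open>q c\<close> never enters.\<close>

definition add_col_mat :: "nat \<Rightarrow> nat \<Rightarrow> (nat \<Rightarrow> 'b::comm_ring_1) \<Rightarrow> 'b mat" where
  "add_col_mat n c q = mat n n (\<lambda>(i, j). if i = j then 1 else if j = c then q i else 0)"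

lemma add_col_mat_carrier [simp]: "add_col_mat n c q \<in> carrier_mat n n"
  by (simp add: add_col_mat_def)

lemma add_col_mat_mult:
  assumes "B \<in> carrier_mat n m" "i < n" "j < m" "c < n"
  shows "(add_col_mat n c q * B) $$ (i, j) =
     B $$ (i, j) + (if i = c then 0 else q i * B $$ (c, j))"
proof -
  have "(add_col_mat n c q * B) $$ (i, j) = (\<Sum>l<n. add_col_mat n c q $$ (i, l) * B $$ (l, j))"
    using assms by (intro mult_mat_index) auto
  also have "\<dots> = (\<Sum>l<n. (if l = i then B $$ (l, j) else 0) +
      (if l = c then (if i = c then 0 else q i * B $$ (l, j)) else 0))"
    using assms by (intro sum.cong refl) (auto simp: add_col_mat_def)
  finally show ?thesis using assms by (simp add: sum.distrib)
qed

lemma add_col_mat_inverse_pair: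
  assumes "c < n"
  shows "inverse_pair n (add_col_mat n c q) (add_col_mat n c (\<lambda>i. - q i))"
proof -
  have *: "add_col_mat n c q * add_col_mat n c (\<lambda>i. - q i) = 1\<^sub>m n" for q :: "nat \<Rightarrow> 'a"
  proof (rule eq_matI)
    fix i j assume "i < dim_row (1\<^sub>m n :: 'a mat)" "j < dim_col (1\<^sub>m n :: 'a mat)"
    then have ij: "i < n" "j < n" by auto
    show "(add_col_mat n c q * add_col_mat n c (\<lambda>i. - q i)) $$ (i, j) = 1\<^sub>m n $$ (i, j)"
      unfolding add_col_mat_mult[OF add_col_mat_carrier ij assms]
      using ij assms by (simp add: add_col_mat_def)
  qed (auto simp: add_col_mat_def)
  from *[of q] *[of "\<lambda>i. - q i"] show ?thesis by (simp add: inverse_pair_def)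
qed

lemma reduced_upto_add_row:
  assumes red: "reduced_upto n k A B" and "c < n" "k \<le> c" "\<And>i. i < k \<Longrightarrow> q i = 0"
  shows "reduced_upto n k A (add_col_mat n c q * B)"
  by (rule reduced_upto_mult_left[OF red add_col_mat_inverse_pair])
     (use assms in \<open>auto simp: fixes_below_def add_col_mat_def\<close>)

lemma reduced_upto_add_col:
  assumes red: "reduced_upto n k A B" and "c < n" "k \<le> c" "\<And>i. i < k \<Longrightarrow> q i = 0"
  shows "reduced_upto n k A (B * transpose_mat (add_col_mat n c q))"
  by (rule reduced_upto_mult_right[OF red add_col_mat_inverse_pair])
     (use assms in \<open>auto simp: fixes_below_def add_col_mat_def\<close>)

lemma add_col_mat_mult_right:
  assumes "B \<in> carrier_mat m n" "i < m" "j < n" "c < n"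
  shows "(B * transpose_mat (add_col_mat n c q)) $$ (i, j) =
     B $$ (i, j) + (if j = c then 0 else q j * B $$ (i, c))"
proof -
  have "B * transpose_mat (add_col_mat n c q) = transpose_mat (add_col_mat n c q * transpose_mat B)"
    using transpose_mult[of "add_col_mat n c q" n n "transpose_mat B" m] assms by simp
  moreover have "transpose_mat (add_col_mat n c q * transpose_mat B) $$ (i, j) =
      (add_col_mat n c q * transpose_mat B) $$ (j, i)"
    using assms by (intro index_transpose_mat(1)) (auto simp: carrier_matD[OF add_col_mat_carrier])
  ultimately show ?thesis
    using add_col_mat_mult[of "transpose_mat B" n m j i c q] assms
    by (simp del: index_mult_mat(1))
qed

lemma swaprows_mat_pair:
  assumes "k < n" "l < n"
  shows "inverse_pair n (swaprows_mat n k l) (swaprows_mat n k l)"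
  using swaprows_mat_inv[OF assms] by (simp add: inverse_pair_def)

lemma reduced_upto_swap:
  assumes red: "reduced_upto n k A B" and "k \<le> i" "k \<le> j" "i < n" "j < n"
  obtains C where "reduced_upto n k A C" "C $$ (k, k) = B $$ (i, j)"
proof -
  have B: "B \<in> carrier_mat n n" using red by (simp add: reduced_upto_def)
  define C1 where "C1 = swaprows k i B"
  have C1: "C1 = swaprows_mat n k i * B"
    unfolding C1_def using assms B by (intro swaprows_mat) auto
  have r1: "reduced_upto n k A C1" unfolding C1
    by (rule reduced_upto_mult_left[OF red swaprows_mat_pair])
       (use assms in \<open>auto simp: fixes_below_def\<close>)
  have C1c: "C1 \<in> carrier_mat n n" using r1 by (simp add: reduced_upto_def)
  have r2: "reduced_upto n k A (C1 * transpose_mat (swaprows_mat n k j))"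
    by (rule reduced_upto_mult_right[OF r1 swaprows_mat_pair])
       (use assms in \<open>auto simp: fixes_below_def\<close>)
  have "C1 * transpose_mat (swaprows_mat n k j) =
      transpose_mat (swaprows_mat n k j * transpose_mat C1)"
    using transpose_mult[of "swaprows_mat n k j" n n "transpose_mat C1" n] C1c by simp
  also have "swaprows_mat n k j * transpose_mat C1 = swaprows k j (transpose_mat C1)"
    using C1c assms by (intro swaprows_mat[symmetric]) auto
  finally have "(C1 * transpose_mat (swaprows_mat n k j)) $$ (k, k) = B $$ (i, j)"
    using C1c assms B by (simp del: index_mult_mat(1) add: C1_def)
  then show thesis using that r2 by blast
qed

lemma reduced_upto_Suc:
  assumes red: "reduced_upto n k A B"
    and row: "\<And>j. k < j \<Longrightarrow> j < n \<Longrightarrow> B $$ (k, j) = 0"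
    and col: "\<And>i. k < i \<Longrightarrow> i < n \<Longrightarrow> B $$ (i, k) = 0"
    and dvd: "\<And>i j. k \<le> i \<Longrightarrow> k \<le> j \<Longrightarrow> i < n \<Longrightarrow> j < n \<Longrightarrow> B $$ (k, k) dvd B $$ (i, j)"
  shows "reduced_upto n (Suc k) A B"
proof -
  have "B $$ (i, j) = 0" if "i < n" "j < n" "i < Suc k \<or> j < Suc k" "i \<noteq> j" for i j
  proof (cases "i < k \<or> j < k")
    case True
    then show ?thesis using red that by (auto simp: reduced_upto_def)
  next
    case False
    then have "i = k \<and> k < j \<or> j = k \<and> k < i" using that by linarith
    then show ?thesis using that row[of j] col[of i] by auto
  qed
  moreover have "B $$ (t, t) dvd B $$ (i, j)"
    if "t < Suc k" "i < n" "j < n" "t \<le> i" "t \<le> j" for t i j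
  proof (cases "t = k")
    case True
    then show ?thesis using dvd that by simp
  next
    case False
    then have "t < k" using that by simp
    then show ?thesis using red that unfolding reduced_upto_def by blast
  qed
  moreover have "B \<in> carrier_mat n n" "equiv_mat n A B" using red by (simp_all add: reduced_upto_def)
  ultimately show ?thesis unfolding reduced_upto_def by (intro conjI allI impI) simp_all
qed

text \<open>The pivot has least degree among the nonzero trailing entries of all reachable matrices,
  not just of the current one. A nonzero remainder of a division by it would be a reachable entry of
  smaller degree, so the pivot divides its row and column in every reachable matrix that carries it
  at \<open>(k, k)\<close>. No repeated division is involved.\<close>

lemma reduced_upto_step:
  fixes A :: "'a::field poly mat"
  assumes red: "reduced_upto n k A B0" and k: "k < n"
  shows "\<exists>B. reduced_upto n (Suc k) A B"
proof (cases "\<forall>i<n. \<forall>j<n. k \<le> i \<longrightarrow> k \<le> j \<longrightarrow> B0 $$ (i, j) = 0")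
  case True
  have "reduced_upto n (Suc k) A B0"
    by (intro reduced_upto_Suc[OF red]) (use True k in auto)
  then show ?thesis ..
next
  case False
  define Q where "Q = (\<lambda>d. \<exists>B i j. reduced_upto n k A B \<and> k \<le> i \<and> k \<le> j \<and> i < n \<and> j < n \<and>
      B $$ (i, j) \<noteq> 0 \<and> Polynomial.degree (B $$ (i, j)) = d)"
  define d where "d = (LEAST d. Q d)"
  obtain i0 j0 where "i0 < n" "j0 < n" "k \<le> i0" "k \<le> j0" "B0 $$ (i0, j0) \<noteq> 0"
    using False by blast
  then have "Q (Polynomial.degree (B0 $$ (i0, j0)))" using red unfolding Q_def by blast
  then have "\<exists>d. Q d" ..
  then have "Q d" unfolding d_def by (rule LeastI_ex)
  then obtain B i j where B: "reduced_upto n k A B" "k \<le> i" "k \<le> j" "i < n" "j < n"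
      "B $$ (i, j) \<noteq> 0" "Polynomial.degree (B $$ (i, j)) = d"
    unfolding Q_def by blast
  have least: "d \<le> Polynomial.degree (C $$ (i, j))"
    if "reduced_upto n k A C" "k \<le> i" "k \<le> j" "i < n" "j < n" "C $$ (i, j) \<noteq> 0" for C i j
  proof -
    have "Q (Polynomial.degree (C $$ (i, j)))" using that unfolding Q_def by blast
    then show ?thesis unfolding d_def by (rule Least_le)
  qed
  define p where "p = B $$ (i, j)"
  have p0: "p \<noteq> 0" and pd: "Polynomial.degree p = d" using B(6,7) by (simp_all add: p_def)
  obtain B1 where B1: "reduced_upto n k A B1" "B1 $$ (k, k) = p"
    using reduced_upto_swap[OF B(1-5)] unfolding p_def by blast
  have col: "p dvd C $$ (l, k)"
    if C: "reduced_upto n k A C" "C $$ (k, k) = p" and l: "k \<le> l" "l < n" for C l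
  proof (cases "l = k")
    case False
    define q where "q = (\<lambda>m. if m = l then - (C $$ (l, k) div p) else 0)"
    have Cc: "C \<in> carrier_mat n n" using C by (simp add: reduced_upto_def)
    have r: "reduced_upto n k A (add_col_mat n k q * C)"
      by (rule reduced_upto_add_row[OF C(1) k]) (use l False in \<open>auto simp: q_def\<close>)
    have e: "(add_col_mat n k q * C) $$ (l, k) = C $$ (l, k) mod p"
      using add_col_mat_mult[OF Cc l(2) k k, of q] False C(2)
      by (simp add: q_def minus_div_mult_eq_mod[symmetric])
    have "C $$ (l, k) mod p = 0"
      using least[OF r l(1) order.refl l(2) k] degree_mod_less[OF p0, of "C $$ (l, k)"] pd
      unfolding e by (metis leD)
    then show ?thesis by (simp add: mod_eq_0_iff_dvd)
  qed (use C in auto)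
  have row: "p dvd C $$ (k, l)"
    if C: "reduced_upto n k A C" "C $$ (k, k) = p" and l: "k \<le> l" "l < n" for C l
  proof (cases "l = k")
    case False
    define q where "q = (\<lambda>m. if m = l then - (C $$ (k, l) div p) else 0)"
    have Cc: "C \<in> carrier_mat n n" using C by (simp add: reduced_upto_def)
    have r: "reduced_upto n k A (C * transpose_mat (add_col_mat n k q))"
      by (rule reduced_upto_add_col[OF C(1) k]) (use l False in \<open>auto simp: q_def\<close>)
    have e: "(C * transpose_mat (add_col_mat n k q)) $$ (k, l) = C $$ (k, l) mod p"
      using add_col_mat_mult_right[OF Cc k l(2) k, of q] False C(2)
      by (simp add: q_def minus_div_mult_eq_mod[symmetric])
    have "C $$ (k, l) mod p = 0"
      using least[OF r order.refl l(1) k l(2)] degree_mod_less[OF p0, of "C $$ (k, l)"] pd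
      unfolding e by (metis leD)
    then show ?thesis by (simp add: mod_eq_0_iff_dvd)
  qed (use C in auto)
  define B2 where "B2 = add_col_mat n k (\<lambda>m. if m \<le> k then 0 else - (B1 $$ (m, k) div p)) * B1"
  have B1c: "B1 \<in> carrier_mat n n" using B1 by (simp add: reduced_upto_def)
  have B2: "reduced_upto n k A B2" unfolding B2_def
    by (rule reduced_upto_add_row[OF B1(1) k]) auto
  have B2kk: "B2 $$ (k, k) = p"
    unfolding B2_def using add_col_mat_mult[OF B1c k k k] B1(2) by simp
  have B2z: "B2 $$ (l, k) = 0" if "k < l" "l < n" for l
    unfolding B2_def using add_col_mat_mult[OF B1c that(2) k k] B1(2) col[OF B1, of l] that p0
    by simp
  define B3 where "B3 = B2 * transpose_mat
      (add_col_mat n k (\<lambda>m. if m \<le> k then 0 else - (B2 $$ (k, m) div p)))"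
  have B2c: "B2 \<in> carrier_mat n n" using B2 by (simp add: reduced_upto_def)
  have B3: "reduced_upto n k A B3" unfolding B3_def
    by (rule reduced_upto_add_col[OF B2 k]) auto
  have B3kk: "B3 $$ (k, k) = p"
    unfolding B3_def using add_col_mat_mult_right[OF B2c k k k] B2kk by simp
  have B3r: "B3 $$ (k, l) = 0" if "k < l" "l < n" for l
    unfolding B3_def using add_col_mat_mult_right[OF B2c k that(2) k] B2kk row[OF B2 B2kk, of l] that p0
    by simp
  have B3l: "B3 $$ (l, k) = 0" if "k < l" "l < n" for l
    unfolding B3_def using add_col_mat_mult_right[OF B2c that(2) k k] B2z[OF that] by simp
  have B3c: "B3 \<in> carrier_mat n n" using B3 by (simp add: reduced_upto_def)
  \<comment> \<open>Adding row \<open>i\<close> to row \<open>k\<close> moves the entry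
    \<open>(i, j)\<close> into the pivot row and leaves the pivot unchanged, since column
    \<open>k\<close> is already cleared. Divisibility along the pivot row then covers the whole
    block.\<close>
  have all: "p dvd B3 $$ (i, j)" if ij: "k < i" "k < j" "i < n" "j < n" for i j
  proof -
    define q where "q = (\<lambda>m. if m = k then 1 else 0 :: 'a poly)"
    have r: "reduced_upto n k A (add_col_mat n i q * B3)"
      by (rule reduced_upto_add_row[OF B3]) (use ij in \<open>auto simp: q_def\<close>)
    have "(add_col_mat n i q * B3) $$ (k, k) = p"
      using add_col_mat_mult[OF B3c k k ij(3), of q] ij B3kk B3l[of i] by (simp add: q_def)
    from row[OF r this, of j] show ?thesis
      using add_col_mat_mult[OF B3c k ij(4) ij(3), of q] ij B3r[of j] by (simp add: q_def)
  qed
  have all': "p dvd B3 $$ (i, j)" if "k \<le> i" "k \<le> j" "i < n" "j < n" for i j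
    using all[of i j] B3kk B3l[of i] B3r[of j] that by (cases "i = k"; cases "j = k") auto
  have "reduced_upto n (Suc k) A B3"
    by (rule reduced_upto_Suc[OF B3]) (use B3l B3r all' B3kk k in auto)
  then show ?thesis ..
qed

theorem smith_normal_form:
  fixes A :: "'a::field poly mat"
  assumes A: "A \<in> carrier_mat n n"
  obtains P P' Q Q' S where "inverse_pair n P P'" "inverse_pair n Q Q'"
    "A = P * mat_diag n S * Q" "\<And>i j. i \<le> j \<Longrightarrow> j < n \<Longrightarrow> S i dvd S j"
proof -
  have "k \<le> n \<Longrightarrow> \<exists>B. reduced_upto n k A B" for k
  proof (induction k)
    case 0
    have "reduced_upto n 0 A A" using A equiv_mat_refl[OF A] by (simp add: reduced_upto_def)
    then show ?case ..
  next
    case (Suc k)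
    then show ?case using reduced_upto_step[of n k A] by auto
  qed
  then obtain B where B: "reduced_upto n n A B" by blast
  define S where "S = (\<lambda>i. B $$ (i, i))"
  have B: "B \<in> carrier_mat n n" and e: "equiv_mat n A B"
    and z: "\<And>i j. i < n \<Longrightarrow> j < n \<Longrightarrow> i < n \<or> j < n \<Longrightarrow> i \<noteq> j \<Longrightarrow> B $$ (i, j) = 0"
    and d: "\<And>t i j. t < n \<Longrightarrow> i < n \<Longrightarrow> j < n \<Longrightarrow> t \<le> i \<Longrightarrow> t \<le> j \<Longrightarrow> B $$ (t, t) dvd B $$ (i, j)"
    using B unfolding reduced_upto_def by blast+
  have diag: "B = mat_diag n S"
    by (rule eq_matI) (use B z in \<open>auto simp: mat_diag_def S_def\<close>)
  obtain P P' Q Q' where "inverse_pair n P P'" "inverse_pair n Q Q'" "A = P * B * Q"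
    using e unfolding equiv_mat_def by blast
  moreover have "S i dvd S j" if "i \<le> j" "j < n" for i j
    unfolding S_def by (rule d) (use that in auto)
  ultimately show thesis using that unfolding diag by blast
qed

section \<open>Minors and bounded rank\<close>

text \<open>
  Index functions instead of index sets: repeated or permuted rows and columns are allowed, so that
  expanding a product never requires sorting.
\<close>

definition fminor :: "nat \<Rightarrow> 'b::comm_ring_1 mat \<Rightarrow> (nat \<Rightarrow> nat) \<Rightarrow> (nat \<Rightarrow> nat) \<Rightarrow> 'b" where
  "fminor k M f g = Determinant.det (mat k k (\<lambda>(i, j). M $$ (f i, g j)))"

definition ring_ideal :: "'b::comm_ring_1 set \<Rightarrow> bool" where
  "ring_ideal J \<longleftrightarrow> 0 \<in> J \<and> (\<forall>x\<in>J. \<forall>y\<in>J. x + y \<in> J) \<and> (\<forall>c. \<forall>x\<in>J. c * x \<in> J)"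

text \<open>One notion for three purposes: with the zero ideal it expresses a rank bound, with the
  multiples of \<open>e\<close> a common divisor of minors, and with the ideal of polynomials that
  have a homogenization divisible by \<open>e\<close> it yields the gcd of homogenized
  minors.\<close>

definition fminors_in :: "nat \<Rightarrow> 'b::comm_ring_1 mat \<Rightarrow> 'b set \<Rightarrow> bool" where
  "fminors_in k M J \<longleftrightarrow> (\<forall>f g. (\<forall>i<k. f i < dim_row M) \<longrightarrow> (\<forall>i<k. g i < dim_col M) \<longrightarrow>
     fminor k M f g \<in> J)"

lemma ring_ideal_sum:
  assumes "ring_ideal J" "\<And>x. x \<in> A \<Longrightarrow> f x \<in> J"
  shows "sum f A \<in> J"
  using assms(2)
proof (induction A rule: infinite_finite_induct)
  case (insert x F)
  then show ?case using assms(1) by (simp add: ring_ideal_def)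
qed (use assms(1) in \<open>simp_all add: ring_ideal_def\<close>)

lemma ring_ideal_zero: "ring_ideal {0}"
  by (simp add: ring_ideal_def)

lemma ring_ideal_dvd: "ring_ideal {x. e dvd x}"
  by (simp add: ring_ideal_def)

lemma fminor_transpose:
  assumes "\<And>i. i < k \<Longrightarrow> f i < dim_row M" "\<And>i. i < k \<Longrightarrow> g i < dim_col M"
  shows "fminor k (transpose_mat M) g f = fminor k M f g"
proof -
  have "mat k k (\<lambda>(i, j). transpose_mat M $$ (g i, f j)) =
      transpose_mat (mat k k (\<lambda>(i, j). M $$ (f i, g j)))"
    by (rule eq_matI) (use assms in auto)
  then show ?thesis
    by (simp add: fminor_def det_transpose[of _ k])
qed

lemma fminors_in_transpose:
  assumes "fminors_in k M J"
  shows "fminors_in k (transpose_mat M) J"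
  using assms fminor_transpose[of k _ M] unfolding fminors_in_def by simp

text \<open>A weak Cauchy-Binet formula that suffices for ideals: by multilinearity in the rows, a
  minor of \<open>Q * M\<close> is a combination of minors of \<open>M\<close> with arbitrary,
  possibly repeated, row choices \<open>h\<close>.\<close>

lemma fminors_in_mult_left:
  fixes M :: "'b::comm_ring_1 mat"
  assumes J: "ring_ideal J" and M: "M \<in> carrier_mat n m" and Q: "Q \<in> carrier_mat p n"
    and mem: "fminors_in k M J"
  shows "fminors_in k (Q * M) J"
  unfolding fminors_in_def
proof (intro allI impI)
  fix f g assume "\<forall>i<k. f i < dim_row (Q * M)" "\<forall>i<k. g i < dim_col (Q * M)"
  then have f: "\<And>i. i < k \<Longrightarrow> f i < p" and g: "\<And>i. i < k \<Longrightarrow> g i < m" using M Q by auto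
  define a where "a = (\<lambda>i l. Q $$ (f i, l) \<cdot>\<^sub>v vec k (\<lambda>j. M $$ (l, g j)))"
  have ac: "a i l \<in> carrier_vec k" for i l by (simp add: a_def)
  have "mat k k (\<lambda>(i, j). (Q * M) $$ (f i, g j)) =
      mat\<^sub>r k k (\<lambda>i. finsum_vec TYPE('b) k (a i) {0..<n})"
  proof (rule eq_matI, goal_cases)
    case (1 i j)
    then have ij: "i < k" "j < k" by auto
    have "(Q * M) $$ (f i, g j) = (\<Sum>l<n. Q $$ (f i, l) * M $$ (l, g j))"
      by (rule mult_mat_index[OF Q M f[OF ij(1)] g[OF ij(2)]])
    also have "\<dots> = finsum_vec TYPE('b) k (a i) {0..<n} $ j"
      using ij ac by (subst index_finsum_vec) (auto simp: a_def atLeast0LessThan)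
    finally show ?case using ij by simp
  qed auto
  then have "fminor k (Q * M) f g =
      Determinant.det (mat\<^sub>r k k (\<lambda>i. finsum_vec TYPE('b) k (a i) {0..<n}))"
    by (simp add: fminor_def)
  also have "\<dots> = (\<Sum>h | (\<forall>i\<in>{0..<k}. h i \<in> {0..<n}) \<and> (\<forall>i. i \<notin> {0..<k} \<longrightarrow> h i = i).
      Determinant.det (mat\<^sub>r k k (\<lambda>i. a i (h i))))"
    by (rule det_linear_rows_sum) (use ac in auto)
  also have "\<dots> \<in> J"
  proof (rule ring_ideal_sum[OF J])
    fix h assume "h \<in> {h. (\<forall>i\<in>{0..<k}. h i \<in> {0..<n}) \<and> (\<forall>i. i \<notin> {0..<k} \<longrightarrow> h i = i)}"
    then have h: "\<forall>i<k. h i < n" by auto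
    have "Determinant.det (mat\<^sub>r k k (\<lambda>i. a i (h i))) =
        prod (\<lambda>i. Q $$ (f i, h i)) {0..<k} *
        Determinant.det (mat\<^sub>r k k (\<lambda>i. vec k (\<lambda>j. M $$ (h i, g j))))"
      unfolding a_def by (rule det_rows_mul) auto
    also have "mat\<^sub>r k k (\<lambda>i. vec k (\<lambda>j. M $$ (h i, g j))) = mat k k (\<lambda>(i, j). M $$ (h i, g j))"
      by (rule eq_matI) auto
    also have "Determinant.det \<dots> \<in> J"
      using mem h g M unfolding fminors_in_def fminor_def by auto
    then have "prod (\<lambda>i. Q $$ (f i, h i)) {0..<k} *
        Determinant.det (mat k k (\<lambda>(i, j). M $$ (h i, g j))) \<in> J"
      using J by (simp add: ring_ideal_def)
    finally show "Determinant.det (mat\<^sub>r k k (\<lambda>i. a i (h i))) \<in> J" .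
  qed
  finally show "fminor k (Q * M) f g \<in> J" .
qed

lemma fminors_in_mult_right:
  assumes J: "ring_ideal J" and M: "M \<in> carrier_mat n m" and Q: "Q \<in> carrier_mat m p"
    and mem: "fminors_in k M J"
  shows "fminors_in k (M * Q) J"
proof -
  have "fminors_in k (transpose_mat Q * transpose_mat M) J"
    by (rule fminors_in_mult_left[OF J _ _ fminors_in_transpose[OF mem]]) (use M Q in auto)
  from fminors_in_transpose[OF this] show ?thesis
    using transpose_mult[OF M Q] by (metis transpose_transpose)
qed

lemma fminors_in_equiv:
  assumes J: "ring_ideal J" and P: "inverse_pair n P P'" and Q: "inverse_pair n Q Q'"
    and M: "M \<in> carrier_mat n n"
  shows "fminors_in k (P * M * Q) J \<longleftrightarrow> fminors_in k M J"
proof -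
  note c = inverse_pairD(1,2)[OF P] inverse_pairD(1,2)[OF Q]
  have fwd: "fminors_in k (P * M * Q) J"
    if "fminors_in k M J" "M \<in> carrier_mat n n" "P \<in> carrier_mat n n" "Q \<in> carrier_mat n n" for M P Q
    by (rule fminors_in_mult_right[OF J _ _ fminors_in_mult_left[OF J _ _ that(1)]])
       (use that in auto)
  have "P' * (P * M * Q) * Q' = P' * (P * M * Q * Q')"
    using c M by (intro assoc_mult_mat) auto
  also have "P * M * Q * Q' = P * M"
    by (rule inverse_pair_cancel_right[OF Q]) (use c M in auto)
  also have "P' * (P * M) = M" by (rule inverse_pair_cancel[OF P M])
  finally have "P' * (P * M * Q) * Q' = M" .
  then show ?thesis
    using fwd[of M P Q] fwd[of "P * M * Q" P' Q'] c M by auto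
qed

lemma fminor_not_inj:
  assumes "\<not> inj_on f {..<k}"
  shows "fminor k M f g = 0"
proof -
  obtain i j where ij: "i < k" "j < k" "i \<noteq> j" "f i = f j" using assms by (auto simp: inj_on_def)
  show ?thesis unfolding fminor_def
    by (rule det_identical_rows[of _ k i j]) (use ij in \<open>auto intro!: eq_vecI\<close>)
qed

text \<open>The permutation sends \<open>i\<close> to the number of elements of the image below
  \<open>f i\<close>, which is the position at which \<open>pick\<close> finds
  \<open>f i\<close>.\<close>

lemma pick_perm:
  assumes "inj_on f {..<k}"
  obtains p where "p permutes {0..<k}" "\<And>i. i < k \<Longrightarrow> pick (f ` {..<k}) (p i) = f i"
proof -
  define I where "I = f ` {..<k}"
  have fin: "finite I" and card: "card I = k" using assms by (auto simp: I_def card_image)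
  define p where "p = (\<lambda>i. if i < k then card {a\<in>I. a < f i} else i)"
  have pick: "pick I (p i) = f i" if "i < k" for i
    using pick_card_in_set[of "f i" I] that by (simp add: p_def I_def)
  have "p i < k" if "i < k" for i
  proof -
    have "{a\<in>I. a < f i} \<subset> I" using that by (auto simp: I_def)
    then show ?thesis using psubset_card_mono[OF fin] card that by (simp add: p_def)
  qed
  moreover have "inj_on p {..<k}"
    using pick assms by (metis (no_types, lifting) inj_on_def lessThan_iff)
  ultimately have "bij_betw p {0..<k} {0..<k}"
    by (simp add: bij_betw_def atLeast0LessThan endo_inj_surj image_subset_iff)
  then have "p permutes {0..<k}"
    by (rule bij_imp_permutes) (auto simp: p_def)
  with pick show thesis using that unfolding I_def by blast
qed

lemma fminor_pick_rows:
  assumes "inj_on f {..<k}"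
  shows "\<exists>c. fminor k M f g = c * fminor k M (pick (f ` {..<k})) g"
proof -
  obtain p where p: "p permutes {0..<k}" "\<And>i. i < k \<Longrightarrow> pick (f ` {..<k}) (p i) = f i"
    using pick_perm[OF assms] by blast
  define N where "N = mat k k (\<lambda>(i, j). M $$ (pick (f ` {..<k}) i, g j))"
  have "mat k k (\<lambda>(i, j). M $$ (f i, g j)) = mat k k (\<lambda>(i, j). N $$ (p i, j))"
    by (rule eq_matI) (use p permutes_in_image[OF p(1)] in \<open>auto simp: N_def\<close>)
  moreover have "Determinant.det (mat k k (\<lambda>(i, j). N $$ (p i, j))) = signof p * Determinant.det N"
    by (rule det_permute_rows[OF _ p(1)]) (simp add: N_def)
  ultimately show ?thesis by (auto simp: fminor_def N_def)
qed

lemma submatrix_fminor: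
  assumes "I \<subseteq> {..<dim_row M}" "L \<subseteq> {..<dim_col M}" "card I = k" "card L = k"
  shows "Determinant.det (submatrix M I L) = fminor k M (pick I) (pick L)"
proof -
  have "{i. i < dim_row M \<and> i \<in> I} = I" "{i. i < dim_col M \<and> i \<in> L} = L" using assms by auto
  then show ?thesis using assms by (simp add: submatrix_def fminor_def)
qed

text \<open>Index functions with a repetition give zero, injective ones give a sorted minor up to
  sign; so both families lie in the same ideals. This is the bridge to the index sets used for
  determinantal divisors.\<close>

lemma fminors_in_iff_minors:
  assumes J: "ring_ideal J"
  shows "fminors_in k M J \<longleftrightarrow> minors k M \<subseteq> J"
proof
  assume L: "fminors_in k M J"
  show "minors k M \<subseteq> J"
  proof
    fix x assume "x \<in> minors k M"
    then obtain I L' where IL: "I \<subseteq> {..<dim_row M}" "L' \<subseteq> {..<dim_col M}" "card I = k" "card L' = k"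
      and x: "x = Determinant.det (submatrix M I L')" by (auto simp: minors_def)
    have "pick I i < dim_row M" "pick L' i < dim_col M" if "i < k" for i
      using pick_in_set[of i I] pick_in_set[of i L'] IL that by auto
    then show "x \<in> J"
      using L unfolding x submatrix_fminor[OF IL] fminors_in_def by blast
  qed
next
  assume sub: "minors k M \<subseteq> J"
  show "fminors_in k M J" unfolding fminors_in_def
  proof (intro allI impI)
    fix f g assume f: "\<forall>i<k. f i < dim_row M" and g: "\<forall>i<k. g i < dim_col M"
    have tr: "fminor k (transpose_mat M) g f' = fminor k M f' g"
      if "\<And>i. i < k \<Longrightarrow> f' i < dim_row M" for f'
      by (rule fminor_transpose) (use that g in auto)
    show "fminor k M f g \<in> J"
    proof (cases "inj_on f {..<k} \<and> inj_on g {..<k}")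
      case False
      then have "fminor k M f g = 0"
        using fminor_not_inj[of f k M g] fminor_not_inj[of g k "transpose_mat M" f] tr[of f] f by auto
      then show ?thesis using J by (simp add: ring_ideal_def)
    next
      case True
      define I where "I = f ` {..<k}"
      define L where "L = g ` {..<k}"
      have IL: "I \<subseteq> {..<dim_row M}" "L \<subseteq> {..<dim_col M}" "card I = k" "card L = k"
        using True f g by (auto simp: I_def L_def card_image)
      have pI: "pick I i < dim_row M" and pL: "pick L i < dim_col M" if "i < k" for i
        using pick_in_set[of i I] pick_in_set[of i L] IL that by auto
      obtain c where c: "fminor k M f g = c * fminor k M (pick I) g"
        using fminor_pick_rows[of f k M g] True unfolding I_def by blast
      obtain d where d: "fminor k (transpose_mat M) g (pick I) =
          d * fminor k (transpose_mat M) (pick L) (pick I)"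
        using fminor_pick_rows[of g k "transpose_mat M" "pick I"] True unfolding L_def by blast
      have "fminor k M (pick I) g = d * fminor k M (pick I) (pick L)"
        using d tr[OF pI] fminor_transpose[of k "pick I" M "pick L"] pI pL by simp
      moreover have "fminor k M (pick I) (pick L) \<in> minors k M"
        unfolding minors_def using IL submatrix_fminor[OF IL, symmetric] by blast
      ultimately show ?thesis using c sub J by (auto simp: ring_ideal_def)
    qed
  qed
qed

text \<open>A factorization through \<open>q\<close> outer products makes sense over any commutative
  ring, so the same notion serves matrices over the field and over its polynomial ring. Over a field
  it means rank at most \<open>q\<close>.\<close>

definition rank_le :: "nat \<Rightarrow> nat \<Rightarrow> 'b::comm_ring_1 mat \<Rightarrow> bool" where
  "rank_le n q Y \<longleftrightarrow> (\<exists>u v. Y = mat n n (\<lambda>(i, j). \<Sum>l<q. u i l * v l j))"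

lemma rank_le_carrier: "rank_le n q Y \<Longrightarrow> Y \<in> carrier_mat n n"
  by (auto simp: rank_le_def)

lemma rank_le_mult_left:
  assumes Y: "rank_le n q Y" and C: "C \<in> carrier_mat n n"
  shows "rank_le n q (C * Y)"
proof -
  obtain u v where uv: "Y = mat n n (\<lambda>(i, j). \<Sum>l<q. u i l * v l j)" using Y by (auto simp: rank_le_def)
  have "C * Y = mat n n (\<lambda>(i, j). \<Sum>l<q. (\<Sum>m<n. C $$ (i, m) * u m l) * v l j)"
  proof (rule eq_matI, goal_cases)
    case (1 i j)
    then have ij: "i < n" "j < n" by auto
    have "(C * Y) $$ (i, j) = (\<Sum>m<n. C $$ (i, m) * (\<Sum>l<q. u m l * v l j))"
      unfolding mult_mat_index[OF C rank_le_carrier[OF Y] ij] using ij by (simp add: uv)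
    also have "\<dots> = (\<Sum>l<q. (\<Sum>m<n. C $$ (i, m) * u m l) * v l j)"
      unfolding sum_distrib_left sum_distrib_right
      by (subst sum.swap) (simp add: mult.assoc)
    finally show ?case using ij by simp
  qed (use C Y rank_le_carrier[OF Y] in auto)
  then show ?thesis unfolding rank_le_def
    by (intro exI[of _ "\<lambda>i l. \<Sum>m<n. C $$ (i, m) * u m l"] exI[of _ v])
qed

lemma rank_le_mult_right:
  assumes Y: "rank_le n q Y" and C: "C \<in> carrier_mat n n"
  shows "rank_le n q (Y * C)"
proof -
  obtain u v where uv: "Y = mat n n (\<lambda>(i, j). \<Sum>l<q. u i l * v l j)" using Y by (auto simp: rank_le_def)
  have "Y * C = mat n n (\<lambda>(i, j). \<Sum>l<q. u i l * (\<Sum>m<n. v l m * C $$ (m, j)))"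
  proof (rule eq_matI, goal_cases)
    case (1 i j)
    then have ij: "i < n" "j < n" by auto
    have "(Y * C) $$ (i, j) = (\<Sum>m<n. (\<Sum>l<q. u i l * v l m) * C $$ (m, j))"
      unfolding mult_mat_index[OF rank_le_carrier[OF Y] C ij] using ij by (simp add: uv)
    also have "\<dots> = (\<Sum>l<q. u i l * (\<Sum>m<n. v l m * C $$ (m, j)))"
      unfolding sum_distrib_left sum_distrib_right
      by (subst sum.swap) (simp add: mult.assoc)
    finally show ?case using ij by simp
  qed (use C Y rank_le_carrier[OF Y] in auto)
  then show ?thesis unfolding rank_le_def
    by (intro exI[of _ u] exI[of _ "\<lambda>l j. \<Sum>m<n. v l m * C $$ (m, j)"])
qed

lemma sum_lessThan_add:
  fixes f :: "nat \<Rightarrow> 'c::comm_monoid_add"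
  shows "sum f {..<p + q} = sum f {..<p} + (\<Sum>l<q. f (p + l))"
  by (induction q) (simp_all add: add.assoc)

lemma rank_le_add:
  assumes "rank_le n p Y" "rank_le n q Z"
  shows "rank_le n (p + q) (Y + Z)"
proof -
  obtain u v where uv: "Y = mat n n (\<lambda>(i, j). \<Sum>l<p. u i l * v l j)"
    using assms by (auto simp: rank_le_def)
  obtain u' v' where uv': "Z = mat n n (\<lambda>(i, j). \<Sum>l<q. u' i l * v' l j)"
    using assms by (auto simp: rank_le_def)
  have "Y + Z = mat n n (\<lambda>(i, j). \<Sum>l<p + q. (if l < p then u i l else u' i (l - p)) *
      (if l < p then v l j else v' (l - p) j))"
    by (rule eq_matI) (auto simp: uv uv' sum_lessThan_add)
  then show ?thesis unfolding rank_le_def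
    by (intro exI[of _ "\<lambda>i l. if l < p then u i l else u' i (l - p)"]
        exI[of _ "\<lambda>l j. if l < p then v l j else v' (l - p) j"])
qed

lemma rank_le_rows:
  assumes Y: "Y \<in> carrier_mat n n"
    and z: "\<And>i j. i < n \<Longrightarrow> j < n \<Longrightarrow> \<not> (s \<le> i \<and> i < s + q) \<Longrightarrow> Y $$ (i, j) = 0"
  shows "rank_le n q Y"
proof -
  have "Y $$ (i, j) = (\<Sum>l<q. (if i = s + l then 1 else 0) * Y $$ (s + l, j))"
    if ij: "i < n" "j < n" for i j
  proof (cases "s \<le> i \<and> i < s + q")
    case True
    have "(\<Sum>l<q. (if i = s + l then 1 else 0) * Y $$ (s + l, j)) =
        (\<Sum>l<q. if l = i - s then Y $$ (i, j) else 0)"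
      by (intro sum.cong refl) (use True in auto)
    then show ?thesis using True by auto
  next
    case False
    then show ?thesis using z[OF ij] by (auto intro!: sum.neutral[symmetric])
  qed
  then have "Y = mat n n (\<lambda>(i, j). \<Sum>l<q. (if i = s + l then 1 else 0) * Y $$ (s + l, j))"
    using Y by (intro eq_matI) auto
  then show ?thesis unfolding rank_le_def
    by (intro exI[of _ "\<lambda>i l. if i = s + l then 1 else 0"] exI[of _ "\<lambda>l j. Y $$ (s + l, j)"])
qed

lemma det_zero_column:
  fixes A :: "'b::comm_ring_1 mat"
  assumes A: "A \<in> carrier_mat k k" and j: "j < k" and z: "\<And>i. i < k \<Longrightarrow> A $$ (i, j) = 0"
  shows "Determinant.det A = 0"
proof -
  have "Determinant.det A = (\<Sum>i<k. A $$ (i, j) * cofactor A i j)"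
    by (rule laplace_expansion_column[OF A j])
  then show ?thesis using z by simp
qed

text \<open>Padding both factors to size \<open>k\<close> leaves a zero column at index
  \<open>q\<close> of the left one, so the product of determinants vanishes.\<close>

lemma rank_le_fminors:
  assumes Y: "rank_le n q Y" and qk: "q < k"
  shows "fminors_in k Y {0}"
  unfolding fminors_in_def
proof (intro allI impI)
  obtain u v where uv: "Y = mat n n (\<lambda>(i, j). \<Sum>l<q. u i l * v l j)" using Y by (auto simp: rank_le_def)
  fix f g assume fg: "\<forall>i<k. f i < dim_row Y" "\<forall>i<k. g i < dim_col Y"
  define U where "U = mat k k (\<lambda>(i, l). if l < q then u (f i) l else 0)"
  define V where "V = mat k k (\<lambda>(l, j). v l (g j))"
  have UV: "U \<in> carrier_mat k k" "V \<in> carrier_mat k k" by (simp_all add: U_def V_def)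
  have "mat k k (\<lambda>(i, j). Y $$ (f i, g j)) = U * V"
  proof (rule eq_matI, goal_cases)
    case (1 i j)
    then have ij: "i < k" "j < k" using UV by auto
    have "Y $$ (f i, g j) = (\<Sum>l<q. u (f i) l * v l (g j))"
      using fg ij by (simp add: uv)
    also have "\<dots> = (\<Sum>l<k. (if l < q then u (f i) l else 0) * v l (g j))"
      using qk by (intro sum.mono_neutral_cong_left) auto
    also have "\<dots> = (U * V) $$ (i, j)"
      unfolding mult_mat_index[OF UV ij] using ij by (intro sum.cong) (auto simp: U_def V_def)
    finally show ?case using ij by simp
  qed (use UV in auto)
  then have "fminor k Y f g = Determinant.det U * Determinant.det V"
    by (simp add: fminor_def det_mult[OF UV])
  moreover have "Determinant.det U = 0"
    by (rule det_zero_column[OF UV(1) qk]) (use qk in \<open>simp add: U_def\<close>)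
  ultimately show "fminor k Y f g \<in> {0}" by simp
qed

lemma dim_mat_diag [simp]: "dim_row (mat_diag n f) = n" "dim_col (mat_diag n f) = n"
  by (simp_all add: mat_diag_def)

lemma diag_mult_carrier [simp]:
  assumes "A \<in> carrier_mat n m"
  shows "mat_diag n f * A \<in> carrier_mat n m"
  using assms by (intro mult_carrier_mat[OF mat_diag_dim])

lemma mult_diag_carrier [simp]:
  assumes "A \<in> carrier_mat m n"
  shows "A * mat_diag n f \<in> carrier_mat m n"
  using assms by (rule mult_carrier_mat) simp

lemma det_diag:
  "Determinant.det (mat k k (\<lambda>(i, j). if i = j then S j else 0)) = (\<Prod>i<k. S i :: 'b::comm_ring_1)"
proof -
  let ?A = "mat k k (\<lambda>(i, j). if i = j then S j else 0)"
  have "Determinant.det ?A = prod_list (diag_mat ?A)"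
    by (rule det_upper_triangular[of _ k]) (auto simp: upper_triangular_def)
  also have "diag_mat ?A = map S [0..<k]" by (auto simp: diag_mat_def)
  also have "prod_list \<dots> = (\<Prod>i<k. S i)"
    by (simp add: prod.distinct_set_conv_list[symmetric] atLeast0LessThan)
  finally show ?thesis .
qed

lemma fminor_diag_id:
  assumes "k \<le> n"
  shows "fminor k (mat_diag n S) id id = (\<Prod>i<k. S i)"
proof -
  have "mat k k (\<lambda>(i, j). mat_diag n S $$ (id i, id j)) = mat k k (\<lambda>(i, j). if i = j then S j else 0)"
    by (rule eq_matI) (use assms in \<open>auto simp: mat_diag_def\<close>)
  then show ?thesis by (simp add: fminor_def det_diag)
qed

text \<open>The leading minor of size \<open>q + 1\<close> is the product of the first
  \<open>q + 1\<close> diagonal entries. One of them vanishes, and divisibility along the chain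
  passes the zero on to all later entries.\<close>

lemma smith_zero_tail:
  fixes S :: "nat \<Rightarrow> 'b::idom"
  assumes P: "inverse_pair n P P'" and Q: "inverse_pair n Q Q'"
    and Z: "Z = P * mat_diag n S * Q" and chain: "\<And>i j. i \<le> j \<Longrightarrow> j < n \<Longrightarrow> S i dvd S j"
    and min: "fminors_in (Suc q) Z {0}" and l: "q \<le> l" "l < n"
  shows "S l = 0"
proof -
  have "fminors_in (Suc q) (mat_diag n S) {0}"
    using min fminors_in_equiv[OF ring_ideal_zero P Q, of "mat_diag n S"] unfolding Z by simp
  then have "fminor (Suc q) (mat_diag n S) id id = 0"
    using l carrier_matD[OF mat_diag_dim[of n S]] unfolding fminors_in_def by auto
  then have "(\<Prod>i<Suc q. S i) = 0" using l by (subst (asm) fminor_diag_id) auto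
  then obtain i where "i \<le> q" "S i = 0" by (metis finite_lessThan lessThan_iff less_Suc_eq_le prod_zero_iff)
  then show ?thesis using chain[of i l] l by auto
qed

text \<open>
  The equation says that \<open>f\<close> annihilates the cokernel of \<open>D\<close> up to the \<open>q\<close> extra generators of \<open>Y\<close>.
\<close>

lemma invariant_factor_dvd:
  fixes p :: "nat \<Rightarrow> 'a::field poly"
  assumes P: "inverse_pair n P P'" and Q: "inverse_pair n Q Q'"
    and D: "D = P * mat_diag n p * Q" and chain: "\<And>i j. i \<le> j \<Longrightarrow> j < n \<Longrightarrow> p i dvd p j"
    and W: "W \<in> carrier_mat n n" and Y: "rank_le n q Y" and q: "q < n"
    and eq: "mat_diag n (\<lambda>_. f) = D * W + Y"
  shows "p (n - 1 - q) dvd f"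
proof -
  note c = inverse_pairD(1,2)[OF P] inverse_pairD(1,2)[OF Q]
  note Yc = rank_le_carrier[OF Y]
  define W' where "W' = Q * W * P"
  define Y' where "Y' = P' * Y * P"
  have W': "W' \<in> carrier_mat n n" and Y'c: "Y' \<in> carrier_mat n n"
    using c W Yc by (auto simp: W'_def Y'_def)
  have rY': "rank_le n q Y'"
    unfolding Y'_def by (intro rank_le_mult_right rank_le_mult_left Y c)
  have Dc: "D \<in> carrier_mat n n"
    unfolding D by (intro mult_carrier_mat[OF _ c(3)] mult_diag_carrier c(1))
  have PD: "P' * D = mat_diag n p * Q"
  proof -
    have "P * mat_diag n p * Q = P * (mat_diag n p * Q)"
      using c by (intro assoc_mult_mat) auto
    then show ?thesis unfolding D using inverse_pair_cancel(2)[OF P, of "mat_diag n p * Q" n] c by (simp del: assoc_mult_mat)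
  qed
  have "P' * mat_diag n (\<lambda>_. f) * P = mat_diag n (\<lambda>_. f) * P' * P"
    using c by (simp add: mat_diag_mult_left[of P' n n] mat_diag_mult_right[of P' n n] mult.commute)
  also have "\<dots> = mat_diag n (\<lambda>_. f)"
    by (rule inverse_pair_cancel_right(2)[OF P mat_diag_dim])
  finally have "mat_diag n (\<lambda>_. f) = P' * (D * W + Y) * P" using eq by simp
  also have "P' * (D * W + Y) = P' * (D * W) + P' * Y"
    using c Dc W Yc by (intro mult_add_distrib_mat) auto
  also have "P' * (D * W) = P' * D * W" using c Dc W by (intro assoc_mult_mat[symmetric]) auto
  also have "P' * D * W = mat_diag n p * (Q * W)"
    unfolding PD by (rule assoc_mult_mat[OF mat_diag_dim c(3) W])
  also have "(mat_diag n p * (Q * W) + P' * Y) * P = mat_diag n p * (Q * W) * P + P' * Y * P"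
    by (rule add_mult_distrib_mat[of _ n n]) (use c W Yc in auto)
  also have "mat_diag n p * (Q * W) * P = mat_diag n p * W'"
    unfolding W'_def by (rule assoc_mult_mat[OF mat_diag_dim _ c(1)]) (use c W in auto)
  finally have eq': "mat_diag n (\<lambda>_. f) = mat_diag n p * W' + Y'" by (simp add: Y'_def)
  obtain u v where uv: "Y' = mat n n (\<lambda>(i, j). \<Sum>l<q. u i l * v l j)"
    using rY' by (auto simp: rank_le_def)
  have entry: "(if i = j then f else 0) = p i * W' $$ (i, j) + (\<Sum>l<q. u i l * v l j)"
    if "i < n" "j < n" for i j
  proof -
    have "mat_diag n (\<lambda>_. f) $$ (i, j) = (mat_diag n p * W' + Y') $$ (i, j)" using eq' by simp
    then show ?thesis
      using that W' carrier_matD[OF mat_diag_dim[of n "\<lambda>_. f"]]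
      by (simp add: mat_diag_mult_left[OF W'] uv) (simp add: mat_diag_def split: if_splits)
  qed
  \<comment> \<open>The trailing block has size \<open>q + 1\<close>, one more than the number of
    generators in \<open>Y'\<close>, and all its diagonal entries \<open>p (s + i)\<close> are
    multiples of \<open>p s\<close>.\<close>
  define s where "s = n - 1 - q"
  define m where "m = Suc q"
  have sm: "s + m = n" using q by (simp add: s_def m_def)
  define U where "U = mat m m (\<lambda>(i, l). if l < q then u (s + i) l else 0)"
  have Uc: "U \<in> carrier_mat m m" by (simp add: U_def)
  obtain E E' F F' S where E: "inverse_pair m E E'" and F: "inverse_pair m F F'"
    and U: "U = E * mat_diag m S * F" and Sch: "\<And>i j. i \<le> j \<Longrightarrow> j < m \<Longrightarrow> S i dvd S j"
    using smith_normal_form[OF Uc] by metis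
  have "rank_le m q U" unfolding rank_le_def
  proof (intro exI, rule eq_matI)
    fix i j
    assume "i < dim_row (mat m m (\<lambda>(i, j). \<Sum>l<q. (\<lambda>i l. u (s + i) l) i l * (\<lambda>l j. if l = j then 1 else 0) l j))"
      "j < dim_col (mat m m (\<lambda>(i, j). \<Sum>l<q. (\<lambda>i l. u (s + i) l) i l * (\<lambda>l j. if l = j then 1 else 0) l j))"
    then have ij: "i < m" "j < m" by auto
    have "(\<Sum>l<q. u (s + i) l * (if l = j then 1 else 0)) = (\<Sum>l<q. if l = j then u (s + i) l else 0)"
      by (intro sum.cong) auto
    then show "U $$ (i, j) = mat m m (\<lambda>(i, j). \<Sum>l<q. (\<lambda>i l. u (s + i) l) i l *
        (\<lambda>l j. if l = j then 1 else 0) l j) $$ (i, j)"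
      using ij by (simp add: U_def)
  qed (auto simp: U_def)
  then have "fminors_in (Suc q) U {0}" by (rule rank_le_fminors) simp
  then have Sq: "S q = 0"
    using smith_zero_tail[OF E F U Sch, of q q] by (simp add: m_def)
  note Ec = inverse_pairD(1,2)[OF E] inverse_pairD(1,2)[OF F]
  have qm: "q < m" by (simp add: m_def)
  \<comment> \<open>Because \<open>S q = 0\<close>, row \<open>q\<close> of \<open>E'\<close>
    combines the trailing rows in such a way that the left factor of \<open>Y'\<close> cancels. The
    row is unimodular: column \<open>q\<close> of \<open>E\<close> supplies coefficients summing to
    one, which at the end recover \<open>f\<close> itself from the multiples
    \<open>f * z c\<close>.\<close>
  define z where "z = (\<lambda>i. E' $$ (q, i))"
  have "E' * U = mat_diag m S * F"
  proof -
    have "E * mat_diag m S * F = E * (mat_diag m S * F)"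
      using Ec by (intro assoc_mult_mat) auto
    then show ?thesis unfolding U
      using inverse_pair_cancel(2)[OF E, of "mat_diag m S * F" m] Ec by (simp del: assoc_mult_mat)
  qed
  then have zU: "(\<Sum>i<m. z i * U $$ (i, l)) = 0" if "l < m" for l
    using mult_mat_index[OF Ec(2) Uc qm that] mat_diag_mult_left[OF Ec(3), of S] Sq qm that
    by (simp add: z_def)
  have zE: "(\<Sum>i<m. z i * E $$ (i, q)) = 1"
    using mult_mat_index[OF Ec(2,1) qm qm] inverse_pairD(4)[OF E] qm by (simp add: z_def)
  have fz: "p s dvd f * z c" if cm: "c < m" for c
  proof -
    have "(\<Sum>i<m. z i * (if i = c then f else 0)) =
        (\<Sum>i<m. z i * (p (s + i) * W' $$ (s + i, s + c) + (\<Sum>l<q. u (s + i) l * v l (s + c))))"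
    proof (intro sum.cong refl)
      fix i assume "i \<in> {..<m}"
      then show "z i * (if i = c then f else 0) =
        z i * (p (s + i) * W' $$ (s + i, s + c) + (\<Sum>l<q. u (s + i) l * v l (s + c)))"
        using entry[of "s + i" "s + c"] cm sm by auto
    qed
    also have "\<dots> = (\<Sum>i<m. z i * (p (s + i) * W' $$ (s + i, s + c))) +
        (\<Sum>i<m. \<Sum>l<q. z i * u (s + i) l * v l (s + c))"
      by (simp add: distrib_left sum.distrib sum_distrib_left mult.assoc)
    also have "(\<Sum>i<m. \<Sum>l<q. z i * u (s + i) l * v l (s + c)) =
        (\<Sum>l<q. (\<Sum>i<m. z i * u (s + i) l) * v l (s + c))"
      by (subst sum.swap) (simp add: sum_distrib_right)
    also have "\<dots> = 0"
    proof (rule sum.neutral, rule ballI)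
      fix l assume "l \<in> {..<q}"
      then have l: "l < q" by simp
      then have "(\<Sum>i<m. z i * u (s + i) l) = (\<Sum>i<m. z i * U $$ (i, l))"
        using qm by (intro sum.cong) (auto simp: U_def)
      then show "(\<Sum>i<m. z i * u (s + i) l) * v l (s + c) = 0" using zU[of l] l qm by simp
    qed
    also have "(\<Sum>i<m. z i * (if i = c then f else 0)) = (\<Sum>i<m. if i = c then f * z i else 0)"
      by (intro sum.cong) auto
    finally have "f * z c = (\<Sum>i<m. z i * (p (s + i) * W' $$ (s + i, s + c)))"
      using cm by simp
    also have "p s dvd \<dots>"
    proof (rule dvd_sum)
      fix i assume "i \<in> {..<m}"
      then have "p s dvd p (s + i)" using chain[of s "s + i"] sm by simp
      then show "p s dvd z i * (p (s + i) * W' $$ (s + i, s + c))" by simp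
    qed
    finally show ?thesis .
  qed
  have "f = (\<Sum>c<m. f * z c * E $$ (c, q))"
    using zE by (simp add: mult.assoc sum_distrib_left[symmetric])
  also have "p s dvd \<dots>" by (rule dvd_sum) (use fz in auto)
  finally show ?thesis by (simp add: s_def)
qed

section \<open>Polynomials in a linear operator\<close>

text \<open>The space is a module over \<open>F[x]\<close> with \<open>x\<close> acting as
  \<open>T\<close>. Scalars and operator are parameters, so that an operator and its perturbation
  can act side by side on the same vectors.\<close>

locale linear_op =
  fixes scl :: "'a::field \<Rightarrow> 'v::ab_group_add \<Rightarrow> 'v" and T :: "'v \<Rightarrow> 'v"
  assumes scl_add: "scl c (u + v) = scl c u + scl c v"
    and scl_add_left: "scl (c + d) v = scl c v + scl d v"
    and scl_scl: "scl c (scl d v) = scl (c * d) v"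
    and scl_one [simp]: "scl 1 v = v"
    and T_add: "T (u + v) = T u + T v" and T_scl: "T (scl c v) = scl c (T v)"
begin

lemma scl_zero [simp]: "scl 0 v = 0" "scl c 0 = 0"
  using scl_add_left[of 0 0 v] scl_add[of c 0 0] by simp_all

lemma scl_minus_one: "scl (- 1) v = - v"
  using scl_add_left[of "- 1" 1 v] by (simp add: eq_neg_iff_add_eq_0)

text \<open>This is \<open>p(T) v\<close> in Horner form.\<close>

definition act :: "'a poly \<Rightarrow> 'v \<Rightarrow> 'v" where
  "act p v = fold_coeffs (\<lambda>c w. scl c v + T w) p 0"

lemma T_zero [simp]: "T 0 = 0"
  using T_add[of 0 0] by simp

lemma act_0 [simp]: "act 0 v = 0"
  by (simp add: act_def)

lemma act_pCons [simp]: "act (pCons c p) v = scl c v + T (act p v)"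
  by (cases "c = 0 \<and> p = 0") (auto simp: act_def)

lemma act_one [simp]: "act 1 v = v"
  by (simp add: one_pCons)

lemma act_add: "act (p + q) v = act p v + act q v"
  by (induction p q rule: poly_induct2) (simp_all add: T_add scl_add_left algebra_simps)

lemma act_smult: "act (smult c p) v = scl c (act p v)"
  by (induction p) (simp_all add: T_scl scl_add scl_scl)

lemma act_add_right: "act p (u + v) = act p u + act p v"
  by (induction p) (simp_all add: T_add scl_add algebra_simps)

lemma act_scl_right: "act p (scl c v) = scl c (act p v)"
  by (induction p) (simp_all add: T_scl scl_add scl_scl mult.commute)

lemma act_zero_right [simp]: "act p 0 = 0"
  using act_scl_right[of p 0 0] by simp

lemma act_mult: "act (p * q) v = act p (act q v)"
  by (induction p) (simp_all add: act_add act_smult)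

lemma act_diff: "act (p - q) v = act p v - act q v"
  using act_add[of "p - q" q v] by (simp add: algebra_simps)

lemma act_diff_right: "act p (u - v) = act p u - act p v"
  using act_add_right[of p "u - v" v] by (simp add: algebra_simps)

lemma act_sum_right: "act p (\<Sum>x\<in>A. f x) = (\<Sum>x\<in>A. act p (f x))"
  by (induction A rule: infinite_finite_induct) (simp_all add: act_add_right)

lemma act_sum: "act (\<Sum>x\<in>A. f x) v = (\<Sum>x\<in>A. act (f x) v)"
  by (induction A rule: infinite_finite_induct) (simp_all add: act_add)

lemma act_dvd_zero:
  assumes "q dvd p" "act q v = 0"
  shows "act p v = 0"
  using assms by (auto elim!: dvdE simp: act_mult mult.commute[of q])

text \<open>The alternative \<open>p = 0\<close> matters for \<open>d = 0\<close>, which occurs for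
  remainders modulo a constant: the zero polynomial has degree 0.\<close>

lemma act_expand:
  assumes "Polynomial.degree p < d \<or> p = 0"
  shows "act p v = (\<Sum>j<d. scl (Polynomial.coeff p j) ((T ^^ j) v))"
  using assms
proof (induction p arbitrary: d)
  case (pCons c p)
  show ?case
  proof (cases d)
    case 0
    then show ?thesis using pCons by simp
  next
    case (Suc d')
    have "Polynomial.degree p < d' \<or> p = 0" using pCons(3) Suc by (auto split: if_splits)
    then have "act p v = (\<Sum>j<d'. scl (Polynomial.coeff p j) ((T ^^ j) v))" by (rule pCons(2))
    moreover have "T (\<Sum>j<m. scl (Polynomial.coeff p j) ((T ^^ j) v)) =
        (\<Sum>j<m. scl (Polynomial.coeff p j) ((T ^^ Suc j) v))" for m
      by (induction m) (simp_all add: T_add T_scl)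
    ultimately show ?thesis unfolding Suc by (simp add: sum.lessThan_Suc_shift del: sum.lessThan_Suc)
  qed
qed simp

lemma act_invariant:
  assumes "\<And>c v. v \<in> W \<Longrightarrow> scl c v \<in> W" "\<And>u v. u \<in> W \<Longrightarrow> v \<in> W \<Longrightarrow> u + v \<in> W"
    "\<And>v. v \<in> W \<Longrightarrow> T v \<in> W" "v \<in> W"
  shows "act p v \<in> W"
proof (induction p)
  case 0
  show ?case using assms(1)[OF assms(4), of 0] by simp
qed (simp add: assms)

text \<open>The submodule over \<open>F[x]\<close>, that is, the smallest \<open>T\<close>-invariant
  subspace containing the first \<open>n\<close> vectors.\<close>

definition span_of :: "nat \<Rightarrow> (nat \<Rightarrow> 'v) \<Rightarrow> 'v set" where
  "span_of n e = {v. \<exists>p. v = (\<Sum>j<n. act (p j) (e j))}"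

lemma span_of_add: "u \<in> span_of n e \<Longrightarrow> v \<in> span_of n e \<Longrightarrow> u + v \<in> span_of n e"
proof -
  assume "u \<in> span_of n e" "v \<in> span_of n e"
  then obtain p q where "u = (\<Sum>j<n. act (p j) (e j))" "v = (\<Sum>j<n. act (q j) (e j))"
    by (auto simp: span_of_def)
  then have "u + v = (\<Sum>j<n. act (p j + q j) (e j))" by (simp add: act_add sum.distrib)
  then show ?thesis unfolding span_of_def by (intro CollectI exI[of _ "\<lambda>j. p j + q j"])
qed

lemma span_of_act: "v \<in> span_of n e \<Longrightarrow> act q v \<in> span_of n e"
proof -
  assume "v \<in> span_of n e"
  then obtain p where "v = (\<Sum>j<n. act (p j) (e j))" by (auto simp: span_of_def)
  then have "act q v = (\<Sum>j<n. act (q * p j) (e j))" by (simp add: act_sum_right act_mult)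
  then show ?thesis unfolding span_of_def by (intro CollectI exI[of _ "\<lambda>j. q * p j"])
qed

lemma span_of_zero: "0 \<in> span_of n e"
  unfolding span_of_def by (intro CollectI exI[of _ "\<lambda>j. 0"]) simp

lemma span_of_scl: "v \<in> span_of n e \<Longrightarrow> scl c v \<in> span_of n e"
  using span_of_act[of v n e "[:c:]"] by simp

lemma span_of_diff: "u \<in> span_of n e \<Longrightarrow> v \<in> span_of n e \<Longrightarrow> u - v \<in> span_of n e"
proof -
  assume "u \<in> span_of n e" "v \<in> span_of n e"
  then have "u + scl (- 1) v \<in> span_of n e" by (intro span_of_add span_of_scl)
  then show ?thesis by (simp add: scl_minus_one)
qed

lemma span_of_sum: "(\<And>x. x \<in> A \<Longrightarrow> f x \<in> span_of n e) \<Longrightarrow> (\<Sum>x\<in>A. f x) \<in> span_of n e"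
  by (induction A rule: infinite_finite_induct) (simp_all add: span_of_zero span_of_add)

lemma span_of_base: "i < n \<Longrightarrow> e i \<in> span_of n e"
proof -
  assume i: "i < n"
  have "(\<Sum>j<n. act (if j = i then 1 else 0) (e j)) = (\<Sum>j<n. if j = i then e j else 0)"
    by (intro sum.cong) auto
  then have "e i = (\<Sum>j<n. act (if j = i then 1 else 0) (e j))" using i by simp
  then show ?thesis unfolding span_of_def by (intro CollectI exI[of _ "\<lambda>j. if j = i then 1 else 0"])
qed

end

definition fscl :: "'a::field \<Rightarrow> (nat \<Rightarrow> 'a) \<Rightarrow> nat \<Rightarrow> 'a" where
  "fscl c v = (\<lambda>i. c * v i)"

definition delta :: "nat \<Rightarrow> nat \<Rightarrow> 'a::field" where
  "delta j = (\<lambda>i. if i = j then 1 else 0)"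

definition dot :: "nat \<Rightarrow> (nat \<Rightarrow> 'a::field) \<Rightarrow> (nat \<Rightarrow> 'a) \<Rightarrow> 'a" where
  "dot n y v = (\<Sum>l<n. y l * v l)"

text \<open>Vectors of length \<open>n\<close> are functions vanishing from \<open>n\<close> on, so
  that all of them live in one additive group.\<close>

definition supp_in :: "nat \<Rightarrow> (nat \<Rightarrow> 'a::field) \<Rightarrow> bool" where
  "supp_in n v \<longleftrightarrow> (\<forall>i\<ge>n. v i = 0)"

definition mv :: "nat \<Rightarrow> 'a::field mat \<Rightarrow> (nat \<Rightarrow> 'a) \<Rightarrow> nat \<Rightarrow> 'a" where
  "mv n N v = (\<lambda>i. if i < n then \<Sum>j<n. N $$ (i, j) * v j else 0)"

lemma sum_pCons_0: "(\<Sum>x\<in>A. [:f x:]) = [:\<Sum>x\<in>A. f x:]"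
  by (induction A rule: infinite_finite_induct) auto

lemma sum_fun_apply: "(\<Sum>x\<in>A. f x) i = (\<Sum>x\<in>A. (f x :: nat \<Rightarrow> 'a::field) i)"
  by (induction A rule: infinite_finite_induct) auto

lemma dot_add: "dot n y (u + v) = dot n y u + dot n y v"
  by (simp add: dot_def algebra_simps sum.distrib)

lemma dot_scl: "dot n y (fscl c v) = c * dot n y v"
  by (simp add: dot_def fscl_def sum_distrib_left algebra_simps)

lemma dot_zero [simp]: "dot n y 0 = 0"
  by (simp add: dot_def)

lemma dot_delta: "l < n \<Longrightarrow> dot n y (delta l) = y l"
  by (simp add: dot_def delta_def if_distrib cong: if_cong)

lemma supp_in_simps [simp]: "supp_in n 0" "supp_in n u \<Longrightarrow> supp_in n (fscl c u)"
  "supp_in n u \<Longrightarrow> supp_in n v \<Longrightarrow> supp_in n (u + v)"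
  "supp_in n u \<Longrightarrow> supp_in n v \<Longrightarrow> supp_in n (u - v)" "j < n \<Longrightarrow> supp_in n (delta j)"
  "supp_in n (mv n N u)"
  by (auto simp: supp_in_def fscl_def delta_def mv_def)

lemma supp_in_sum: "(\<And>x. x \<in> A \<Longrightarrow> supp_in n (f x)) \<Longrightarrow> supp_in n (\<Sum>x\<in>A. f x)"
  by (auto simp: supp_in_def sum_fun_apply)

lemma supp_in_delta_sum:
  assumes "supp_in n v"
  shows "v = (\<Sum>j<n. fscl (v j) (delta j))"
proof
  fix i
  have "(\<Sum>j<n. fscl (v j) (delta j)) i = (\<Sum>j<n. if j = i then v i else 0)"
    unfolding sum_fun_apply by (intro sum.cong) (auto simp: fscl_def delta_def)
  then show "v i = (\<Sum>j<n. fscl (v j) (delta j)) i"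
    using assms by (auto simp: supp_in_def)
qed

lemma linear_op_mv: "linear_op fscl (mv n N)"
  by standard (auto simp: mv_def fscl_def fun_eq_iff algebra_simps sum.distrib sum_distrib_left)

text \<open>The module map that sends a polynomial vector \<open>w\<close> to the sum of the vectors
  \<open>w_j(N) e_j\<close>. The lemmas below identify its kernel with the column module of
  \<open>xI - N\<close>.\<close>

definition ev :: "nat \<Rightarrow> 'a::field mat \<Rightarrow> (nat \<Rightarrow> 'a poly) \<Rightarrow> nat \<Rightarrow> 'a" where
  "ev n N w = (\<Sum>j<n. linear_op.act fscl (mv n N) (w j) (delta j))"

context
  fixes n :: nat and N :: "'a::field mat"
begin

interpretation linear_op fscl "mv n N" by (rule linear_op_mv)

lemma ev_diff: "ev n N (\<lambda>i. w i - z i) = ev n N w - ev n N z"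
  by (simp add: ev_def act_diff sum_subtractf)

lemma ev_mult: "ev n N (\<lambda>i. p * w i) = linear_op.act fscl (mv n N) p (ev n N w)"
  by (simp add: ev_def act_mult act_sum_right)

lemma ev_sum: "ev n N (\<lambda>i. \<Sum>x\<in>A. w x i) = (\<Sum>x\<in>A. ev n N (w x))"
  unfolding ev_def act_sum by (rule sum.swap)

lemma ev_const:
  assumes "supp_in n v"
  shows "ev n N (\<lambda>i. [:v i:]) = v"
  using supp_in_delta_sum[OF assms] by (simp add: ev_def)

lemma ev_cong: "(\<And>i. i < n \<Longrightarrow> w i = z i) \<Longrightarrow> ev n N w = ev n N z"
  by (simp add: ev_def)

end

lemma mv_delta:
  assumes "j < n"
  shows "mv n N (delta j) = (\<lambda>i. if i < n then N $$ (i, j) else 0)"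
proof -
  have "(\<Sum>l<n. N $$ (i, l) * delta j l) = (\<Sum>l<n. if l = j then N $$ (i, l) else 0)" for i
    by (intro sum.cong) (auto simp: delta_def)
  then show ?thesis using assms by (auto simp: mv_def fun_eq_iff)
qed

lemma char_poly_matrix_index:
  assumes "N \<in> carrier_mat n n" "i < n" "j < n"
  shows "char_poly_matrix N $$ (i, j) = (if i = j then [:0, 1:] else 0) - [:N $$ (i, j):]"
  using assms by (auto simp: char_poly_matrix_def)

lemma ev_char_poly_matrix:
  assumes N: "N \<in> carrier_mat n n"
  shows "ev n N (\<lambda>i. \<Sum>j<n. char_poly_matrix N $$ (i, j) * z j) = 0"
proof -
  interpret linear_op fscl "mv n N" by (rule linear_op_mv)
  have col: "ev n N (\<lambda>i. char_poly_matrix N $$ (i, j)) = 0" if j: "j < n" for j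
  proof -
    have "ev n N (\<lambda>i. char_poly_matrix N $$ (i, j)) =
        ev n N (\<lambda>i. [:0, 1:] * [:delta j i:] - [:(mv n N (delta j)) i:])"
      by (rule ev_cong) (simp add: char_poly_matrix_index[OF N _ j] mv_delta[OF j], simp add: delta_def)
    also have "\<dots> = mv n N (delta j) - mv n N (delta j)"
      unfolding ev_diff ev_mult using j by (simp only: ev_const supp_in_simps act_pCons act_0) simp
    finally show ?thesis by simp
  qed
  have "ev n N (\<lambda>i. \<Sum>j<n. char_poly_matrix N $$ (i, j) * z j) =
      (\<Sum>j<n. act (z j) (ev n N (\<lambda>i. char_poly_matrix N $$ (i, j))))"
    unfolding ev_sum by (simp only: ev_mult mult.commute[of "char_poly_matrix N $$ _"])
  then show ?thesis by (simp add: col)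
qed

text \<open>Division with remainder by \<open>xI - N\<close>: from
  \<open>x v = (xI - N) v + N v\<close>, multiplication by \<open>x\<close> acts on constant vectors
  as \<open>N\<close> modulo the columns of \<open>xI - N\<close>, so Horner's scheme reduces every
  \<open>w\<close> to a constant vector.\<close>

lemma ev_reduce:
  assumes N: "N \<in> carrier_mat n n"
  shows "\<exists>z. \<forall>i<n. w i = (\<Sum>j<n. char_poly_matrix N $$ (i, j) * z j) +
     [:ev n N w i:]"
proof -
  interpret linear_op fscl "mv n N" by (rule linear_op_mv)
  let ?C = "\<lambda>i j. char_poly_matrix N $$ (i, j)"
  have single: "\<exists>z. \<forall>i<n. (if i = j then p else 0) = (\<Sum>l<n. ?C i l * z l) +
      [:act p (delta j) i:]" for p j
  proof (induction p)
    case 0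
    then show ?case by (intro exI[of _ "\<lambda>_. 0"]) simp
  next
    case (pCons c p)
    obtain z where z': "\<forall>i<n. (if i = j then p else 0) = (\<Sum>l<n. ?C i l * z l) +
      [:act p (delta j) i:]" using pCons(2) ..
    have z: "(if i = j then p else 0) = (\<Sum>l<n. ?C i l * z l) + [:act p (delta j) i:]"
      if "i < n" for i by (rule z'[rule_format, OF that])
    define v where "v = act p (delta j)"
    have "(if i = j then pCons c p else 0) = (\<Sum>l<n. ?C i l * ([:0, 1:] * z l + [:v l:])) +
      [:act (pCons c p) (delta j) i:]" if i: "i < n" for i
    proof -
      have "(\<Sum>l<n. ?C i l * [:v l:]) = (\<Sum>l<n. (if l = i then [:0, 1:] * [:v i:] else 0) - [:N $$ (i, l) * v l:])"
        by (intro sum.cong) (auto simp: char_poly_matrix_index[OF N i])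
      also have "\<dots> = [:0, 1:] * [:v i:] - (\<Sum>l<n. [:N $$ (i, l) * v l:])"
        using i by (simp add: sum_subtractf)
      also have "(\<Sum>l<n. [:N $$ (i, l) * v l:]) = [:mv n N v i:]"
        using i by (simp add: mv_def sum_pCons_0)
      finally have *: "(\<Sum>l<n. ?C i l * [:v l:]) = [:0, 1:] * [:v i:] - [:mv n N v i:]" .
      have "(if i = j then pCons c p else 0) = [:c * delta j i:] + [:0, 1:] * (if i = j then p else 0)"
        by (simp add: delta_def)
      also have "\<dots> = [:c * delta j i:] + [:0, 1:] * (\<Sum>l<n. ?C i l * z l) + [:0, 1:] * [:v i:]"
        unfolding z[OF i] v_def[symmetric] by (simp only: distrib_left add.assoc)
      also have "[:0, 1:] * [:v i:] = (\<Sum>l<n. ?C i l * [:v l:]) + [:mv n N v i:]"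
        by (simp only: * diff_add_cancel)
      also have "[:0, 1:] * (\<Sum>l<n. ?C i l * z l) = (\<Sum>l<n. ?C i l * ([:0, 1:] * z l))"
        by (simp only: sum_distrib_left mult.left_commute)
      also have "[:c * delta j i:] + (\<Sum>l<n. ?C i l * ([:0, 1:] * z l)) +
          ((\<Sum>l<n. ?C i l * [:v l:]) + [:mv n N v i:]) =
          ((\<Sum>l<n. ?C i l * ([:0, 1:] * z l)) + (\<Sum>l<n. ?C i l * [:v l:])) +
          ([:c * delta j i:] + [:mv n N v i:])"
        by (simp only: add_ac)
      also have "(\<Sum>l<n. ?C i l * ([:0, 1:] * z l)) + (\<Sum>l<n. ?C i l * [:v l:]) =
          (\<Sum>l<n. ?C i l * ([:0, 1:] * z l + [:v l:]))"
        by (simp only: distrib_left sum.distrib)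
      also have "[:c * delta j i:] + [:mv n N v i:] = [:act (pCons c p) (delta j) i:]"
        by (simp add: v_def fscl_def)
      finally show ?thesis .
    qed
    then show ?case by (intro exI[of _ "\<lambda>l. [:0, 1:] * z l + [:v l:]"]) simp
  qed
  have "\<forall>j. \<exists>z. \<forall>i<n. (if i = j then w j else 0) = (\<Sum>l<n. ?C i l * z l) +
      [:act (w j) (delta j) i:]" by (intro allI single)
  then have "\<exists>Z. \<forall>j. \<forall>i<n. (if i = j then w j else 0) = (\<Sum>l<n. ?C i l * Z j l) +
      [:act (w j) (delta j) i:]" by (rule choice)
  then obtain Z where Z': "\<forall>j. \<forall>i<n. (if i = j then w j else 0) = (\<Sum>l<n. ?C i l * Z j l) +
      [:act (w j) (delta j) i:]" ..
  have Z: "(if i = j then w j else 0) = (\<Sum>l<n. ?C i l * Z j l) + [:act (w j) (delta j) i:]"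
    if "i < n" for i j
    by (rule Z'[rule_format, OF that])
  have "w i = (\<Sum>l<n. ?C i l * (\<Sum>j<n. Z j l)) + [:ev n N w i:]" if i: "i < n" for i
  proof -
    have "w i = (\<Sum>j<n. if i = j then w j else 0)" using i by (simp add: sum.delta)
    also have "\<dots> = (\<Sum>j<n. (\<Sum>l<n. ?C i l * Z j l) + [:act (w j) (delta j) i:])"
      by (intro sum.cong refl) (rule Z[OF i])
    also have "\<dots> = (\<Sum>j<n. \<Sum>l<n. ?C i l * Z j l) + (\<Sum>j<n. [:act (w j) (delta j) i:])"
      by (rule sum.distrib)
    also have "(\<Sum>j<n. [:act (w j) (delta j) i:]) = [:ev n N w i:]"
      by (simp add: ev_def sum_fun_apply sum_pCons_0)
    also have "(\<Sum>j<n. \<Sum>l<n. ?C i l * Z j l) = (\<Sum>l<n. ?C i l * (\<Sum>j<n. Z j l))"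
      by (subst sum.swap) (simp add: sum_distrib_left)
    finally show ?thesis .
  qed
  then show ?thesis by (intro exI[of _ "\<lambda>l. \<Sum>j<n. Z j l"]) simp
qed

section \<open>Invariant factors of a matrix over a field\<close>

text \<open>Indices start at 0, whereas invariant factors of a pencil are counted from 1. Total
  degree \<open>n\<close> is what makes such a chain a candidate for the invariant factors of a
  matrix of size \<open>n\<close>; leading members may be 1.\<close>

definition invariant_chain :: "nat \<Rightarrow> (nat \<Rightarrow> 'a::field poly) \<Rightarrow> bool" where
  "invariant_chain n \<phi> \<longleftrightarrow> (\<forall>i j. i \<le> j \<longrightarrow> j < n \<longrightarrow> \<phi> i dvd \<phi> j) \<and>
     (\<forall>i<n. lead_coeff (\<phi> i) = 1) \<and> (\<Sum>i<n. Polynomial.degree (\<phi> i)) = n"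

definition has_invariants :: "nat \<Rightarrow> 'a::field mat \<Rightarrow> (nat \<Rightarrow> 'a poly) \<Rightarrow> bool" where
  "has_invariants n N \<phi> \<longleftrightarrow> N \<in> carrier_mat n n \<and> invariant_chain n \<phi> \<and>
     (\<exists>P P' Q Q'. inverse_pair n P P' \<and> inverse_pair n Q Q' \<and>
        char_poly_matrix N = P * mat_diag n \<phi> * Q)"

text \<open>
  A generating system of length \<open>n\<close> with \<open>\<phi>\<^sub>i(T) f\<^sub>i = 0\<close>. Since the degrees of an invariant chain
  add up to \<open>n\<close>, the space is then automatically the direct sum of the cyclic spaces generated by the
  \<open>f\<^sub>i\<close>.
\<close>

definition cyclic_gens ::
  "nat \<Rightarrow> ((nat \<Rightarrow> 'a::field) \<Rightarrow> nat \<Rightarrow> 'a) \<Rightarrow> (nat \<Rightarrow> 'a poly) \<Rightarrow> (nat \<Rightarrow> nat \<Rightarrow> 'a) \<Rightarrow> bool" where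
  "cyclic_gens n T \<phi> f \<longleftrightarrow>
     (\<forall>i<n. supp_in n (f i) \<and> linear_op.act fscl T (\<phi> i) (f i) = 0) \<and>
     (\<forall>v. supp_in n v \<longrightarrow> v \<in> linear_op.span_of fscl T n f)"

lemma invariant_chainD:
  assumes "invariant_chain n \<phi>"
  shows "i \<le> j \<Longrightarrow> j < n \<Longrightarrow> \<phi> i dvd \<phi> j" "i < n \<Longrightarrow> lead_coeff (\<phi> i) = 1"
    "(\<Sum>i<n. Polynomial.degree (\<phi> i)) = n" "i < n \<Longrightarrow> \<phi> i \<noteq> 0"
  using assms by (force simp: invariant_chain_def)+

lemma monic_dvd_eq:
  fixes p q :: "'a::field poly"
  assumes "p dvd q" "lead_coeff p = 1" "lead_coeff q = 1" "Polynomial.degree q \<le> Polynomial.degree p"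
  shows "p = q"
proof -
  obtain c where c: "q = p * c" using assms(1) by (elim dvdE)
  then have nz: "p \<noteq> 0" "c \<noteq> 0" using assms(3) by auto
  then have "Polynomial.degree c = 0" using assms(4) c by (simp add: degree_mult_eq)
  moreover have "lead_coeff c = 1" using assms c by (simp add: lead_coeff_mult)
  ultimately have "c = 1" by (metis degree_0_id one_pCons of_nat_1 lead_coeff_1 degree_eq_zeroE pCons_0_0 coeff_pCons_0 degree_pCons_0)
  then show ?thesis using c by simp
qed

text \<open>Degrees can only grow termwise, so a bound on the total forces equality of every
  degree.\<close>

lemma monic_chain_eq:
  fixes \<rho> \<psi> :: "nat \<Rightarrow> 'a::field poly"
  assumes dvd: "\<And>i. i < n \<Longrightarrow> \<rho> i dvd \<psi> i"
    and monic: "\<And>i. i < n \<Longrightarrow> lead_coeff (\<rho> i) = 1" "\<And>i. i < n \<Longrightarrow> lead_coeff (\<psi> i) = 1"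
    and deg: "(\<Sum>i<n. Polynomial.degree (\<psi> i)) \<le> (\<Sum>i<n. Polynomial.degree (\<rho> i))"
    and i: "i < n"
  shows "\<rho> i = \<psi> i"
proof (rule monic_dvd_eq[OF dvd[OF i] monic(1)[OF i] monic(2)[OF i]])
  have le: "Polynomial.degree (\<rho> j) \<le> Polynomial.degree (\<psi> j)" if "j < n" for j
  proof (rule dvd_imp_degree_le[OF dvd[OF that]])
    show "\<psi> j \<noteq> 0" using monic(2)[OF that] by auto
  qed
  show "Polynomial.degree (\<psi> i) \<le> Polynomial.degree (\<rho> i)"
  proof (rule ccontr)
    assume "\<not> ?thesis"
    then have "(\<Sum>i<n. Polynomial.degree (\<rho> i)) < (\<Sum>i<n. Polynomial.degree (\<psi> i))"
      using le i by (intro sum_strict_mono_ex1) (auto simp: not_le)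
    then show False using deg by simp
  qed
qed

lemma det_mat_diag: "Determinant.det (mat_diag n S) = (\<Prod>i<n. S i :: 'b::comm_ring_1)"
  unfolding mat_diag_def by (rule det_diag)

lemma inverse_pair_det:
  assumes "inverse_pair n P P'"
  shows "Determinant.det P * Determinant.det P' = 1"
  using det_mult[OF inverse_pairD(1,2)[OF assms]] inverse_pairD(3)[OF assms] by simp

text \<open>The total degree comes from the characteristic polynomial, since the transforming
  matrices have constant nonzero determinants. Leading coefficients are moved from the Smith
  diagonal into the left factor.\<close>

lemma has_invariants_exists:
  fixes N :: "'a::field mat"
  assumes N: "N \<in> carrier_mat n n"
  shows "\<exists>\<phi>. has_invariants n N \<phi>"
proof -
  let ?C = "char_poly_matrix N"
  have C: "?C \<in> carrier_mat n n" using N by simp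
  obtain P P' Q Q' S where P: "inverse_pair n P P'" and Q: "inverse_pair n Q Q'"
    and eq: "?C = P * mat_diag n S * Q" and chain: "\<And>i j. i \<le> j \<Longrightarrow> j < n \<Longrightarrow> S i dvd S j"
    using smith_normal_form[OF C] by metis
  note c = inverse_pairD(1,2)[OF P] inverse_pairD(1,2)[OF Q]
  have "Determinant.det ?C = Determinant.det (P * mat_diag n S) * Determinant.det Q"
    unfolding eq by (rule det_mult[OF _ c(3)]) (use c in simp)
  also have "Determinant.det (P * mat_diag n S) = Determinant.det P * (\<Prod>i<n. S i)"
    unfolding det_mat_diag[symmetric] by (rule det_mult[OF c(1)]) simp
  finally have det: "char_poly N = Determinant.det P * (\<Prod>i<n. S i) * Determinant.det Q"
    by (simp add: char_poly_def)
  have cp: "Polynomial.degree (char_poly N) = n" "char_poly N \<noteq> 0"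
    using degree_monic_char_poly[OF N] by auto
  have Snz: "S i \<noteq> 0" if "i < n" for i using det cp that by auto
  have deg0: "Polynomial.degree (Determinant.det U) = 0" "Determinant.det U \<noteq> 0"
    if "inverse_pair n U U'" for U U' :: "'a poly mat"
  proof -
    have "Determinant.det U dvd 1" using inverse_pair_det[OF that] by (metis dvd_triv_left)
    then show "Polynomial.degree (Determinant.det U) = 0" "Determinant.det U \<noteq> 0"
      by (auto simp: poly_dvd_1 is_unit_poly_iff)
  qed
  have "Polynomial.degree (char_poly N) = Polynomial.degree (\<Prod>i<n. S i)"
    unfolding det using deg0[OF P] deg0[OF Q] Snz by (subst degree_mult_eq | simp add: degree_mult_eq)+
  also have "\<dots> = (\<Sum>i<n. Polynomial.degree (S i))"
    by (rule degree_prod_eq_sum_degree) (use Snz in auto)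
  finally have degS: "(\<Sum>i<n. Polynomial.degree (S i)) = n" using cp by simp
  \<comment> \<open>The value 1 from index \<open>n\<close> on keeps \<open>k i\<close> nonzero for
    every \<open>i\<close>.\<close>
  define k where "k = (\<lambda>i. if i < n then lead_coeff (S i) else 1)"
  have knz: "k i \<noteq> 0" for i using Snz by (simp add: k_def)
  define \<phi> where "\<phi> = (\<lambda>i. smult (inverse (k i)) (S i))"
  have pair: "inverse_pair n (mat_diag n (\<lambda>i. [:k i:])) (mat_diag n (\<lambda>i. [:inverse (k i):]))"
    using knz by (simp add: inverse_pair_def one_pCons[symmetric])
  have "mat_diag n S = mat_diag n (\<lambda>i. [:k i:]) * mat_diag n \<phi>"
    using knz by (simp add: \<phi>_def)
  then have "P * mat_diag n S = P * mat_diag n (\<lambda>i. [:k i:]) * mat_diag n \<phi>"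
    by (metis assoc_mult_mat[OF c(1) mat_diag_dim mat_diag_dim])
  then have "?C = P * mat_diag n (\<lambda>i. [:k i:]) * mat_diag n \<phi> * Q" using eq by simp
  moreover have "invariant_chain n \<phi>"
    unfolding invariant_chain_def
  proof (intro conjI allI impI)
    show "\<phi> i dvd \<phi> j" if "i \<le> j" "j < n" for i j
      using chain[OF that] knz by (simp add: \<phi>_def smult_dvd_iff dvd_smult_iff)
    show "lead_coeff (\<phi> i) = 1" if "i < n" for i
      using Snz[OF that] that by (simp add: \<phi>_def k_def lead_coeff_smult)
    show "(\<Sum>i<n. Polynomial.degree (\<phi> i)) = n" using degS knz by (simp add: \<phi>_def)
  qed
  ultimately show ?thesis
    using N Q inverse_pair_mult[OF P pair] unfolding has_invariants_def by blast
qed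

text \<open>The generators are the images under \<open>ev\<close> of the columns of
  \<open>P\<close>. By \<open>CQ\<close>, \<open>\<phi> i\<close> times column \<open>i\<close> of
  \<open>P\<close> lies in the column module of \<open>xI - N\<close>, which \<open>ev\<close>
  kills; invertibility of \<open>P\<close> gives generation.\<close>

lemma has_invariants_gens:
  fixes N :: "'a::field mat"
  assumes "has_invariants n N \<phi>"
  shows "\<exists>f. cyclic_gens n (mv n N) \<phi> f"
proof -
  interpret linear_op fscl "mv n N" by (rule linear_op_mv)
  obtain P P' Q Q' where P: "inverse_pair n P P'" and Q: "inverse_pair n Q Q'"
    and eq: "char_poly_matrix N = P * mat_diag n \<phi> * Q" and N: "N \<in> carrier_mat n n"
    using assms unfolding has_invariants_def by blast
  note c = inverse_pairD(1,2)[OF P] inverse_pairD(1,2)[OF Q]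
  have CQ: "char_poly_matrix N * Q' = P * mat_diag n \<phi>"
    unfolding eq by (rule inverse_pair_cancel_right[OF Q, where m = n]) (use c in simp)
  define f where "f = (\<lambda>i. ev n N (\<lambda>l. P $$ (l, i)))"
  have supp: "supp_in n (f i)" for i
  proof -
    have "act p (delta j) \<in> {v. supp_in n v}" if "j < n" for p j
      by (rule act_invariant) (use that in auto)
    then show ?thesis unfolding f_def ev_def by (intro supp_in_sum) auto
  qed
  have zero: "act (\<phi> i) (f i) = 0" if i: "i < n" for i
  proof -
    have "act (\<phi> i) (f i) = ev n N (\<lambda>l. \<phi> i * P $$ (l, i))" by (simp add: f_def ev_mult)
    also have "\<dots> = ev n N (\<lambda>l. \<Sum>j<n. char_poly_matrix N $$ (l, j) * Q' $$ (j, i))"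
    proof (rule ev_cong)
      fix l assume l: "l < n"
      have "(P * mat_diag n \<phi>) $$ (l, i) = \<phi> i * P $$ (l, i)"
        using l i c by (simp add: mat_diag_mult_right[of P n n] mult.commute)
      then show "\<phi> i * P $$ (l, i) = (\<Sum>j<n. char_poly_matrix N $$ (l, j) * Q' $$ (j, i))"
        using mult_mat_index[of "char_poly_matrix N" n n Q' n l i] c N CQ l i by simp
    qed
    also have "\<dots> = 0" by (rule ev_char_poly_matrix[OF N])
    finally show ?thesis .
  qed
  have "v \<in> span_of n f" if v: "supp_in n v" for v
  proof -
    define p where "p = (\<lambda>i. \<Sum>j<n. P' $$ (i, j) * [:v j:])"
    have "(\<Sum>i<n. act (p i) (f i)) = ev n N (\<lambda>l. \<Sum>i<n. p i * P $$ (l, i))"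
      by (simp add: f_def ev_mult ev_sum)
    also have "\<dots> = ev n N (\<lambda>l. [:v l:])"
    proof (rule ev_cong)
      fix l assume l: "l < n"
      have "(\<Sum>i<n. p i * P $$ (l, i)) = (\<Sum>i<n. \<Sum>j<n. P $$ (l, i) * P' $$ (i, j) * [:v j:])"
        unfolding p_def by (simp add: sum_distrib_right sum_distrib_left mult.commute mult.left_commute)
      also have "\<dots> = (\<Sum>j<n. (\<Sum>i<n. P $$ (l, i) * P' $$ (i, j)) * [:v j:])"
        by (subst sum.swap) (simp only: sum_distrib_right)
      also have "\<dots> = (\<Sum>j<n. if j = l then [:v j:] else 0)"
      proof (intro sum.cong refl)
        fix j assume "j \<in> {..<n}"
        then have "(\<Sum>i<n. P $$ (l, i) * P' $$ (i, j)) = (if l = j then 1 else 0)"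
          using mult_mat_index[OF c(1,2) l, of j] inverse_pairD(3)[OF P] l by simp
        then show "(\<Sum>i<n. P $$ (l, i) * P' $$ (i, j)) * [:v j:] = (if j = l then [:v j:] else 0)"
          by simp
      qed
      finally show "(\<Sum>i<n. p i * P $$ (l, i)) = [:v l:]" using l by simp
    qed
    also have "\<dots> = v" by (rule ev_const[OF v])
    finally show ?thesis unfolding span_of_def by (intro CollectI exI[of _ p]) simp
  qed
  then show ?thesis using supp zero unfolding cyclic_gens_def by blast
qed

text \<open>Let \<open>\<rho>\<close> be the invariant factors that \<open>N\<close> certainly has.
  As \<open>\<psi> i\<close> annihilates the generators with index at most \<open>i\<close>,
  multiplying the module by \<open>\<psi> i\<close> leaves only the last \<open>n - 1 - i\<close>
  generators, and \<open>invariant_factor_dvd\<close> gives \<open>\<rho> i dvd \<psi> i\<close>.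
  Equal total degrees do the rest.\<close>

lemma cyclic_gens_has_invariants:
  fixes N :: "'a::field mat"
  assumes N: "N \<in> carrier_mat n n" and ch: "invariant_chain n \<psi>"
    and gens: "cyclic_gens n (mv n N) \<psi> f"
  shows "has_invariants n N \<psi>"
proof -
  interpret linear_op fscl "mv n N" by (rule linear_op_mv)
  let ?C = "char_poly_matrix N"
  have C: "?C \<in> carrier_mat n n" using N by simp
  obtain \<rho> where \<rho>: "has_invariants n N \<rho>" using has_invariants_exists[OF N] by blast
  then obtain P P' Q Q' where P: "inverse_pair n P P'" and Q: "inverse_pair n Q Q'"
    and eq: "?C = P * mat_diag n \<rho> * Q" and ch\<rho>: "invariant_chain n \<rho>"
    unfolding has_invariants_def by blast
  have dvd: "\<rho> i dvd \<psi> i" if i: "i < n" for i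
  proof -
    have "\<exists>p. delta l = (\<Sum>j<n. act (p j) (f j))" if "l < n" for l
      using gens that supp_in_simps(5)[OF that] unfolding cyclic_gens_def span_of_def by blast
    then obtain p where p: "\<And>l. l < n \<Longrightarrow> delta l = (\<Sum>j<n. act (p l j) (f j))" by metis
    define q where "q = n - 1 - i"
    define m where "m = Suc i"
    have mq: "m + q = n" using i by (simp add: m_def q_def)
    \<comment> \<open>The vector \<open>\<psi> i\<close> times \<open>e_l\<close>, minus its part
      carried by the last \<open>q\<close> generators. It lies in the kernel of \<open>ev\<close>,
      hence is a combination of columns of \<open>xI - N\<close>; the subtracted part becomes the
      matrix \<open>Y\<close>.\<close>
    define w where "w = (\<lambda>l a. (if a = l then \<psi> i else 0) -
      (\<Sum>t<q. \<psi> i * p l (m + t) * [:f (m + t) a:]))"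
    have w0: "ev n N (w l) = 0" if l: "l < n" for l
    proof -
      have "ev n N (\<lambda>a. if a = l then \<psi> i else 0) = ev n N (\<lambda>a. \<psi> i * [:delta l a:])"
        by (rule ev_cong) (simp add: delta_def)
      also have "\<dots> = act (\<psi> i) (delta l)"
        unfolding ev_mult using l by (simp only: ev_const supp_in_simps)
      also have "\<dots> = (\<Sum>j<n. act (\<psi> i * p l j) (f j))"
        by (subst p[OF l]) (simp add: act_sum_right act_mult)
      also have "\<dots> = (\<Sum>j<m. act (\<psi> i * p l j) (f j)) +
          (\<Sum>t<q. act (\<psi> i * p l (m + t)) (f (m + t)))"
        unfolding mq[symmetric] by (rule sum_lessThan_add)
      also have "(\<Sum>j<m. act (\<psi> i * p l j) (f j)) = 0"
      proof (rule sum.neutral, rule ballI)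
        fix j assume "j \<in> {..<m}"
        then have j: "j \<le> i" by (simp add: m_def)
        have "\<psi> j dvd \<psi> i * p l j" using invariant_chainD(1)[OF ch j i] by simp
        moreover have "act (\<psi> j) (f j) = 0" using gens i j by (simp add: cyclic_gens_def)
        ultimately show "act (\<psi> i * p l j) (f j) = 0" by (rule act_dvd_zero)
      qed
      finally have 1: "ev n N (\<lambda>a. if a = l then \<psi> i else 0) =
          (\<Sum>t<q. act (\<psi> i * p l (m + t)) (f (m + t)))" by simp
      have "ev n N (\<lambda>a. \<Sum>t<q. \<psi> i * p l (m + t) * [:f (m + t) a:]) =
          (\<Sum>t<q. act (\<psi> i * p l (m + t)) (f (m + t)))"
        unfolding ev_sum ev_mult
      proof (intro sum.cong refl)
        fix t assume "t \<in> {..<q}"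
        then have "supp_in n (f (m + t))" using gens mq by (auto simp: cyclic_gens_def)
        then show "act (\<psi> i * p l (m + t)) (ev n N (\<lambda>a. [:f (m + t) a:])) =
            act (\<psi> i * p l (m + t)) (f (m + t))" by (simp only: ev_const)
      qed
      then show ?thesis unfolding w_def ev_diff 1 by simp
    qed
    have "\<exists>z. \<forall>a<n. w l a = (\<Sum>j<n. ?C $$ (a, j) * z j)" if "l < n" for l
      using ev_reduce[OF N, of "w l"] w0[OF that] by simp
    then obtain z where z: "\<And>l a. l < n \<Longrightarrow> a < n \<Longrightarrow> w l a = (\<Sum>j<n. ?C $$ (a, j) * z l j)"
      by metis
    define W where "W = mat n n (\<lambda>(j, l). z l j)"
    define Y where "Y = mat n n (\<lambda>(a, l). \<Sum>t<q. [:f (m + t) a:] * (\<psi> i * p l (m + t)))"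
    have Wc: "W \<in> carrier_mat n n" and Yc: "Y \<in> carrier_mat n n" by (simp_all add: W_def Y_def)
    have Y: "rank_le n q Y"
      unfolding rank_le_def Y_def
      by (intro exI[of _ "\<lambda>a t. [:f (m + t) a:]"] exI[of _ "\<lambda>t l. \<psi> i * p l (m + t)"]) (rule refl)
    have "mat_diag n (\<lambda>_. \<psi> i) = ?C * W + Y"
    proof (rule eq_matI)
      fix a l assume "a < dim_row (?C * W + Y)" "l < dim_col (?C * W + Y)"
      then have al: "a < n" "l < n" using Yc by auto
      have "(?C * W) $$ (a, l) = w l a"
        unfolding mult_mat_index[OF C Wc al] z[OF al(2,1)] using al by (simp add: W_def)
      then have "(?C * W + Y) $$ (a, l) = w l a + (\<Sum>t<q. [:f (m + t) a:] * (\<psi> i * p l (m + t)))"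
        using al by (simp add: Y_def)
      also have "(\<Sum>t<q. [:f (m + t) a:] * (\<psi> i * p l (m + t))) =
          (\<Sum>t<q. \<psi> i * p l (m + t) * [:f (m + t) a:])"
        by (intro sum.cong refl mult.commute)
      also have "w l a + \<dots> = (if a = l then \<psi> i else 0)" unfolding w_def by simp
      finally show "mat_diag n (\<lambda>_. \<psi> i) $$ (a, l) = (?C * W + Y) $$ (a, l)"
        using al by (simp add: mat_diag_def)
    qed (use Yc in auto)
    from invariant_factor_dvd[OF P Q eq invariant_chainD(1)[OF ch\<rho>] Wc Y _ this] i
    show ?thesis by (simp add: q_def)
  qed
  have "\<rho> i = \<psi> i" if "i < n" for i
    by (rule monic_chain_eq[OF dvd invariant_chainD(2)[OF ch\<rho>] invariant_chainD(2)[OF ch] _ that])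
       (simp_all add: invariant_chainD(3)[OF ch\<rho>] invariant_chainD(3)[OF ch])
  then have "mat_diag n \<rho> = mat_diag n \<psi>" by (intro eq_matI) (auto simp: mat_diag_def)
  then show ?thesis using N ch P Q eq unfolding has_invariants_def by metis
qed

section \<open>Least common multiples and root multiplicities over the algebraic closure\<close>

lemma map_poly_to_ac:
  "map_poly to_ac (p + q :: 'a::field poly) = map_poly to_ac p + map_poly to_ac q"
  "map_poly to_ac (p * q) = map_poly to_ac p * map_poly to_ac q"
  "map_poly to_ac (smult c p) = smult (to_ac c) (map_poly to_ac p)"
  "map_poly to_ac p = 0 \<longleftrightarrow> p = 0"
  "map_poly to_ac (1 :: 'a poly) = 1"
  "Polynomial.degree (map_poly to_ac p) = Polynomial.degree p"
proof -
  interpret h: field_hom "to_ac :: 'a \<Rightarrow> _" by unfold_locales simp_all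
  interpret m: map_poly_inj_idom_hom "to_ac :: 'a \<Rightarrow> _" ..
  show "map_poly to_ac (p + q) = map_poly to_ac p + map_poly to_ac q"
    "map_poly to_ac (p * q) = map_poly to_ac p * map_poly to_ac q"
    "map_poly to_ac p = 0 \<longleftrightarrow> p = 0" "map_poly to_ac (1 :: 'a poly) = 1"
    "Polynomial.degree (map_poly to_ac p) = Polynomial.degree p"
    by (simp_all add: m.hom_add m.hom_mult)
  show "map_poly to_ac (smult c p) = smult (to_ac c) (map_poly to_ac p)"
    by (rule poly_eqI) (simp add: coeff_map_poly)
qed

abbreviation ac_order :: "'a::field alg_closure \<Rightarrow> 'a poly \<Rightarrow> nat" where
  "ac_order x p \<equiv> Polynomial.order x (map_poly to_ac p)"

text \<open>A nonzero element of least degree in the ideal of \<open>p\<close> and \<open>q\<close>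
  divides the whole ideal; cancelling it leaves comaximal cofactors.\<close>

lemma bezout_cofactors:
  fixes p q :: "'a::field poly"
  assumes "p \<noteq> 0"
  obtains d p' q' u v where "p = d * p'" "q = d * q'" "u * p' + v * q' = 1"
proof -
  define I where "I = {u * p + v * q | u v. True}"
  have pI: "p \<in> I" unfolding I_def by (rule CollectI, intro exI[of _ 1] exI[of _ 0]) simp
  have qI: "q \<in> I" unfolding I_def by (rule CollectI, intro exI[of _ 0] exI[of _ 1]) simp
  define Q where "Q = (\<lambda>m. \<exists>d\<in>I. d \<noteq> 0 \<and> Polynomial.degree d = m)"
  have "Q (Polynomial.degree p)" unfolding Q_def using pI assms by blast
  then have "Q (LEAST m. Q m)" by (rule LeastI)
  then obtain d where d: "d \<in> I" "d \<noteq> 0" and dm: "Polynomial.degree d = (LEAST m. Q m)"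
    unfolding Q_def by blast
  have least: "Polynomial.degree d \<le> Polynomial.degree x" if "x \<in> I" "x \<noteq> 0" for x
    unfolding dm by (rule Least_le) (use that in \<open>auto simp: Q_def\<close>)
  have dvd: "d dvd x" if xI: "x \<in> I" for x
  proof -
    obtain u v where uv: "x = u * p + v * q" using xI unfolding I_def by blast
    obtain u' v' where uv': "d = u' * p + v' * q" using d unfolding I_def by blast
    have "x mod d = x - x div d * d" by (simp add: minus_div_mult_eq_mod)
    also have "\<dots> = (u - x div d * u') * p + (v - x div d * v') * q"
      by (subst (1) uv, subst (2) uv') (simp add: algebra_simps)
    finally have "x mod d \<in> I" unfolding I_def by blast
    then have "x mod d = 0" using least[of "x mod d"] degree_mod_less[OF d(2), of x] by (metis leD)
    then show ?thesis by (simp add: mod_eq_0_iff_dvd)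
  qed
  obtain p' q' where pq: "p = d * p'" "q = d * q'" using dvd[OF pI] dvd[OF qI] by (elim dvdE)
  obtain u v where "d = u * p + v * q" using d unfolding I_def by blast
  then have "d * (u * p' + v * q') = d * 1" using pq by (simp add: algebra_simps)
  then have "u * p' + v * q' = 1" using d(2) by (simp only: mult_cancel_left) simp
  with pq show thesis using that by blast
qed

text \<open>The least common multiple is \<open>d * p' * q'\<close> made monic. The identity
  \<open>u * p' + v * q' = 1\<close> shows that \<open>p'\<close> and \<open>q'\<close> have no
  common root in the closure, so each multiplicity is a maximum.\<close>

lemma monic_lcm_exists:
  fixes p q :: "'a::field poly"
  assumes p: "lead_coeff p = 1" and q: "lead_coeff q = 1"
  shows "\<exists>L. lead_coeff L = 1 \<and> p dvd L \<and> q dvd L \<and> (\<forall>h. p dvd h \<longrightarrow> q dvd h \<longrightarrow> L dvd h) \<and>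
    (\<forall>x. ac_order x L = max (ac_order x p) (ac_order x q))"
proof -
  have "p \<noteq> 0" using p by auto
  then obtain d p' q' u v where pd: "p = d * p'" and qd: "q = d * q'" and uv: "u * p' + v * q' = 1"
    using bezout_cofactors[of p q] by metis
  have nz: "d \<noteq> 0" "p' \<noteq> 0" "q' \<noteq> 0" using p q pd qd by auto
  define M where "M = d * p' * q'"
  define L where "L = smult (inverse (lead_coeff M)) M"
  have M: "M \<noteq> 0" using nz by (simp add: M_def)
  have "lead_coeff L = 1" using M by (simp add: L_def)
  moreover have "p dvd L" using pd by (auto simp: L_def M_def intro!: dvd_smult)
  moreover have "q dvd L" using qd by (auto simp: L_def M_def mult.commute mult.left_commute intro!: dvd_smult)
  moreover have "L dvd h" if h: "p dvd h" "q dvd h" for h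
  proof -
    obtain a b where a: "h = p * a" and b: "h = q * b" using h by (elim dvdE)
    have "h = (u * p' + v * q') * h" using uv by simp
    also have "\<dots> = u * p' * (q * b) + v * q' * (p * a)" using a b by (simp add: algebra_simps)
    also have "\<dots> = M * (u * b + v * a)" by (simp add: M_def pd qd algebra_simps)
    finally have "M dvd h" by (rule dvdI)
    then show ?thesis using M by (simp add: L_def smult_dvd_iff)
  qed
  moreover have "ac_order x L = max (ac_order x p) (ac_order x q)" for x
  proof -
    have ord: "ac_order x (f * g) = ac_order x f + ac_order x g" if "f \<noteq> 0" "g \<noteq> 0" for f g
      using that by (simp add: map_poly_to_ac order_mult)
    have "poly (map_poly to_ac (u * p' + v * q')) x = 1" unfolding uv by (simp add: map_poly_to_ac)
    then have "poly (map_poly to_ac p') x \<noteq> 0 \<or> poly (map_poly to_ac q') x \<noteq> 0"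
      by (auto simp: map_poly_to_ac(1) map_poly_to_ac(2))
    then have "ac_order x p' = 0 \<or> ac_order x q' = 0"
      by (elim disjE) (simp_all add: order_0I)
    moreover have "ac_order x L = ac_order x M"
      using M by (simp add: L_def map_poly_to_ac order_smult)
    ultimately show ?thesis using nz by (auto simp: M_def pd qd ord)
  qed
  ultimately show ?thesis by blast
qed

definition mlcm :: "'a::field poly \<Rightarrow> 'a poly \<Rightarrow> 'a poly" where
  "mlcm p q = (SOME L. lead_coeff L = 1 \<and> p dvd L \<and> q dvd L \<and>
     (\<forall>h. p dvd h \<longrightarrow> q dvd h \<longrightarrow> L dvd h) \<and>
     (\<forall>x. ac_order x L = max (ac_order x p) (ac_order x q)))"

lemma mlcm:
  assumes "lead_coeff p = 1" "lead_coeff q = 1"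
  shows "lead_coeff (mlcm p q) = 1" "p dvd mlcm p q" "q dvd mlcm p q"
    "p dvd h \<Longrightarrow> q dvd h \<Longrightarrow> mlcm p q dvd h"
    "ac_order x (mlcm p q) = max (ac_order x p) (ac_order x q)"
  using someI_ex[OF monic_lcm_exists[OF assms], folded mlcm_def] by blast+

text \<open>Splitting off one root at a time. \<open>R\<close> may be any finite set containing the
  roots, so that many polynomials can share one index set.\<close>

lemma degree_eq_sum_order:
  fixes f :: "'a::alg_closed_field poly"
  assumes "finite R" "f \<noteq> 0" "{x. poly f x = 0} \<subseteq> R"
  shows "Polynomial.degree f = (\<Sum>x\<in>R. Polynomial.order x f)"
  using assms(2,3)
proof (induction "Polynomial.degree f" arbitrary: f)
  case 0
  then have "Polynomial.order x f = 0" for x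
    using order_degree[of f x] by simp
  then show ?case using 0 by simp
next
  case (Suc m)
  obtain a where a: "poly f a = 0" using alg_closed_imp_poly_has_root[of f] Suc(2) by auto
  then obtain g where g: "f = [:- a, 1:] * g" by (auto simp: poly_eq_0_iff_dvd elim: dvdE)
  have gnz: "g \<noteq> 0" using g Suc by auto
  have deg: "Polynomial.degree f = Suc (Polynomial.degree g)"
    unfolding g using gnz by (subst degree_mult_eq) auto
  have "{x. poly g x = 0} \<subseteq> R" using Suc(4) g by auto
  then have "Polynomial.degree g = (\<Sum>x\<in>R. Polynomial.order x g)"
    using Suc(1)[of g] Suc(2) deg gnz by simp
  moreover have "Polynomial.order x f = (if x = a then 1 else 0) + Polynomial.order x g" for x
  proof -
    have "Polynomial.order x ([:- a, 1:] * g) = Polynomial.order x [:- a, 1:] + Polynomial.order x g"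
      using gnz by (intro order_mult) (simp del: mult_pCons_left)
    moreover have "Polynomial.order x [:- a, 1:] = (if x = a then 1 else 0)"
      using order_power_n_n[of a 1] order_0I[of "[:- a, 1:]" x] by auto
    ultimately show ?thesis unfolding g by simp
  qed
  moreover have "a \<in> R" using a Suc(4) by auto
  ultimately show ?case using deg assms(1) by (simp add: sum.distrib)
qed

section \<open>Counting multiplicities level by level\<close>

lemma upset_threshold:
  fixes P :: "nat \<Rightarrow> bool"
  assumes "\<And>i j. i \<le> j \<Longrightarrow> j < n \<Longrightarrow> P i \<Longrightarrow> P j"
  obtains \<alpha> where "\<alpha> \<le> n" "\<And>i. i < n \<Longrightarrow> P i \<longleftrightarrow> \<alpha> \<le> i"
proof (cases "\<exists>i<n. P i")
  case True
  define \<alpha> where "\<alpha> = (LEAST i. i < n \<and> P i)"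
  have "\<alpha> < n \<and> P \<alpha>" unfolding \<alpha>_def using True by (rule LeastI_ex)
  moreover have "\<alpha> \<le> i" if "i < n" "P i" for i
    unfolding \<alpha>_def using that by (intro Least_le) simp
  ultimately show thesis using that[of \<alpha>] assms by (metis less_imp_le)
next
  case False
  then show thesis using that[of n] by auto
qed

text \<open>Double counting: each \<open>a i\<close> is the number of levels \<open>t\<close>
  between 1 and \<open>a i\<close>.\<close>

lemma sum_levels:
  fixes a :: "nat \<Rightarrow> nat"
  assumes "\<And>i. i < n \<Longrightarrow> a i \<le> M"
  shows "(\<Sum>i<n. a i) = (\<Sum>t\<in>{1..M}. card {i. i < n \<and> t \<le> a i})"
proof -
  have "a i = (\<Sum>t\<in>{1..M}. if t \<le> a i then 1 else 0)" if "i < n" for i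
  proof -
    have "{1..M} \<inter> {t. t \<le> a i} = {1..a i}" using assms[OF that] by auto
    then show ?thesis by (simp add: sum.If_cases)
  qed
  then have "(\<Sum>i<n. a i) = (\<Sum>i<n. \<Sum>t\<in>{1..M}. if t \<le> a i then 1 else 0)" by simp
  also have "\<dots> = (\<Sum>t\<in>{1..M}. \<Sum>i<n. if t \<le> a i then 1 else 0)" by (rule sum.swap)
  also have "\<dots> = (\<Sum>t\<in>{1..M}. card {i. i < n \<and> t \<le> a i})"
    by (intro sum.cong refl) (simp add: sum.If_cases Int_def)
  finally show ?thesis .
qed

text \<open>It suffices to compare level sets. At a level \<open>t\<close> the sets of
  \<open>a\<close> and \<open>b\<close> are final segments of sizes \<open>m\<close> and
  \<open>k\<close>, the hypotheses say that \<open>m\<close> and \<open>k\<close> differ by at most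
  \<open>s + 1\<close>, and the set of \<open>c\<close> has size \<open>m - 1\<close> or
  \<open>k - s\<close>; either size times \<open>s + 1\<close> is at most \<open>s * m + k\<close>.
  The weights \<open>s\<close> and 1 are chosen such that, when both sums equal \<open>n\<close>,
  the sum of \<open>c\<close> is at most \<open>n\<close>.\<close>

lemma shifted_max_sum_le:
  fixes a b :: "nat \<Rightarrow> nat"
  assumes mono: "\<And>i j. i \<le> j \<Longrightarrow> j < n \<Longrightarrow> a i \<le> a j" "\<And>i j. i \<le> j \<Longrightarrow> j < n \<Longrightarrow> b i \<le> b j"
    and ab: "\<And>i. i + Suc s < n \<Longrightarrow> a i \<le> b (i + Suc s)"
    and ba: "\<And>i. i + Suc s < n \<Longrightarrow> b i \<le> a (i + Suc s)"
  defines "c \<equiv> \<lambda>i. max (if i < 1 then 0 else a (i - 1)) (if i < s then 0 else b (i - s))"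
  shows "Suc s * (\<Sum>i<n. c i) \<le> s * (\<Sum>i<n. a i) + (\<Sum>i<n. b i)"
proof -
  define M where "M = (\<Sum>i<n. a i) + (\<Sum>i<n. b i)"
  have aM: "a i \<le> M" and bM: "b i \<le> M" if "i < n" for i
    using member_le_sum[of i "{..<n}" a] member_le_sum[of i "{..<n}" b] that by (auto simp: M_def)
  have cM: "c i \<le> M" if "i < n" for i
    using aM[of "i - 1"] bM[of "i - s"] that by (auto simp: c_def)
  have level: "Suc s * card {i. i < n \<and> t \<le> c i} \<le>
      s * card {i. i < n \<and> t \<le> a i} + card {i. i < n \<and> t \<le> b i}" if t: "1 \<le> t" for t
  proof -
    obtain \<alpha> where \<alpha>: "\<alpha> \<le> n" "\<And>i. i < n \<Longrightarrow> t \<le> a i \<longleftrightarrow> \<alpha> \<le> i"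
      using upset_threshold[of n "\<lambda>i. t \<le> a i"] mono(1) by (metis order.trans)
    obtain \<beta> where \<beta>: "\<beta> \<le> n" "\<And>i. i < n \<Longrightarrow> t \<le> b i \<longleftrightarrow> \<beta> \<le> i"
      using upset_threshold[of n "\<lambda>i. t \<le> b i"] mono(2) by (metis order.trans)
    have A: "{i. i < n \<and> t \<le> a i} = {\<alpha>..<n}" using \<alpha> by auto
    have B: "{i. i < n \<and> t \<le> b i} = {\<beta>..<n}" using \<beta> by auto
    have C: "{i. i < n \<and> t \<le> c i} = {min (\<alpha> + 1) (\<beta> + s)..<n}"
    proof (rule Set.set_eqI, rule iffI)
      fix i assume "i \<in> {i. i < n \<and> t \<le> c i}"
      then have i: "i < n" "t \<le> (if i < 1 then 0 else a (i - 1)) \<or> t \<le> (if i < s then 0 else b (i - s))"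
        by (auto simp: c_def)
      then have "\<alpha> + 1 \<le> i \<or> \<beta> + s \<le> i"
        using \<alpha>(2)[of "i - 1"] \<beta>(2)[of "i - s"] t by (auto split: if_splits)
      then show "i \<in> {min (\<alpha> + 1) (\<beta> + s)..<n}" using i by auto
    next
      fix i assume i: "i \<in> {min (\<alpha> + 1) (\<beta> + s)..<n}"
      then consider "\<alpha> + 1 \<le> i" | "\<beta> + s \<le> i" by (auto simp: min_le_iff_disj)
      then have "t \<le> (if i < 1 then 0 else a (i - 1)) \<or> t \<le> (if i < s then 0 else b (i - s))"
      proof cases
        case 1
        then have "\<alpha> \<le> i - 1" "i - 1 < n" "\<not> i < 1" using i by auto
        then show ?thesis using \<alpha>(2)[of "i - 1"] by auto
      next
        case 2
        then have "\<beta> \<le> i - s" "i - s < n" "\<not> i < s" using i by auto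
        then show ?thesis using \<beta>(2)[of "i - s"] by auto
      qed
      then show "i \<in> {i. i < n \<and> t \<le> c i}" using i by (auto simp: c_def)
    qed
    have "\<beta> \<le> \<alpha> + Suc s"
    proof (cases "\<alpha> + Suc s < n")
      case True
      then have "t \<le> b (\<alpha> + Suc s)" using \<alpha>(2)[of \<alpha>] ab[of \<alpha>] by simp
      then show ?thesis using \<beta>(2)[OF True] by simp
    qed (use \<beta> in simp)
    moreover have "\<alpha> \<le> \<beta> + Suc s"
    proof (cases "\<beta> + Suc s < n")
      case True
      then have "t \<le> a (\<beta> + Suc s)" using \<beta>(2)[of \<beta>] ba[of \<beta>] by simp
      then show ?thesis using \<alpha>(2)[OF True] by simp
    qed (use \<alpha> in simp)
    moreover define m where "m = n - \<alpha>"
    moreover define k where "k = n - \<beta>"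
    ultimately have mk: "m \<le> k + Suc s" "k \<le> m + Suc s" using \<alpha>(1) \<beta>(1) by auto
    have "Suc s * (m - 1) \<le> s * m + k"
    proof (cases m)
      case (Suc m')
      then show ?thesis using mk by (simp add: algebra_simps)
    qed simp
    moreover have "Suc s * (k - s) \<le> s * m + k"
    proof (cases "s \<le> k")
      case True
      define k' where "k' = k - s"
      have "k' \<le> m + 1" using mk by (simp add: k'_def)
      then have "s * k' \<le> s * (m + 1)" by (rule mult_le_mono2)
      then show ?thesis using True by (simp add: k'_def algebra_simps)
    qed simp
    moreover have "n - min (\<alpha> + 1) (\<beta> + s) = m - 1 \<or> n - min (\<alpha> + 1) (\<beta> + s) = k - s"
      by (auto simp: m_def k_def min_def)
    ultimately show ?thesis unfolding A B C by (auto simp: m_def k_def)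
  qed
  have "Suc s * (\<Sum>i<n. c i) = (\<Sum>t\<in>{1..M}. Suc s * card {i. i < n \<and> t \<le> c i})"
    by (subst sum_levels[OF cM]) (simp_all only: sum_distrib_left)
  also have "\<dots> \<le> (\<Sum>t\<in>{1..M}. s * card {i. i < n \<and> t \<le> a i} + card {i. i < n \<and> t \<le> b i})"
    by (intro sum_mono level) simp
  also have "\<dots> = s * (\<Sum>i<n. a i) + (\<Sum>i<n. b i)"
    by (simp add: sum.distrib sum_distrib_left sum_levels[of n a M] sum_levels[of n b M] aM bM)
  finally show ?thesis .
qed

section \<open>Interlaced divisor chains\<close>

definition interlaced :: "nat \<Rightarrow> nat \<Rightarrow> (nat \<Rightarrow> 'a::field poly) \<Rightarrow> (nat \<Rightarrow> 'a poly) \<Rightarrow> bool" where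
  "interlaced n r \<phi> \<psi> \<longleftrightarrow> (\<forall>i. i + r < n \<longrightarrow> \<phi> i dvd \<psi> (i + r) \<and> \<psi> i dvd \<phi> (i + r))"

lemma interlacedD:
  assumes "interlaced n r \<phi> \<psi>" "j = i + r" "j < n"
  shows "\<phi> i dvd \<psi> j" "\<psi> i dvd \<phi> j"
  using assms by (simp_all add: interlaced_def)

definition shift :: "nat \<Rightarrow> (nat \<Rightarrow> 'a::field poly) \<Rightarrow> nat \<Rightarrow> 'a poly" where
  "shift k \<phi> i = (if i < k then 1 else \<phi> (i - k))"

lemma shift_monic:
  assumes "invariant_chain n \<phi>" "i < n"
  shows "lead_coeff (shift k \<phi> i) = 1"
  using invariant_chainD(2)[OF assms(1), of "i - k"] assms(2) by (simp add: shift_def)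

text \<open>
  \<open>\<chi>\<^sub>i\<close> is the least common multiple of \<open>\<phi>\<^sub>i\<^sub>-\<^sub>1\<close> and \<open>\<psi>\<^sub>i\<^sub>-\<^sub>s\<close>, and the last one is multiplied by a power
  of \<open>x\<close> to bring the total degree up to \<open>n\<close>. That the least common multiples do not already exceed
  total degree \<open>n\<close> is the inequality \<open>shifted_max_sum_le\<close>, applied to the multiplicities of each root.
\<close>

lemma interpolation:
  assumes \<phi>: "invariant_chain n \<phi>" and \<psi>: "invariant_chain n \<psi>"
    and int: "interlaced n (Suc s) \<phi> \<psi>" and s: "1 \<le> s" and n: "1 \<le> n"
  obtains \<chi> where "invariant_chain n \<chi>" "interlaced n 1 \<phi> \<chi>" "interlaced n s \<chi> \<psi>"
proof -
  define L where "L = (\<lambda>i. mlcm (shift 1 \<phi> i) (shift s \<psi> i))"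
  have L1: "lead_coeff (L i) = 1" "shift 1 \<phi> i dvd L i" "shift s \<psi> i dvd L i" if "i < n" for i
    unfolding L_def using mlcm(1-3)[OF shift_monic[OF \<phi> that] shift_monic[OF \<psi> that]] by blast+
  have L2: "L i dvd h" if "i < n" "1 \<le> i \<Longrightarrow> \<phi> (i - 1) dvd h" "s \<le> i \<Longrightarrow> \<psi> (i - s) dvd h" for i h
    unfolding L_def
    by (rule mlcm(4)[OF shift_monic[OF \<phi> that(1)] shift_monic[OF \<psi> that(1)]])
       (use that in \<open>auto simp: shift_def\<close>)
  have Lnz: "L i \<noteq> 0" if "i < n" for i using L1(1)[OF that] by auto
  \<comment> \<open>One finite set containing the roots of all polynomials involved, so that all
    degrees become sums over the same points.\<close>
  define R where "R = (\<Union>i<n. {x. poly (map_poly to_ac (L i * \<phi> i * \<psi> i)) x = 0})"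
  have nz: "L i * \<phi> i * \<psi> i \<noteq> 0" if "i < n" for i
    using Lnz[OF that] invariant_chainD(4)[OF \<phi> that] invariant_chainD(4)[OF \<psi> that] by simp
  have finR: "finite R" unfolding R_def
    by (rule finite_UN_I) (use nz in \<open>simp_all add: poly_roots_finite map_poly_to_ac(4) del: mult_eq_0_iff\<close>)
  have deg: "Polynomial.degree f = (\<Sum>x\<in>R. ac_order x f)"
    if i: "i < n" and fd: "f dvd L i * \<phi> i * \<psi> i" for i f
  proof -
    have "f \<noteq> 0" using fd nz[OF i] by auto
    then have f: "map_poly to_ac f \<noteq> 0" by (simp add: map_poly_to_ac)
    obtain g where "L i * \<phi> i * \<psi> i = f * g" using fd by (elim dvdE)
    then have "poly (map_poly to_ac (L i * \<phi> i * \<psi> i)) x = 0" if "poly (map_poly to_ac f) x = 0" for x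
      using that by (simp only: map_poly_to_ac(2)) simp
    then have "{x. poly (map_poly to_ac f) x = 0} \<subseteq> R"
      using i unfolding R_def by blast
    from degree_eq_sum_order[OF finR f this] show ?thesis by (simp add: map_poly_to_ac)
  qed
  have dg: "Polynomial.degree (L i) = (\<Sum>x\<in>R. ac_order x (L i))"
    "Polynomial.degree (\<phi> i) = (\<Sum>x\<in>R. ac_order x (\<phi> i))"
    "Polynomial.degree (\<psi> i) = (\<Sum>x\<in>R. ac_order x (\<psi> i))" if "i < n" for i
    by (rule deg[OF that]; simp)+
  have ole: "ac_order x p \<le> ac_order x q" if "p dvd q" "q \<noteq> 0" for x and p q :: "'a poly"
    using that dvd_imp_order_le[of "map_poly to_ac q" "map_poly to_ac p" x]
    by (auto elim!: dvdE simp: map_poly_to_ac)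
  have local: "Suc s * (\<Sum>i<n. ac_order x (L i)) \<le>
      s * (\<Sum>i<n. ac_order x (\<phi> i)) + (\<Sum>i<n. ac_order x (\<psi> i))" for x
  proof -
    have "ac_order x (L i) = max (if i < 1 then 0 else ac_order x (\<phi> (i - 1)))
        (if i < s then 0 else ac_order x (\<psi> (i - s)))" if "i < n" for i
      unfolding L_def mlcm(5)[OF shift_monic[OF \<phi> that] shift_monic[OF \<psi> that]]
      by (simp add: shift_def)
    then have eq: "(\<Sum>i<n. ac_order x (L i)) = (\<Sum>i<n. max (if i < 1 then 0 else ac_order x (\<phi> (i - 1)))
        (if i < s then 0 else ac_order x (\<psi> (i - s))))" by (intro sum.cong) auto
    show ?thesis unfolding eq
      by (rule shifted_max_sum_le[where a = "\<lambda>i. ac_order x (\<phi> i)" and b = "\<lambda>i. ac_order x (\<psi> i)"])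
         (use int invariant_chainD(1,4)[OF \<phi>] invariant_chainD(1,4)[OF \<psi>] in
           \<open>auto simp: interlaced_def intro!: ole\<close>)
  qed
  have swap: "(\<Sum>i<n. Polynomial.degree (f i)) = (\<Sum>x\<in>R. \<Sum>i<n. ac_order x (f i))"
    if "\<And>i. i < n \<Longrightarrow> Polynomial.degree (f i) = (\<Sum>x\<in>R. ac_order x (f i))" for f :: "nat \<Rightarrow> 'a poly"
  proof -
    have "(\<Sum>i<n. Polynomial.degree (f i)) = (\<Sum>i<n. \<Sum>x\<in>R. ac_order x (f i))"
      by (intro sum.cong refl that) simp
    also have "\<dots> = (\<Sum>x\<in>R. \<Sum>i<n. ac_order x (f i))" by (rule sum.swap)
    finally show ?thesis .
  qed
  have "Suc s * (\<Sum>i<n. Polynomial.degree (L i)) = (\<Sum>x\<in>R. Suc s * (\<Sum>i<n. ac_order x (L i)))"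
    by (subst swap[OF dg(1)]) (assumption, rule sum_distrib_left)
  also have "\<dots> \<le> (\<Sum>x\<in>R. s * (\<Sum>i<n. ac_order x (\<phi> i)) + (\<Sum>i<n. ac_order x (\<psi> i)))"
    by (intro sum_mono local)
  also have "\<dots> = s * (\<Sum>x\<in>R. \<Sum>i<n. ac_order x (\<phi> i)) + (\<Sum>x\<in>R. \<Sum>i<n. ac_order x (\<psi> i))"
    by (simp only: sum.distrib sum_distrib_left)
  also have "\<dots> = s * (\<Sum>i<n. Polynomial.degree (\<phi> i)) + (\<Sum>i<n. Polynomial.degree (\<psi> i))"
    by (simp only: swap[OF dg(2)] swap[OF dg(3)])
  also have "\<dots> = Suc s * n"
    using invariant_chainD(3)[OF \<phi>] invariant_chainD(3)[OF \<psi>] by simp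
  finally have degL: "(\<Sum>i<n. Polynomial.degree (L i)) \<le> n"
    by (simp only: Suc_mult_le_cancel1)
  define e where "e = n - (\<Sum>i<n. Polynomial.degree (L i))"
  \<comment> \<open>The last member can absorb any factor: neither interlacing condition nor the
    chain asks it to divide another polynomial.\<close>
  define \<chi> where "\<chi> = (\<lambda>i. if i = n - 1 then L i * monom 1 e else L i)"
  have L\<chi>: "L i dvd \<chi> i" for i by (simp add: \<chi>_def)
  have sh: "\<phi> (i - 1) dvd L i" if "1 \<le> i" "i < n" for i
    using L1(2)[OF that(2)] that(1) by (simp add: shift_def)
  have sh': "\<psi> (i - s) dvd L i" if "s \<le> i" "i < n" for i
    using L1(3)[OF that(2)] that(1) by (simp add: shift_def)
  have chain: "L i dvd L j" if ij: "i \<le> j" "j < n" for i j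
  proof -
    have "\<phi> (i - 1) dvd L j" if "1 \<le> i"
    proof (rule dvd_trans[OF _ sh])
      show "\<phi> (i - 1) dvd \<phi> (j - 1)" by (rule invariant_chainD(1)[OF \<phi>]) (use that ij in auto)
    qed (use that ij in auto)
    moreover have "\<psi> (i - s) dvd L j" if "s \<le> i"
    proof (rule dvd_trans[OF _ sh'])
      show "\<psi> (i - s) dvd \<psi> (j - s)" by (rule invariant_chainD(1)[OF \<psi>]) (use that ij in auto)
    qed (use that ij in auto)
    ultimately show ?thesis using L2[of i "L j"] ij by simp
  qed
  have "invariant_chain n \<chi>"
    unfolding invariant_chain_def
  proof (intro conjI allI impI)
    show "\<chi> i dvd \<chi> j" if "i \<le> j" "j < n" for i j
    proof (cases "i = j")
      case False
      then have "\<chi> i = L i" using that by (simp add: \<chi>_def)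
      then show ?thesis using dvd_trans[OF chain[OF that] L\<chi>] by simp
    qed simp
    show "lead_coeff (\<chi> i) = 1" if "i < n" for i
      using L1(1)[OF that] by (auto simp: \<chi>_def lead_coeff_mult degree_monom_eq)
    have "Polynomial.degree (\<chi> i) = Polynomial.degree (L i) + (if i = n - 1 then e else 0)" if "i < n" for i
      using Lnz[OF that] by (auto simp: \<chi>_def degree_mult_eq degree_monom_eq monom_eq_0_iff)
    then have "(\<Sum>i<n. Polynomial.degree (\<chi> i)) = (\<Sum>i<n. Polynomial.degree (L i)) + e"
      using n by (simp add: sum.distrib)
    then show "(\<Sum>i<n. Polynomial.degree (\<chi> i)) = n" using degL by (simp add: e_def)
  qed
  moreover have "interlaced n 1 \<phi> \<chi>"
    unfolding interlaced_def
  proof (intro allI impI conjI)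
    fix i assume i: "i + 1 < n"
    show "\<phi> i dvd \<chi> (i + 1)" using dvd_trans[OF sh[of "i + 1"] L\<chi>] i by simp
    have "\<phi> (i - 1) dvd \<phi> (i + 1)" by (rule invariant_chainD(1)[OF \<phi>]) (use i in auto)
    moreover have "\<psi> (i - s) dvd \<phi> (i + 1)" if "s \<le> i"
      by (rule interlacedD(2)[OF int]) (use that i in simp_all)
    ultimately have "L i dvd \<phi> (i + 1)" using L2[of i "\<phi> (i + 1)"] i by simp
    then show "\<chi> i dvd \<phi> (i + 1)" using i by (auto simp: \<chi>_def)
  qed
  moreover have "interlaced n s \<chi> \<psi>"
    unfolding interlaced_def
  proof (intro allI impI conjI)
    fix i assume i: "i + s < n"
    have "\<psi> (i + s - s) dvd L (i + s)" by (rule sh'[OF le_add2 i])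
    then have "\<psi> i dvd L (i + s)" unfolding diff_add_inverse2 .
    then have B: "\<psi> i dvd \<chi> (i + s)" by (rule dvd_trans[OF _ L\<chi>])
    have "\<phi> (i - 1) dvd \<psi> (i + s)" if "1 \<le> i"
      by (rule interlacedD(1)[OF int]) (use that i in simp_all)
    moreover have "\<psi> (i - s) dvd \<psi> (i + s)" by (rule invariant_chainD(1)[OF \<psi>]) (use i in auto)
    ultimately have "L i dvd \<psi> (i + s)" using L2[of i "\<psi> (i + s)"] i by simp
    then show "\<chi> i dvd \<psi> (i + s)" using i s by (auto simp: \<chi>_def)
    show "\<psi> i dvd \<chi> (i + s)" by (rule B)
  qed
  ultimately show thesis using that by blast
qed

section \<open>Linear functionals and products of monic polynomials\<close>

lemma dot_sum: "dot n y (\<Sum>x\<in>A. f x) = (\<Sum>x\<in>A. dot n y (f x))"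
  unfolding dot_def sum_fun_apply sum_distrib_left by (rule sum.swap)

text \<open>With the vectors as columns, padded by zero columns to a square matrix, the determinant
  vanishes; a kernel vector of the transpose is the functional.\<close>

lemma common_annihilator:
  fixes vs :: "(nat \<Rightarrow> 'a::field) list"
  assumes "length vs < n"
  obtains y l where "l < n" "y l \<noteq> 0" "\<And>v. v \<in> set vs \<Longrightarrow> dot n y v = 0"
proof -
  define A where "A = mat n n (\<lambda>(j, i). if i < length vs then (vs ! i) j else 0)"
  have A: "A \<in> carrier_mat n n" by (simp add: A_def)
  have "Determinant.det A = 0"
    by (rule det_zero_column[OF A assms]) (use assms in \<open>simp add: A_def\<close>)
  then have "Determinant.det (transpose_mat A) = 0" by (simp add: det_transpose[OF A])
  then obtain w where w: "w \<in> carrier_vec n" "w \<noteq> 0\<^sub>v n" "transpose_mat A *\<^sub>v w = 0\<^sub>v n"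
    using det_0_iff_vec_prod_zero_field[of "transpose_mat A" n] A by auto
  obtain l where l: "l < n" "w $ l \<noteq> 0" using w by (metis eq_vecI carrier_vecD index_zero_vec)
  have "dot n (\<lambda>l. w $ l) v = 0" if "v \<in> set vs" for v
  proof -
    obtain i where i: "i < length vs" "v = vs ! i" using \<open>v \<in> set vs\<close> by (metis in_set_conv_nth)
    have "(transpose_mat A *\<^sub>v w) $ i = 0" using w(3) i assms by simp
    then show ?thesis using i assms w(1) A
      by (simp add: scalar_prod_def dot_def A_def atLeast0LessThan mult.commute)
  qed
  then show thesis using that[of l "\<lambda>l. w $ l"] l by blast
qed

lemma prod_monic:
  fixes \<alpha> :: "nat \<Rightarrow> 'a::field poly"
  assumes "\<And>i. i \<in> A \<Longrightarrow> lead_coeff (\<alpha> i) = 1"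
  shows "lead_coeff (prod \<alpha> A) = 1"
  using assms by (induction A rule: infinite_finite_induct) (simp_all add: lead_coeff_mult)

lemma degree_prod_monic:
  fixes \<alpha> :: "nat \<Rightarrow> 'a::field poly"
  assumes "\<And>i. i < n \<Longrightarrow> lead_coeff (\<alpha> i) = 1"
  shows "Polynomial.degree (\<Prod>i<n. \<alpha> i) = (\<Sum>i<n. Polynomial.degree (\<alpha> i))"
  by (rule degree_prod_eq_sum_degree) (use assms in force)

lemma monic_cofactor:
  fixes p q :: "'a::field poly"
  assumes "lead_coeff p = 1" "lead_coeff q = 1" "q dvd p"
  obtains r where "p = q * r" "lead_coeff r = 1" "Polynomial.degree p = Polynomial.degree q + Polynomial.degree r"
proof -
  obtain r where r: "p = q * r" using assms(3) by (elim dvdE)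
  then have "q \<noteq> 0" "r \<noteq> 0" using assms(1) by auto
  then have "Polynomial.degree p = Polynomial.degree q + Polynomial.degree r"
    by (simp add: r degree_mult_eq)
  moreover have "lead_coeff r = 1" using lead_coeff_mult[of q r] assms(1,2) unfolding r by simp
  ultimately show thesis using that r by blast
qed

section \<open>Perturbations of bounded rank\<close>

text \<open>
  Write \<open>\<phi>\<^sub>i = \<gamma>\<^sub>i \<alpha>\<^sub>i\<close>, \<open>\<psi>\<^sub>i = \<gamma>\<^sub>i \<beta>\<^sub>i\<close>, and let \<open>k\<close> be the common degree of \<open>a = \<Prod>\<^sub>i \<alpha>\<^sub>i\<close> and
  \<open>b = \<Prod>\<^sub>i \<beta>\<^sub>i\<close>. The vectors \<open>e\<^sub>i = \<alpha>\<^sub>i(T) f\<^sub>i - f\<^sub>i\<^sub>-\<^sub>1\<close> and \<open>g = f\<^sub>n\<^sub>-\<^sub>1\<close> generate the space and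
  \<open>\<gamma>\<^sub>i(T) e\<^sub>i = 0\<close>. Only \<open>n - 1\<close> vectors have to be killed for a functional \<open>y\<close> to vanish on all \<open>T\<^sup>j e\<^sub>i\<close>
  and on \<open>T\<^sup>j g\<close> for \<open>j < k - 1\<close>; normalize it by \<open>y(T\<^sup>k\<^sup>-\<^sup>1 g) = 1\<close>. Then \<open>T' = T + (w - b(T) g) y\<close> agrees with
  \<open>T\<close> on the \<open>e\<^sub>i\<close> and satisfies \<open>b(T') g = w\<close>. For \<open>w = \<Sum>\<^sub>i (\<beta>\<^sub>0 \<dots> \<beta>\<^sub>i\<^sub>-\<^sub>1)(T) e\<^sub>i\<close> this makes the vectors
  \<open>f'\<^sub>i\<^sub>-\<^sub>1 = \<beta>\<^sub>i(T') f'\<^sub>i - e\<^sub>i\<close> with \<open>f'\<^sub>n\<^sub>-\<^sub>1 = g\<close> generators for \<open>\<psi>\<close>.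
\<close>

lemma rank_one_operator:
  fixes T :: "(nat \<Rightarrow> 'a::field) \<Rightarrow> nat \<Rightarrow> 'a"
  assumes lin: "linear_op fscl T" and Tsupp: "\<And>v. supp_in n (T v)"
    and \<phi>: "invariant_chain n \<phi>" and \<psi>: "invariant_chain n \<psi>"
    and gens: "cyclic_gens n T \<phi> f"
    and monic: "\<And>i. i < n \<Longrightarrow> lead_coeff (\<gamma> i) = 1"
    and \<gamma>\<phi>: "\<And>i. i < n \<Longrightarrow> \<gamma> i dvd \<phi> i" and \<gamma>\<psi>: "\<And>i. i < n \<Longrightarrow> \<gamma> i dvd \<psi> i"
    and \<phi>\<gamma>: "\<And>i. Suc i < n \<Longrightarrow> \<phi> i dvd \<gamma> (Suc i)" and \<psi>\<gamma>: "\<And>i. Suc i < n \<Longrightarrow> \<psi> i dvd \<gamma> (Suc i)"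
  shows "\<exists>u y f'. supp_in n u \<and> cyclic_gens n (\<lambda>v. T v + fscl (dot n y v) u) \<psi> f'"
proof -
  interpret linear_op fscl T by (rule lin)
  have fsupp: "supp_in n (f i)" and fzero: "act (\<phi> i) (f i) = 0" if "i < n" for i
    using gens that by (auto simp: cyclic_gens_def)
  have fspan: "v \<in> span_of n f" if "supp_in n v" for v
    using gens that by (auto simp: cyclic_gens_def)
  have "\<exists>r. \<phi> i = \<gamma> i * r \<and> lead_coeff r = 1 \<and>
      Polynomial.degree (\<phi> i) = Polynomial.degree (\<gamma> i) + Polynomial.degree r" if "i < n" for i
    using monic_cofactor[OF invariant_chainD(2)[OF \<phi> that] monic[OF that] \<gamma>\<phi>[OF that]] by metis
  then obtain \<alpha> where \<alpha>: "\<And>i. i < n \<Longrightarrow> \<phi> i = \<gamma> i * \<alpha> i" "\<And>i. i < n \<Longrightarrow> lead_coeff (\<alpha> i) = 1"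
    "\<And>i. i < n \<Longrightarrow> Polynomial.degree (\<phi> i) = Polynomial.degree (\<gamma> i) + Polynomial.degree (\<alpha> i)"
    by metis
  have "\<exists>r. \<psi> i = \<gamma> i * r \<and> lead_coeff r = 1 \<and>
      Polynomial.degree (\<psi> i) = Polynomial.degree (\<gamma> i) + Polynomial.degree r" if "i < n" for i
    using monic_cofactor[OF invariant_chainD(2)[OF \<psi> that] monic[OF that] \<gamma>\<psi>[OF that]] by metis
  then obtain \<beta> where \<beta>: "\<And>i. i < n \<Longrightarrow> \<psi> i = \<gamma> i * \<beta> i" "\<And>i. i < n \<Longrightarrow> lead_coeff (\<beta> i) = 1"
    "\<And>i. i < n \<Longrightarrow> Polynomial.degree (\<psi> i) = Polynomial.degree (\<gamma> i) + Polynomial.degree (\<beta> i)"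
    by metis
  define k where "k = (\<Sum>i<n. Polynomial.degree (\<alpha> i))"
  have nk: "(\<Sum>i<n. Polynomial.degree (\<gamma> i)) + k = n"
    unfolding k_def using invariant_chainD(3)[OF \<phi>] \<alpha>(3) by (simp add: sum.distrib)
  have k\<beta>: "(\<Sum>i<n. Polynomial.degree (\<beta> i)) = k"
    using invariant_chainD(3)[OF \<psi>] \<beta>(3) nk by (simp add: sum.distrib)
  show ?thesis
  proof (cases "k = 0")
    case True
    have "\<gamma> i = \<phi> i" if "i < n" for i
      by (rule monic_chain_eq[of n, OF \<gamma>\<phi> monic invariant_chainD(2)[OF \<phi>] _ that])
         (use nk True invariant_chainD(3)[OF \<phi>] in auto)
    moreover have "\<gamma> i = \<psi> i" if "i < n" for i
      by (rule monic_chain_eq[of n, OF \<gamma>\<psi> monic invariant_chainD(2)[OF \<psi>] _ that])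
         (use nk True invariant_chainD(3)[OF \<psi>] in auto)
    ultimately have "cyclic_gens n T \<psi> f" using gens by (simp add: cyclic_gens_def)
    moreover have "(\<lambda>v. T v + fscl (dot n (\<lambda>_. 0) v) 0) = T" by (rule ext) simp
    ultimately have "cyclic_gens n (\<lambda>v. T v + fscl (dot n (\<lambda>_. 0) v) 0) \<psi> f" by (simp only:)
    then show ?thesis
      by (intro exI[of _ 0] exI[of _ "\<lambda>_. 0"] exI[of _ f] conjI supp_in_simps(1))
  next
    case False
    then have k1: "1 \<le> k" and n1: "1 \<le> n" using nk by auto
    \<comment> \<open>The generators shifted by one, with \<open>F 0 = 0\<close> in place of a
      generator of index -1, so that \<open>e 0\<close> follows the same formula as the
      others.\<close>
    define F where "F = (\<lambda>i. if i = 0 then 0 else f (i - 1))"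
    have F_Suc [simp]: "F (Suc i) = f i" for i by (simp add: F_def)
    define e where "e = (\<lambda>i. act (\<alpha> i) (f i) - F i)"
    define g where "g = f (n - 1)"
    have gF: "g = F n" using n1 by (simp add: g_def F_def)
    have Fsupp: "supp_in n (F i)" if "i \<le> n" for i using fsupp that by (simp add: F_def)
    have asupp: "supp_in n (act p v)" if "supp_in n v" for p v
      using act_invariant[of "{v. supp_in n v}" v p] Tsupp that by simp
    have esupp: "supp_in n (e i)" if "i < n" for i
      unfolding e_def using that by (intro supp_in_simps(4) asupp fsupp Fsupp) auto
    have ezero: "act (\<gamma> i) (e i) = 0" if i: "i < n" for i
    proof -
      have "act (\<gamma> i) (act (\<alpha> i) (f i)) = 0"
        using fzero[OF i] \<alpha>(1)[OF i] by (simp add: act_mult)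
      moreover have "act (\<gamma> i) (F i) = 0"
      proof (cases i)
        case (Suc j)
        then show ?thesis using act_dvd_zero[OF \<phi>\<gamma> fzero, of j] i by simp
      qed (simp add: F_def)
      ultimately show ?thesis by (simp only: e_def act_diff_right diff_self)
    qed
    \<comment> \<open>Modulo the span of the \<open>e i\<close>, each \<open>F i\<close> is
      \<open>c i\<close> applied to \<open>g\<close>. At \<open>i = 0\<close> this says that
      \<open>c 0\<close> annihilates \<open>g\<close> in the quotient.\<close>
    define c where "c = (\<lambda>i. \<Prod>l\<in>{i..<n}. \<alpha> l)"
    have c_rec: "c i = \<alpha> i * c (Suc i)" if "i < n" for i
      unfolding c_def using that by (rule prod.atLeast_Suc_lessThan)
    have FS: "F i - act (c i) g \<in> span_of n e" if "i \<le> n" for i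
      using that
    proof (induction i rule: inc_induct)
      case base
      have "c n = 1" by (simp add: c_def)
      then show ?case by (simp only: gF act_one diff_self span_of_zero)
    next
      case (step m)
      have "F m = act (\<alpha> m) (F (Suc m)) - e m" by (simp add: e_def)
      then have "F m - act (c m) g = act (\<alpha> m) (F (Suc m)) - e m - act (\<alpha> m) (act (c (Suc m)) g)"
        by (simp only: c_rec[OF step(2)] act_mult)
      also have "\<dots> = act (\<alpha> m) (F (Suc m)) - act (\<alpha> m) (act (c (Suc m)) g) - e m"
        by (simp only: diff_diff_eq add.commute[of "e m"])
      also have "\<dots> = act (\<alpha> m) (F (Suc m) - act (c (Suc m)) g) - e m"
        by (simp only: act_diff_right)
      also have "\<dots> \<in> span_of n e"
        by (intro span_of_diff span_of_act step(3) span_of_base step(2))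
      finally show ?case .
    qed
    define a where "a = c 0"
    have a_prod: "a = (\<Prod>i<n. \<alpha> i)" by (simp add: a_def c_def atLeast0LessThan)
    have a_deg: "Polynomial.degree a = k" and a_monic: "lead_coeff a = 1"
      unfolding a_prod using degree_prod_monic[of n \<alpha>] prod_monic[of "{..<n}" \<alpha>] \<alpha>(2)
      by (simp_all add: k_def)
    have a0: "a \<noteq> 0" using a_monic by auto
    have ag: "act a g \<in> span_of n e"
      using span_of_diff[OF span_of_zero FS[of 0]] by (simp add: a_def F_def)
    \<comment> \<open>The quotient by the span of the \<open>e i\<close> is cyclic, generated by
      \<open>g\<close> and annihilated by \<open>a\<close> of degree \<open>k\<close>; so remainders
      of degree below \<open>k\<close> suffice.\<close>
    have decomp: "\<exists>p. (Polynomial.degree p < k \<or> p = 0) \<and> v - act p g \<in> span_of n e"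
      if v: "supp_in n v" for v
    proof -
      obtain q where q: "v = (\<Sum>j<n. act (q j) (f j))" using fspan[OF v] unfolding span_of_def by blast
      define p where "p = (\<Sum>j<n. q j * c (Suc j))"
      have "v - act p g = (\<Sum>j<n. act (q j) (F (Suc j) - act (c (Suc j)) g))"
        unfolding q p_def act_sum act_mult act_diff_right sum_subtractf F_Suc ..
      also have "\<dots> \<in> span_of n e" by (intro span_of_sum span_of_act FS) auto
      finally have 1: "v - act p g \<in> span_of n e" .
      have "act p g = act (p div a) (act a g) + act (p mod a) g"
        unfolding act_mult[symmetric] act_add[symmetric] by (simp only: div_mult_mod_eq)
      then have "v - act (p mod a) g = (v - act p g) + act (p div a) (act a g)"
        by (simp only: diff_add_eq_diff_diff_swap diff_add_cancel)
      also have "\<dots> \<in> span_of n e" by (intro span_of_add 1 span_of_act ag)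
      finally have "v - act (p mod a) g \<in> span_of n e" .
      moreover have "Polynomial.degree (p mod a) < k \<or> p mod a = 0"
        by (rule disjE[OF degree_mod_less[OF a0, of p]]) (simp_all only: a_deg simp_thms)
      ultimately show ?thesis by (intro exI[of _ "p mod a"] conjI)
    qed
    define vs where "vs = concat (map (\<lambda>i. map (\<lambda>j. (T ^^ j) (e i)) [0..<Polynomial.degree (\<gamma> i)]) [0..<n])
        @ map (\<lambda>j. (T ^^ j) g) [0..<k - 1]"
    have "length vs = (\<Sum>i<n. Polynomial.degree (\<gamma> i)) + (k - 1)"
      unfolding vs_def length_append length_concat map_map o_def length_map length_upt
      by (simp only: interv_sum_list_conv_sum_set_nat set_upt atLeast0LessThan diff_zero)
    then have "length vs < n" using nk k1 by simp
    then obtain y0 l where l: "l < n" "y0 l \<noteq> 0" and y0: "\<And>v. v \<in> set vs \<Longrightarrow> dot n y0 v = 0"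
      by (rule common_annihilator) (rule that)
    have mem: "(T ^^ j) (e i) \<in> set vs" if "i < n" "j < Polynomial.degree (\<gamma> i)" for i j
      using that by (auto simp: vs_def intro!: bexI[of _ i])
    have \<gamma>0: "\<gamma> i \<noteq> 0" if "i < n" for i using monic[OF that] by auto
    have y0e: "dot n y0 (act p (e i)) = 0" if i: "i < n" for p i
    proof -
      have "act p (e i) = act (p div \<gamma> i) (act (\<gamma> i) (e i)) + act (p mod \<gamma> i) (e i)"
        unfolding act_mult[symmetric] act_add[symmetric] by (simp only: div_mult_mod_eq)
      then have "act p (e i) = act (p mod \<gamma> i) (e i)" by (simp add: ezero[OF i])
      also have "\<dots> = (\<Sum>j<Polynomial.degree (\<gamma> i). fscl (Polynomial.coeff (p mod \<gamma> i) j) ((T ^^ j) (e i)))"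
        by (rule act_expand) (use degree_mod_less[OF \<gamma>0[OF i], of p] in blast)
      finally show ?thesis
        using y0 mem[OF i] by (simp add: dot_sum dot_scl)
    qed
    have y0span: "dot n y0 v = 0" if "v \<in> span_of n e" for v
      using that y0e by (auto simp: span_of_def dot_sum)
    have y0g: "dot n y0 ((T ^^ j) g) = 0" if "j < k - 1" for j
      by (rule y0) (use that in \<open>auto simp: vs_def\<close>)
    define h where "h = dot n y0 ((T ^^ (k - 1)) g)"
    have y0act: "dot n y0 (act p g) = Polynomial.coeff p (k - 1) * h" if "Polynomial.degree p < k \<or> p = 0" for p
    proof -
      have "dot n y0 (act p g) = (\<Sum>j<Suc (k - 1). Polynomial.coeff p j * dot n y0 ((T ^^ j) g))"
        using act_expand[OF that, of g] k1 by (simp add: dot_sum dot_scl)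
      also have "\<dots> = Polynomial.coeff p (k - 1) * h"
        unfolding sum.lessThan_Suc h_def by (simp add: y0g)
      finally show ?thesis .
    qed
    \<comment> \<open>Otherwise \<open>y0\<close> would vanish on the span of the \<open>e i\<close>
      and on every \<open>act p g\<close> with \<open>p\<close> of degree below \<open>k\<close>,
      hence by \<open>decomp\<close> on all vectors, against \<open>y0 l \<noteq> 0\<close>.\<close>
    have h: "h \<noteq> 0"
    proof
      assume "h = 0"
      obtain p where p: "Polynomial.degree p < k \<or> p = 0" "delta l - act p g \<in> span_of n e"
        using decomp[of "delta l"] l by auto
      have "dot n y0 ((delta l - act p g) + act p g) = 0"
        unfolding dot_add y0span[OF p(2)] y0act[OF p(1)] \<open>h = 0\<close> by simp
      then show False using l by (simp add: dot_delta)
    qed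
    define y where "y = (\<lambda>l. y0 l / h)"
    have dot_y: "dot n y v = dot n y0 v / h" for v
      by (simp add: y_def dot_def sum_divide_distrib)
    have yspan: "dot n y v = 0" if "v \<in> span_of n e" for v by (simp add: dot_y y0span[OF that])
    have yact: "dot n y (act p g) = Polynomial.coeff p (k - 1)" if "Polynomial.degree p < k \<or> p = 0" for p
      using h by (simp add: dot_y y0act[OF that])
    define b where "b = (\<Prod>i<n. \<beta> i)"
    have b_deg: "Polynomial.degree b = k" and b_monic: "lead_coeff b = 1"
      unfolding b_def using degree_prod_monic[of n \<beta>] prod_monic[of "{..<n}" \<beta>] \<beta>(2) k\<beta>
      by simp_all
    define w where "w = (\<Sum>i<n. act (\<Prod>l\<in>{0..<i}. \<beta> l) (e i))"
    define u where "u = w - act b g"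
    have gsupp: "supp_in n g" using fsupp n1 by (simp add: g_def)
    have usupp: "supp_in n u" unfolding u_def w_def
      by (intro supp_in_simps(4) supp_in_sum asupp esupp gsupp) auto
    define T' where "T' = (\<lambda>v. T v + fscl (dot n y v) u)"
    have lin': "linear_op fscl T'"
    proof
      show "T' (v + w) = T' v + T' w" for v w
        by (simp only: T'_def T_add dot_add scl_add_left ac_simps)
      show "T' (fscl c v) = fscl c (T' v)" for c v
        by (simp only: T'_def T_scl dot_scl scl_add scl_scl)
    qed (rule scl_add scl_add_left scl_scl scl_one)+
    interpret T': linear_op fscl T' by (rule lin')
    have T'supp: "supp_in n (T' v)" for v using usupp Tsupp by (simp add: T'_def)
    have act'_eq: "T'.act p v = act p v" if "\<And>q. dot n y (act q v) = 0" for p v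
    proof (induction p)
      case (pCons c p)
      have "T' (act p v) = T (act p v)" by (simp add: T'_def that)
      then show ?case by (simp only: T'.act_pCons act_pCons pCons)
    qed simp
    have act'_e: "T'.act p (e i) = act p (e i)" if "i < n" for p i
      by (rule act'_eq) (use yspan span_of_act span_of_base that in blast)
    have act'_g: "T'.act p g = act p g" if "Polynomial.degree p < k \<or> p = 0" for p
      using that
    proof (induction p)
      case (pCons c p)
      then have deg: "Suc (Polynomial.degree p) < k \<or> p = 0" by (auto split: if_splits)
      have "Polynomial.coeff p (k - 1) = 0"
      proof (cases "p = 0")
        case False
        then show ?thesis by (intro coeff_eq_0) (use deg in auto)
      qed simp
      then have "dot n y (act p g) = 0" using yact[of p] deg by auto
      then have "T' (act p g) = T (act p g)" by (simp only: T'_def scl_zero add_0_right)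
      moreover have "T'.act p g = act p g" by (rule pCons(2)) (use deg in auto)
      ultimately show ?case by (simp only: T'.act_pCons act_pCons)
    qed simp
    have act'_b: "T'.act b g = w"
    proof -
      \<comment> \<open>In Horner form the functional first becomes nonzero at \<open>b'\<close>,
        whose coefficient at \<open>k - 1\<close> is the leading coefficient 1 of \<open>b\<close>.
        So \<open>T'\<close> adds the vector \<open>u\<close> exactly once, and \<open>u\<close> was
        chosen as the missing difference to \<open>w\<close>.\<close>
      obtain b0 b' where b': "b = pCons b0 b'" by (cases b) auto
      have "b' \<noteq> 0" using b_deg k1 b' by auto
      then have deg: "Polynomial.degree b' = k - 1" and lc: "Polynomial.coeff b' (k - 1) = 1"
        using b_deg b_monic b' by auto
      have deg': "Polynomial.degree b' < k \<or> b' = 0" using deg k1 by simp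
      have "T'.act b g = fscl b0 g + T' (act b' g)" by (simp only: b' T'.act_pCons act'_g[OF deg'])
      also have "T' (act b' g) = T (act b' g) + u" by (simp only: T'_def yact[OF deg'] lc scl_one)
      also have "fscl b0 g + (T (act b' g) + u) = act b g + u" by (simp only: b' act_pCons add.assoc)
      finally show ?thesis by (simp add: u_def)
    qed
    \<comment> \<open>Closed form of the backward recursion \<open>F'_rec\<close> started at
      \<open>g\<close>. The requirement \<open>F' 0 = 0\<close>, which mirrors
      \<open>F 0 = 0\<close>, is what determines \<open>w\<close>.\<close>
    define F' where "F' = (\<lambda>i. T'.act (\<Prod>l\<in>{i..<n}. \<beta> l) g - (\<Sum>j\<in>{i..<n}. T'.act (\<Prod>l\<in>{i..<j}. \<beta> l) (e j)))"
    have F'_rec: "F' i = T'.act (\<beta> i) (F' (Suc i)) - e i" if i: "i < n" for i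
    proof -
      have 1: "(\<Prod>l\<in>{i..<j}. \<beta> l) = \<beta> i * (\<Prod>l\<in>{Suc i..<j}. \<beta> l)" if "i < j" for j
        using that by (rule prod.atLeast_Suc_lessThan)
      have "(\<Sum>j\<in>{i..<n}. T'.act (\<Prod>l\<in>{i..<j}. \<beta> l) (e j)) =
          T'.act (\<Prod>l\<in>{i..<i}. \<beta> l) (e i) + (\<Sum>j\<in>{Suc i..<n}. T'.act (\<Prod>l\<in>{i..<j}. \<beta> l) (e j))"
        using i by (rule sum.atLeast_Suc_lessThan)
      also have "(\<Sum>j\<in>{Suc i..<n}. T'.act (\<Prod>l\<in>{i..<j}. \<beta> l) (e j)) =
          (\<Sum>j\<in>{Suc i..<n}. T'.act (\<beta> i) (T'.act (\<Prod>l\<in>{Suc i..<j}. \<beta> l) (e j)))"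
        by (intro sum.cong refl) (simp add: 1 T'.act_mult)
      also have "\<dots> = T'.act (\<beta> i) (\<Sum>j\<in>{Suc i..<n}. T'.act (\<Prod>l\<in>{Suc i..<j}. \<beta> l) (e j))"
        by (simp only: T'.act_sum_right)
      also have "T'.act (\<Prod>l\<in>{i..<i}. \<beta> l) (e i) = e i"
        by (simp only: atLeastLessThan_empty order.refl prod.empty T'.act_one)
      finally have 2: "(\<Sum>j\<in>{i..<n}. T'.act (\<Prod>l\<in>{i..<j}. \<beta> l) (e j)) =
          e i + T'.act (\<beta> i) (\<Sum>j\<in>{Suc i..<n}. T'.act (\<Prod>l\<in>{Suc i..<j}. \<beta> l) (e j))" .
      show ?thesis
        unfolding F'_def 2 1[OF i] T'.act_mult T'.act_diff_right by (simp only: diff_add_eq_diff_diff_swap)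
    qed
    have F'n: "F' n = g" by (simp add: F'_def)
    have F'0: "F' 0 = 0"
    proof -
      have "(\<Sum>j\<in>{0..<n}. T'.act (\<Prod>l\<in>{0..<j}. \<beta> l) (e j)) = w"
        unfolding w_def by (rule sum.cong) (auto simp: act'_e)
      moreover have "T'.act (\<Prod>l\<in>{0..<n}. \<beta> l) g = w" using act'_b by (simp add: b_def atLeast0LessThan)
      ultimately show ?thesis by (simp add: F'_def)
    qed
    define f' where "f' = (\<lambda>i. F' (Suc i))"
    have asupp': "supp_in n (T'.act p v)" if "supp_in n v" for p v
      using T'.act_invariant[of "{v. supp_in n v}" v p] T'supp that by simp
    have f'supp: "supp_in n (f' i)" if "i < n" for i
      unfolding f'_def F'_def by (intro supp_in_simps(4) supp_in_sum asupp' gsupp esupp) auto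
    have f'zero: "T'.act (\<psi> i) (f' i) = 0" if "i < n" for i
      using that
    proof (induction i)
      case 0
      have "T'.act (\<psi> 0) (f' 0) = T'.act (\<gamma> 0) (F' 0 + e 0)"
        unfolding \<beta>(1)[OF 0] T'.act_mult f'_def F'_rec[OF 0] by (simp only: diff_add_cancel)
      also have "\<dots> = 0" using 0 by (simp add: F'0 act'_e ezero)
      finally show ?case .
    next
      case (Suc j)
      have "T'.act (\<psi> (Suc j)) (f' (Suc j)) = T'.act (\<gamma> (Suc j)) (F' (Suc j) + e (Suc j))"
        unfolding \<beta>(1)[OF Suc(2)] T'.act_mult f'_def F'_rec[OF Suc(2)] by (simp only: diff_add_cancel)
      also have "\<dots> = T'.act (\<gamma> (Suc j)) (f' j)"
        using Suc(2) unfolding T'.act_add_right by (simp add: act'_e ezero f'_def)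
      also have "\<dots> = 0" by (rule T'.act_dvd_zero[OF \<psi>\<gamma>[OF Suc(2)] Suc(1)]) (use Suc(2) in simp)
      finally show ?case .
    qed
    have F'span: "F' i \<in> T'.span_of n f'" if "i \<le> n" for i
    proof (cases i)
      case (Suc j)
      then show ?thesis using T'.span_of_base[of j n f'] that by (simp add: f'_def)
    qed (simp add: F'0 T'.span_of_zero)
    have espan: "e i \<in> T'.span_of n f'" if "i < n" for i
    proof -
      have "e i = T'.act (\<beta> i) (F' (Suc i)) - F' i" using F'_rec[OF that] by simp
      also have "\<dots> \<in> T'.span_of n f'"
        by (intro T'.span_of_diff T'.span_of_act F'span) (use that in auto)
      finally show ?thesis .
    qed
    have f'span: "v \<in> T'.span_of n f'" if v: "supp_in n v" for v
    proof -
      obtain p where p: "Polynomial.degree p < k \<or> p = 0" "v - act p g \<in> span_of n e"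
        using decomp[OF v] by blast
      then obtain q where q: "v - act p g = (\<Sum>j<n. act (q j) (e j))" unfolding span_of_def by blast
      have "act (q j) (e j) = T'.act (q j) (e j)" if "j < n" for j by (simp only: act'_e[OF that])
      then have sum: "(\<Sum>j<n. act (q j) (e j)) = (\<Sum>j<n. T'.act (q j) (e j))"
        by (intro sum.cong refl) (simp only: lessThan_iff)
      have "v = (v - act p g) + act p g" by (simp only: diff_add_cancel)
      then have v_eq: "v = (\<Sum>j<n. T'.act (q j) (e j)) + T'.act p (F' n)"
        by (simp only: q sum act'_g[OF p(1)] F'n)
      have "(\<Sum>j<n. T'.act (q j) (e j)) \<in> T'.span_of n f'"
        by (rule T'.span_of_sum, rule T'.span_of_act, rule espan) (simp only: lessThan_iff)
      moreover have "T'.act p (F' n) \<in> T'.span_of n f'"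
        by (rule T'.span_of_act, rule F'span, rule order.refl)
      ultimately show ?thesis by (subst v_eq) (rule T'.span_of_add)
    qed
    have "cyclic_gens n T' \<psi> f'"
      unfolding cyclic_gens_def by (intro conjI allI impI f'supp f'zero f'span)
    then have "cyclic_gens n (\<lambda>v. T v + fscl (dot n y v) u) \<psi> f'" unfolding T'_def .
    then show ?thesis by (intro exI[of _ u] exI[of _ y] exI[of _ f'] conjI usupp)
  qed
qed

text \<open>The chain \<open>\<gamma>\<close> consists of the least common multiples of
  \<open>\<phi> (i - 1)\<close> and \<open>\<psi> (i - 1)\<close>, starting with 1. Interlacing by
  one place makes each a common divisor of \<open>\<phi> i\<close> and \<open>\<psi> i\<close>, as
  \<open>rank_one_operator\<close> requires.\<close>

lemma rank_one_perturbation: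
  fixes N :: "'a::field mat"
  assumes N: "has_invariants n N \<phi>" and \<psi>: "invariant_chain n \<psi>" and int: "interlaced n 1 \<phi> \<psi>"
  shows "\<exists>N'. has_invariants n N' \<psi> \<and> rank_le n 1 (N' - N)"
proof -
  have \<phi>: "invariant_chain n \<phi>" and Nc: "N \<in> carrier_mat n n"
    using N by (simp_all add: has_invariants_def)
  obtain f where f: "cyclic_gens n (mv n N) \<phi> f" using has_invariants_gens[OF N] by blast
  define \<gamma> where "\<gamma> = (\<lambda>i. mlcm (shift 1 \<phi> i) (shift 1 \<psi> i))"
  note mon = shift_monic[OF \<phi>, of _ 1] shift_monic[OF \<psi>, of _ 1]
  have \<gamma>dvd: "\<gamma> i dvd h" if "i < n" "1 \<le> i \<Longrightarrow> \<phi> (i - 1) dvd h" "1 \<le> i \<Longrightarrow> \<psi> (i - 1) dvd h" for i h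
    unfolding \<gamma>_def by (rule mlcm(4)[OF mon[OF that(1)]]) (use that in \<open>auto simp: shift_def\<close>)
  have "\<exists>u y f'. supp_in n u \<and> cyclic_gens n (\<lambda>v. mv n N v + fscl (dot n y v) u) \<psi> f'"
  proof (rule rank_one_operator[OF linear_op_mv _ \<phi> \<psi> f])
    show "lead_coeff (\<gamma> i) = 1" if "i < n" for i
      unfolding \<gamma>_def by (rule mlcm(1)[OF mon[OF that]])
    show "\<gamma> i dvd \<phi> i" if "i < n" for i
      by (rule \<gamma>dvd[OF that]) (use that invariant_chainD(1)[OF \<phi>] interlacedD(2)[OF int, of i "i - 1"] in auto)
    show "\<gamma> i dvd \<psi> i" if "i < n" for i
      by (rule \<gamma>dvd[OF that]) (use that invariant_chainD(1)[OF \<psi>] interlacedD(1)[OF int, of i "i - 1"] in auto)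
    show "\<phi> i dvd \<gamma> (Suc i)" if "Suc i < n" for i
      using mlcm(2)[OF mon[OF that]] by (simp add: \<gamma>_def shift_def)
    show "\<psi> i dvd \<gamma> (Suc i)" if "Suc i < n" for i
      using mlcm(3)[OF mon[OF that]] by (simp add: \<gamma>_def shift_def)
  qed simp
  then obtain u y f' where
    "supp_in n u \<and> cyclic_gens n (\<lambda>v. mv n N v + fscl (dot n y v) u) \<psi> f'" by (elim exE)
  then have u: "supp_in n u" and f': "cyclic_gens n (\<lambda>v. mv n N v + fscl (dot n y v) u) \<psi> f'"
    by (rule conjunct1, rule conjunct2)
  define N' where "N' = mat n n (\<lambda>(i, j). N $$ (i, j) + u i * y j)"
  have "mv n N' = (\<lambda>v. mv n N v + fscl (dot n y v) u)"
  proof (intro ext)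
    fix v i
    have "(\<Sum>j<n. (N $$ (i, j) + u i * y j) * v j) = (\<Sum>j<n. N $$ (i, j) * v j) + u i * dot n y v"
      by (simp only: dot_def distrib_right sum.distrib sum_distrib_left mult.assoc)
    then have "i < n \<Longrightarrow> mv n N' v i = mv n N v i + dot n y v * u i"
      by (simp add: mv_def N'_def mult.commute[of "u i"])
    moreover have "\<not> i < n \<Longrightarrow> mv n N' v i = mv n N v i + dot n y v * u i"
      using u by (simp add: mv_def supp_in_def)
    ultimately show "mv n N' v i = (mv n N v + fscl (dot n y v) u) i"
      unfolding plus_fun_apply fscl_def by blast
  qed
  then have "has_invariants n N' \<psi>"
    using cyclic_gens_has_invariants[of N' n \<psi> f'] f' \<psi> by (simp add: N'_def)
  moreover have "N' - N = mat n n (\<lambda>(i, j). \<Sum>l<(1::nat). u i * y j)"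
    by (rule eq_matI) (use Nc in \<open>auto simp: N'_def\<close>)
  then have "rank_le n 1 (N' - N)" unfolding rank_le_def
    by (intro exI[of _ "\<lambda>i l. u i"] exI[of _ "\<lambda>l. y"])
  ultimately show ?thesis by blast
qed

text \<open>Interpolation inserts a chain one place from \<open>\<phi>\<close> and \<open>s\<close>
  places from \<open>\<psi>\<close>; a rank one step reaches it and the induction hypothesis covers
  the rest. For \<open>r = 0\<close> the degree count forces the two chains to coincide.\<close>

theorem bounded_rank_perturbation:
  fixes N :: "'a::field mat"
  assumes "has_invariants n N \<phi>" "invariant_chain n \<psi>" "interlaced n r \<phi> \<psi>"
  shows "\<exists>N'. has_invariants n N' \<psi> \<and> rank_le n r (N' - N)"
  using assms
proof (induction r arbitrary: N \<phi>)
  case 0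
  have \<phi>: "invariant_chain n \<phi>" and Nc: "N \<in> carrier_mat n n"
    using 0 by (simp_all add: has_invariants_def)
  have dvd: "\<phi> i dvd \<psi> i" if "i < n" for i
    by (rule interlacedD(1)[OF 0(3) _ that]) simp
  have "\<phi> i = \<psi> i" if "i < n" for i
    by (rule monic_chain_eq[of n, OF dvd invariant_chainD(2)[OF \<phi>] invariant_chainD(2)[OF 0(2)] _ that])
       (simp_all only: invariant_chainD(3)[OF \<phi>] invariant_chainD(3)[OF 0(2)] order.refl)
  then have "mat_diag n \<phi> = mat_diag n \<psi>" by (intro eq_matI) (auto simp: mat_diag_def)
  then have "has_invariants n N \<psi>" using 0(1,2) unfolding has_invariants_def by simp
  moreover have "rank_le n 0 (N - N)" using Nc unfolding rank_le_def
    by (intro exI[of _ "\<lambda>_ _. 0"] eq_matI) auto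
  ultimately show ?case by blast
next
  case (Suc s)
  show ?case
  proof (cases "s = 0 \<or> n = 0")
    case True
    then have "interlaced n 1 \<phi> \<psi>" "s = 0 \<or> n = 0" using Suc(4) by (auto simp: interlaced_def)
    then obtain N' where N': "has_invariants n N' \<psi>" "rank_le n 1 (N' - N)"
      using rank_one_perturbation[OF Suc(2,3)] by blast
    show ?thesis
    proof (cases "s = 0")
      case False
      then have "n = 0" using True by simp
      then have "rank_le n (Suc s) (N' - N)"
        using N' Suc(2) unfolding rank_le_def has_invariants_def
        by (intro exI[of _ "\<lambda>_ _. 0"] eq_matI) auto
      then show ?thesis using N' by blast
    qed (use N' in auto)
  next
    case False
    have \<phi>: "invariant_chain n \<phi>" using Suc(2) by (simp add: has_invariants_def)
    have sn: "1 \<le> s" "1 \<le> n" using False by auto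
    obtain \<chi> where \<chi>: "invariant_chain n \<chi>" "interlaced n 1 \<phi> \<chi>" "interlaced n s \<chi> \<psi>"
      by (rule interpolation[OF \<phi> Suc(3,4) sn])
    obtain N1 where N1: "has_invariants n N1 \<chi>" "rank_le n 1 (N1 - N)"
      using rank_one_perturbation[OF Suc(2) \<chi>(1,2)] by blast
    obtain N' where N': "has_invariants n N' \<psi>" "rank_le n s (N' - N1)"
      using Suc(1)[OF N1(1) Suc(3) \<chi>(3)] by blast
    have "N' - N = (N1 - N) + (N' - N1)"
      by (rule eq_matI) (use N' N1 Suc(2) in \<open>auto simp: has_invariants_def\<close>)
    then have "rank_le n (Suc s) (N' - N)" using rank_le_add[OF N1(2) N'(2)] by simp
    then show ?thesis using N' by blast
  qed
qed

abbreviation const_mat :: "'b::zero mat \<Rightarrow> 'b poly mat" where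
  "const_mat M \<equiv> map_mat (\<lambda>c. [:c:]) M"

section \<open>Similarity\<close>

lemma const_mat_mult:
  fixes A B :: "'b::comm_ring_1 mat"
  assumes "A \<in> carrier_mat n m" "B \<in> carrier_mat m p"
  shows "const_mat (A * B) = const_mat A * const_mat B"
proof (rule eq_matI)
  fix i j assume "i < dim_row (const_mat A * const_mat B)" "j < dim_col (const_mat A * const_mat B)"
  then have ij: "i < n" "j < p" using assms by auto
  have cA: "const_mat A \<in> carrier_mat n m" and cB: "const_mat B \<in> carrier_mat m p" using assms by auto
  have "(const_mat A * const_mat B) $$ (i, j) = (\<Sum>l<m. [:A $$ (i, l) * B $$ (l, j):])"
    unfolding mult_mat_index[OF cA cB ij] using assms ij by (intro sum.cong) auto
  also have "\<dots> = [:(A * B) $$ (i, j):]"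
    unfolding mult_mat_index[OF assms ij]
    by (induction m) auto
  finally show "const_mat (A * B) $$ (i, j) = (const_mat A * const_mat B) $$ (i, j)"
    using assms ij by (simp del: index_mult_mat(1) add: index_mult_mat(2,3))
qed (use assms in auto)

lemma const_mat_one: "const_mat (1\<^sub>m n :: 'b::comm_ring_1 mat) = 1\<^sub>m n"
  by (rule eq_matI) (auto simp: one_pCons)

lemma inverse_pair_const_mat:
  assumes "inverse_pair n P Q"
  shows "inverse_pair n (const_mat P) (const_mat Q)"
  using assms const_mat_mult[of P n n Q n] const_mat_mult[of Q n n P n]
  by (simp add: inverse_pair_def const_mat_one)

lemma char_poly_matrix_division:
  fixes N :: "'a::field mat"
  assumes N: "N \<in> carrier_mat n n" and Z: "Z \<in> carrier_mat n n"
  obtains Y R where "Y \<in> carrier_mat n n" "R \<in> carrier_mat n n"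
    "Z = char_poly_matrix N * Y + const_mat R"
proof -
  let ?C = "char_poly_matrix N"
  have C: "?C \<in> carrier_mat n n" using N by simp
  have "\<forall>l. \<exists>z. \<forall>i<n. Z $$ (i, l) = (\<Sum>j<n. ?C $$ (i, j) * z j) + [:ev n N (\<lambda>i. Z $$ (i, l)) i:]"
    by (intro allI ev_reduce[OF N])
  then have "\<exists>z. \<forall>l. \<forall>i<n. Z $$ (i, l) = (\<Sum>j<n. ?C $$ (i, j) * z l j) + [:ev n N (\<lambda>i. Z $$ (i, l)) i:]"
    by (rule choice)
  then obtain z where z: "\<forall>l. \<forall>i<n. Z $$ (i, l) =
      (\<Sum>j<n. ?C $$ (i, j) * z l j) + [:ev n N (\<lambda>i. Z $$ (i, l)) i:]" ..
  define Y where "Y = mat n n (\<lambda>(j, l). z l j)"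
  define R where "R = mat n n (\<lambda>(i, l). ev n N (\<lambda>i. Z $$ (i, l)) i)"
  have YR: "Y \<in> carrier_mat n n" "R \<in> carrier_mat n n" by (simp_all add: Y_def R_def)
  have "Z = ?C * Y + const_mat R"
  proof (rule eq_matI)
    fix i l assume "i < dim_row (?C * Y + const_mat R)" "l < dim_col (?C * Y + const_mat R)"
    then have il: "i < n" "l < n" using YR by auto
    have "(?C * Y + const_mat R) $$ (i, l) = (?C * Y) $$ (i, l) + [:R $$ (i, l):]"
      using il YR by (simp del: index_mult_mat(1) add: index_mult_mat(2,3))
    also have "\<dots> = (\<Sum>j<n. ?C $$ (i, j) * z l j) + [:ev n N (\<lambda>i. Z $$ (i, l)) i:]"
      unfolding mult_mat_index[OF C YR(1) il] using il by (simp add: Y_def R_def)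
    also have "\<dots> = Z $$ (i, l)" using z[rule_format, OF il(1), of l] by (rule sym)
    finally show "Z $$ (i, l) = (?C * Y + const_mat R) $$ (i, l)" by (rule sym)
  qed (use YR Z in auto)
  with YR show thesis by (rule that)
qed

text \<open>\<open>ev\<close> kills the columns of \<open>xI - N\<close> but fixes constant vectors,
  so a constant column in that module is zero. This makes remainders modulo \<open>xI - N\<close>
  unique.\<close>

lemma char_poly_matrix_no_const:
  fixes N :: "'a::field mat"
  assumes N: "N \<in> carrier_mat n n" and Y: "Y \<in> carrier_mat n n" and R: "R \<in> carrier_mat n n"
    and eq: "char_poly_matrix N * Y = const_mat R"
  shows "R = 0\<^sub>m n n"
proof (rule eq_matI)
  let ?C = "char_poly_matrix N"
  have C: "?C \<in> carrier_mat n n" using N by simp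
  fix i l assume "i < dim_row (0\<^sub>m n n :: 'a mat)" "l < dim_col (0\<^sub>m n n :: 'a mat)"
  then have il: "i < n" "l < n" by auto
  define r where "r = (\<lambda>i. if i < n then R $$ (i, l) else 0)"
  have "ev n N (\<lambda>i. [:r i:]) = ev n N (\<lambda>i. \<Sum>j<n. ?C $$ (i, j) * Y $$ (j, l))"
  proof (rule ev_cong)
    fix i assume i: "i < n"
    have "(?C * Y) $$ (i, l) = [:R $$ (i, l):]" unfolding eq using i il R by simp
    then show "[:r i:] = (\<Sum>j<n. ?C $$ (i, j) * Y $$ (j, l))"
      unfolding mult_mat_index[OF C Y i il(2)] using i by (simp add: r_def)
  qed
  also have "\<dots> = 0" by (rule ev_char_poly_matrix[OF N])
  finally have "r = 0" using ev_const[of n r N] by (simp add: r_def supp_in_def)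
  then have "r i = 0" by simp
  then show "R $$ (i, l) = 0\<^sub>m n n $$ (i, l)" using il by (simp add: r_def)
qed (use R in auto)

lemma char_poly_matrix_const:
  fixes N :: "'a::field mat"
  assumes N: "N \<in> carrier_mat n n" and Q: "Q \<in> carrier_mat n n"
  shows "char_poly_matrix N * const_mat Q = [:0, 1:] \<cdot>\<^sub>m const_mat Q - const_mat (N * Q)"
    and "const_mat Q * char_poly_matrix N = [:0, 1:] \<cdot>\<^sub>m const_mat Q - const_mat (Q * N)"
proof -
  have c: "char_poly_matrix N = [:0, 1:] \<cdot>\<^sub>m 1\<^sub>m n - const_mat N"
    using N by (intro eq_matI) (auto simp: char_poly_matrix_def)
  have cc: "const_mat N \<in> carrier_mat n n" "const_mat Q \<in> carrier_mat n n" using N Q by auto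
  show "char_poly_matrix N * const_mat Q = [:0, 1:] \<cdot>\<^sub>m const_mat Q - const_mat (N * Q)"
    unfolding c const_mat_mult[OF N Q] using cc
    by (subst minus_mult_distrib_mat[of _ n n _ _ n]) (auto simp: mult_smult_assoc_mat[of _ n n _ n])
  show "const_mat Q * char_poly_matrix N = [:0, 1:] \<cdot>\<^sub>m const_mat Q - const_mat (Q * N)"
    unfolding c const_mat_mult[OF Q N] using cc
    by (subst mult_minus_distrib_mat[of _ n n _ n]) (auto simp: mult_smult_distrib[of _ n n _ n])
qed

lemma mat_cancel:
  fixes A B D :: "'b::ab_group_add mat"
  assumes "A \<in> carrier_mat n m" "B \<in> carrier_mat n m" "D \<in> carrier_mat n m"
  shows "A + B - A = B" "A + (B + D) - D = A + B" "A - B = 0\<^sub>m n m \<Longrightarrow> A = B"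
proof -
  show "A + B - A = B" "A + (B + D) - D = A + B"
    by (rule eq_matI; use assms in auto)+
  assume z: "A - B = 0\<^sub>m n m"
  show "A = B"
  proof (rule eq_matI)
    fix i j assume ij: "i < dim_row B" "j < dim_col B"
    then have "(A - B) $$ (i, j) = 0" unfolding z using assms by simp
    then show "A $$ (i, j) = B $$ (i, j)" using ij assms by simp
  qed (use assms in auto)
qed

lemma const_mat_minus:
  fixes A B :: "'b::ab_group_add mat"
  assumes "A \<in> carrier_mat n m" "B \<in> carrier_mat n m"
  shows "const_mat (A - B) = const_mat A - const_mat B"
  by (rule eq_matI) (use assms in auto)

lemma smult_mat_minus_cancel:
  fixes A B D :: "'b::comm_ring_1 mat"
  assumes "A \<in> carrier_mat n m" "B \<in> carrier_mat n m" "D \<in> carrier_mat n m"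
  shows "(A - B) - (A - D) = D - B"
  by (rule eq_matI) (use assms in auto)

text \<open>The two Smith forms give \<open>?C * H = Gi * ?C'\<close> with \<open>Gi\<close>
  invertible. Replacing \<open>Gi\<close> by its constant remainder \<open>Q1\<close> modulo
  \<open>xI - N\<close> and comparing remainders turns this relation into
  \<open>N * Q1 = Q1 * N'\<close>.\<close>

theorem same_invariants_similar:
  fixes N N' :: "'a::field mat"
  assumes "has_invariants n N \<phi>" "has_invariants n N' \<phi>"
  obtains Q Q' where "inverse_pair n Q Q'" "N * Q = Q * N'"
proof -
  let ?C = "char_poly_matrix N" and ?C' = "char_poly_matrix N'"
  have N: "N \<in> carrier_mat n n" "N' \<in> carrier_mat n n" using assms by (auto simp: has_invariants_def)
  then have C: "?C \<in> carrier_mat n n" "?C' \<in> carrier_mat n n" by simp_all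
  obtain P Pi R Ri where P: "inverse_pair n P Pi" and R: "inverse_pair n R Ri"
    and eq: "?C = P * mat_diag n \<phi> * R" using assms(1) unfolding has_invariants_def by blast
  obtain P' Pi' R' Ri' where P': "inverse_pair n P' Pi'" and R': "inverse_pair n R' Ri'"
    and eq': "?C' = P' * mat_diag n \<phi> * R'" using assms(2) unfolding has_invariants_def by blast
  note c = inverse_pairD(1,2)[OF P] inverse_pairD(1,2)[OF R]
    inverse_pairD(1,2)[OF P'] inverse_pairD(1,2)[OF R']
  let ?D = "mat_diag n \<phi>"
  have Dc: "?D \<in> carrier_mat n n" by simp
  define G where "G = P' * Pi"
  define Gi where "Gi = P * Pi'"
  define H where "H = Ri * R'"
  have Gp: "inverse_pair n G Gi" unfolding G_def Gi_def
    by (rule inverse_pair_mult[OF P' inverse_pair_sym[OF P]])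
  note Gc = inverse_pairD(1,2)[OF Gp]
  have Hc: "H \<in> carrier_mat n n" unfolding H_def by (rule mult_carrier_mat[OF c(4) c(7)])
  have DR: "?D * R' \<in> carrier_mat n n" "?D * R \<in> carrier_mat n n" using c by simp_all
  have CH: "?C * H = P * (?D * R')"
  proof -
    have "P * ?D * R * (Ri * R') = P * ?D * (R * (Ri * R'))"
      by (rule assoc_mult_mat[of _ n n _ n _ n]) (use c in auto)
    also have "R * (Ri * R') = R'" by (rule inverse_pair_cancel(1)[OF R c(7)])
    also have "P * ?D * R' = P * (?D * R')" by (rule assoc_mult_mat[OF c(1) Dc c(7)])
    finally show ?thesis unfolding eq H_def .
  qed
  have GC: "Gi * ?C' = P * (?D * R')"
  proof -
    have "?C' = P' * (?D * R')" unfolding eq' by (rule assoc_mult_mat[OF c(5) Dc c(7)])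
    then have "Gi * ?C' = P * (Pi' * (P' * (?D * R')))"
      unfolding Gi_def using assoc_mult_mat[OF c(1,6), of "P' * (?D * R')" n] c(5) DR(1)
      by (metis mult_carrier_mat)
    also have "Pi' * (P' * (?D * R')) = ?D * R'" by (rule inverse_pair_cancel(2)[OF P' DR(1)])
    finally show ?thesis .
  qed
  obtain Y1 Q1 where Y1: "Y1 \<in> carrier_mat n n" and Q1: "Q1 \<in> carrier_mat n n"
    and G1: "Gi = ?C * Y1 + const_mat Q1"
    by (rule char_poly_matrix_division[OF N(1) Gc(2)])
  obtain Y2 Q2 where Y2: "Y2 \<in> carrier_mat n n" and Q2: "Q2 \<in> carrier_mat n n"
    and G2: "G = ?C' * Y2 + const_mat Q2"
    by (rule char_poly_matrix_division[OF N(2) Gc(1)])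
  have cQ: "const_mat Q1 \<in> carrier_mat n n" "const_mat Q2 \<in> carrier_mat n n" using Q1 Q2 by auto
  have NQ: "N * Q1 \<in> carrier_mat n n" "Q1 * N' \<in> carrier_mat n n" "Q1 * Q2 \<in> carrier_mat n n"
    using N Q1 Q2 by (auto intro: mult_carrier_mat)
  have YC: "Y1 * ?C' \<in> carrier_mat n n" by (rule mult_carrier_mat[OF Y1 C(2)])
  have 1: "?C * H = ?C * (Y1 * ?C') + const_mat Q1 * ?C'"
  proof -
    have "?C * H = (?C * Y1 + const_mat Q1) * ?C'" using CH GC G1 by simp
    also have "\<dots> = ?C * Y1 * ?C' + const_mat Q1 * ?C'"
      by (rule add_mult_distrib_mat[OF mult_carrier_mat[OF C(1) Y1] cQ(1) C(2)])
    also have "?C * Y1 * ?C' = ?C * (Y1 * ?C')" by (rule assoc_mult_mat[OF C(1) Y1 C(2)])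
    finally show ?thesis .
  qed
  have "?C * (H - Y1 * ?C' - const_mat Q1) = const_mat (N * Q1 - Q1 * N')"
  proof -
    have "?C * (H - Y1 * ?C' - const_mat Q1) = ?C * (H - Y1 * ?C') - ?C * const_mat Q1"
      by (rule mult_minus_distrib_mat[OF C(1) minus_carrier_mat[OF YC] cQ(1)])
    also have "?C * (H - Y1 * ?C') = ?C * H - ?C * (Y1 * ?C')"
      by (rule mult_minus_distrib_mat[OF C(1) Hc YC])
    also have "\<dots> = const_mat Q1 * ?C'"
      unfolding 1 by (rule mat_cancel(1)[OF mult_carrier_mat[OF C(1) YC] mult_carrier_mat[OF cQ(1) C(2)]])
        (rule mult_carrier_mat[OF C(1) YC])
    also have "const_mat Q1 * ?C' - ?C * const_mat Q1 = const_mat (N * Q1 - Q1 * N')"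
      unfolding char_poly_matrix_const(1)[OF N(1) Q1] char_poly_matrix_const(2)[OF N(2) Q1]
      unfolding const_mat_minus[OF NQ(1,2)]
      by (rule smult_mat_minus_cancel[of _ n n]) (use NQ cQ in auto)
    finally show ?thesis .
  qed
  from char_poly_matrix_no_const[OF N(1) minus_carrier_mat[OF cQ(1)] minus_carrier_mat[OF NQ(2)] this]
  have "N * Q1 - Q1 * N' = 0\<^sub>m n n" .
  then have comm: "N * Q1 = Q1 * N'" by (rule mat_cancel(3)[OF NQ(1,2,2)])
  \<comment> \<open>Invertibility of \<open>Q1\<close> by the same comparison:
    \<open>Q1 * Q2\<close> is the remainder of \<open>Gi * G = 1\<close> modulo
    \<open>xI - N\<close>.\<close>
  have "?C * (H * Y2 + Y1 * const_mat Q2) = const_mat (1\<^sub>m n - Q1 * Q2)"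
  proof -
    have HY: "H * Y2 \<in> carrier_mat n n" "Y1 * const_mat Q2 \<in> carrier_mat n n"
      using mult_carrier_mat[OF Hc Y2] mult_carrier_mat[OF Y1 cQ(2)] by auto
    have CY: "?C * Y1 \<in> carrier_mat n n" "?C' * Y2 \<in> carrier_mat n n"
      using mult_carrier_mat[OF C(1) Y1] mult_carrier_mat[OF C(2) Y2] by auto
    have "1\<^sub>m n = Gi * (?C' * Y2 + const_mat Q2)" using inverse_pairD(4)[OF Gp] G2 by simp
    also have "\<dots> = Gi * (?C' * Y2) + Gi * const_mat Q2"
      by (rule mult_add_distrib_mat[OF Gc(2) CY(2) cQ(2)])
    also have "Gi * (?C' * Y2) = ?C * (H * Y2)"
      using assoc_mult_mat[OF Gc(2) C(2) Y2] assoc_mult_mat[OF C(1) Hc Y2] CH GC by simp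
    also have "Gi * const_mat Q2 = ?C * (Y1 * const_mat Q2) + const_mat (Q1 * Q2)"
      unfolding const_mat_mult[OF Q1 Q2] G1
      by (subst add_mult_distrib_mat[OF CY(1) cQ(1) cQ(2)], subst assoc_mult_mat[OF C(1) Y1 cQ(2)], rule refl)
    finally have one: "1\<^sub>m n = ?C * (H * Y2) + (?C * (Y1 * const_mat Q2) + const_mat (Q1 * Q2))" .
    have "const_mat (1\<^sub>m n - Q1 * Q2) = 1\<^sub>m n - const_mat (Q1 * Q2)"
      unfolding const_mat_minus[OF one_carrier_mat NQ(3)] const_mat_one ..
    also have "\<dots> = ?C * (H * Y2) + ?C * (Y1 * const_mat Q2)"
      unfolding one
      by (rule mat_cancel(2)[OF mult_carrier_mat[OF C(1) HY(1)] mult_carrier_mat[OF C(1) HY(2)]])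
        (use NQ in simp)
    also have "\<dots> = ?C * (H * Y2 + Y1 * const_mat Q2)"
      by (rule mult_add_distrib_mat[OF C(1) HY, symmetric])
    finally show ?thesis by (rule sym)
  qed
  from char_poly_matrix_no_const[OF N(1) add_carrier_mat[OF mult_carrier_mat[OF Y1 cQ(2)]]
      minus_carrier_mat[OF NQ(3)] this]
  have "1\<^sub>m n - Q1 * Q2 = 0\<^sub>m n n" .
  then have inv: "Q1 * Q2 = 1\<^sub>m n" by (rule mat_cancel(3)[OF one_carrier_mat NQ(3,3), symmetric])
  then have "inverse_pair n Q1 Q2"
    using mat_mult_left_right_inverse[OF Q1 Q2 inv] Q1 Q2 by (simp add: inverse_pair_def)
  then show thesis using comm by (rule that)
qed

section \<open>Homogenization\<close>

lemma fminors_inD: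
  assumes "fminors_in k M J" "M \<in> carrier_mat n m" "\<forall>i<k. f i < n" "\<forall>i<k. g i < m"
  shows "fminor k M f g \<in> J"
  using assms unfolding fminors_in_def by simp

lemma fminors_inI:
  assumes "M \<in> carrier_mat n m"
    and "\<And>f g. \<forall>i<k. f i < n \<Longrightarrow> \<forall>i<k. g i < m \<Longrightarrow> fminor k M f g \<in> J"
  shows "fminors_in k M J"
  using assms unfolding fminors_in_def by simp

text \<open>The values of \<open>u\<close> and \<open>v\<close> stay open, so that one theory covers
  the pencil itself, its homogenization in two variables and the substitution \<open>u = x\<close>,
  \<open>v = 1\<close>.\<close>

locale homogenizer =
  fixes emb :: "'a::field \<Rightarrow> 'r::comm_ring_1" and u v :: 'r
  assumes emb_add: "emb (a + b) = emb a + emb b" and emb_mult: "emb (a * b) = emb a * emb b"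
    and emb_one [simp]: "emb 1 = 1"
begin

lemma emb_zero [simp]: "emb 0 = 0"
  using emb_add[of 0 0] by simp

lemma emb_minus: "emb (- a) = - emb a"
  using emb_add[of a "- a"] by (simp add: eq_neg_iff_add_eq_0 add.commute)

text \<open>
  This is \<open>v\<^sup>k f(u/v)\<close>; coefficients of \<open>f\<close> beyond degree \<open>k\<close> are dropped.
\<close>

definition hom_poly :: "nat \<Rightarrow> 'a poly \<Rightarrow> 'r" where
  "hom_poly k f = (\<Sum>j\<le>k. emb (Polynomial.coeff f j) * u ^ j * v ^ (k - j))"

lemma hom_poly_zero [simp]: "hom_poly k 0 = 0"
  by (simp add: hom_poly_def)

lemma hom_poly_add: "hom_poly k (f + g) = hom_poly k f + hom_poly k g"
  by (simp add: hom_poly_def emb_add distrib_right sum.distrib)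

lemma hom_poly_smult: "hom_poly k (smult c f) = emb c * hom_poly k f"
  by (simp add: hom_poly_def emb_mult sum_distrib_left mult.assoc)

lemma hom_poly_minus: "hom_poly k (- f) = - hom_poly k f"
  by (simp add: hom_poly_def emb_minus sum_negf)

lemma hom_poly_sum: "hom_poly k (\<Sum>x\<in>A. f x) = (\<Sum>x\<in>A. hom_poly k (f x))"
  by (induction A rule: infinite_finite_induct) (simp_all add: hom_poly_add)

lemma hom_poly_raise:
  assumes "Polynomial.degree f \<le> k"
  shows "hom_poly (k + m) f = v ^ m * hom_poly k f"
proof -
  have "hom_poly (k + m) f = (\<Sum>j\<le>k. emb (Polynomial.coeff f j) * u ^ j * v ^ (k + m - j))"
    unfolding hom_poly_def using assms
    by (intro sum.mono_neutral_right) (auto simp: coeff_eq_0)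
  also have "\<dots> = (\<Sum>j\<le>k. v ^ m * (emb (Polynomial.coeff f j) * u ^ j * v ^ (k - j)))"
  proof (intro sum.cong refl)
    fix j assume "j \<in> {..k}"
    then have "k + m - j = m + (k - j)" by simp
    then show "emb (Polynomial.coeff f j) * u ^ j * v ^ (k + m - j) =
        v ^ m * (emb (Polynomial.coeff f j) * u ^ j * v ^ (k - j))"
      by (simp only: power_add mult_ac)
  qed
  finally show ?thesis by (simp only: hom_poly_def sum_distrib_left)
qed

lemma hom_poly_pCons: "hom_poly (Suc k) (pCons c f) = emb c * v ^ Suc k + u * hom_poly k f"
proof -
  have "hom_poly (Suc k) (pCons c f) =
      emb c * v ^ Suc k + (\<Sum>j\<le>k. emb (Polynomial.coeff f j) * u ^ Suc j * v ^ (k - j))"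
    unfolding hom_poly_def by (subst sum.atMost_Suc_shift) simp
  also have "(\<Sum>j\<le>k. emb (Polynomial.coeff f j) * u ^ Suc j * v ^ (k - j)) = u * hom_poly k f"
    unfolding hom_poly_def sum_distrib_left by (intro sum.cong refl) (simp only: power_Suc mult_ac)
  finally show ?thesis .
qed

lemma hom_poly_mult:
  assumes "Polynomial.degree f \<le> k" "Polynomial.degree g \<le> l"
  shows "hom_poly (k + l) (f * g) = hom_poly k f * hom_poly l g"
  using assms(1)
proof (induction k arbitrary: f)
  case 0
  then obtain c where "f = [:c:]" by (metis degree_eq_zeroE le_zero_eq)
  then show ?case by (simp add: hom_poly_smult) (simp add: hom_poly_def)
next
  case (Suc k)
  obtain c f' where f: "f = pCons c f'" by (cases f)
  then have deg: "Polynomial.degree f' \<le> k" using Suc(2) by (auto split: if_splits)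
  have "f * g = smult c g + pCons 0 (f' * g)" by (simp add: f)
  then have "hom_poly (Suc k + l) (f * g) =
      emb c * hom_poly (l + Suc k) g + hom_poly (Suc (k + l)) (pCons 0 (f' * g))"
    by (simp only: hom_poly_add hom_poly_smult add.commute[of "Suc k"] add_Suc_right add.commute[of l])
  also have "\<dots> = (emb c * v ^ Suc k + u * hom_poly k f') * hom_poly l g"
    unfolding hom_poly_raise[OF assms(2)] hom_poly_pCons Suc(1)[OF deg]
    by (simp only: distrib_right mult.assoc emb_zero mult_zero_left add_0_left)
  finally show ?case unfolding f hom_poly_pCons .
qed

lemma hom_poly_prod:
  assumes "\<And>i. i < k \<Longrightarrow> Polynomial.degree (f i) \<le> 1"
  shows "hom_poly k (\<Prod>i<k. f i) = (\<Prod>i<k. hom_poly 1 (f i)) \<and> Polynomial.degree (\<Prod>i<k. f i) \<le> k"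
  using assms
proof (induction k)
  case 0
  show ?case by (simp add: hom_poly_def)
next
  case (Suc k)
  have IH: "hom_poly k (\<Prod>i<k. f i) = (\<Prod>i<k. hom_poly 1 (f i))"
      "Polynomial.degree (\<Prod>i<k. f i) \<le> k" using Suc by simp_all
  have "hom_poly (k + 1) ((\<Prod>i<k. f i) * f k) = hom_poly k (\<Prod>i<k. f i) * hom_poly 1 (f k)"
    by (rule hom_poly_mult[OF IH(2)]) (use Suc(2) in simp)
  moreover have "Polynomial.degree ((\<Prod>i<k. f i) * f k) \<le> Suc k"
    using degree_mult_le[of "\<Prod>i<k. f i" "f k"] IH(2) Suc(2)[of k] by simp
  ultimately show ?case by (simp add: IH(1))
qed

text \<open>Every term of the Leibniz formula is a product of exactly \<open>k\<close> entries of
  degree at most one, so homogenizing to degree \<open>k\<close> distributes over its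
  factors.\<close>

lemma hom_poly_det:
  assumes M: "M \<in> carrier_mat k k"
    and deg: "\<And>i j. i < k \<Longrightarrow> j < k \<Longrightarrow> Polynomial.degree (M $$ (i, j)) \<le> 1"
  shows "hom_poly k (Determinant.det M) = Determinant.det (map_mat (hom_poly 1) M)"
proof -
  have M': "map_mat (hom_poly 1) M \<in> carrier_mat k k" using M by simp
  have sgn: "hom_poly k (signof p * f) = signof p * hom_poly k f" for p f
    by (simp add: sign_def hom_poly_minus)
  have "hom_poly k (signof p * (\<Prod>i = 0..<k. M $$ (i, p i))) =
      signof p * (\<Prod>i = 0..<k. map_mat (hom_poly 1) M $$ (i, p i))" if p: "p permutes {0..<k}" for p
  proof -
    have pk: "p i < k" if "i < k" for i using permutes_in_image[OF p, of i] that by simp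
    have "hom_poly k (\<Prod>i<k. M $$ (i, p i)) = (\<Prod>i<k. hom_poly 1 (M $$ (i, p i)))"
      using hom_poly_prod[of k "\<lambda>i. M $$ (i, p i)"] deg pk by simp
    also have "\<dots> = (\<Prod>i<k. map_mat (hom_poly 1) M $$ (i, p i))"
      by (intro prod.cong refl) (use M pk in auto)
    finally show ?thesis unfolding sgn by (simp only: atLeast0LessThan)
  qed
  then show ?thesis
    unfolding det_def'[OF M] det_def'[OF M'] hom_poly_sum by (intro sum.cong refl) simp
qed

lemma hom_poly_fminor:
  assumes M: "M \<in> carrier_mat n m"
    and deg: "\<And>i j. i < n \<Longrightarrow> j < m \<Longrightarrow> Polynomial.degree (M $$ (i, j)) \<le> 1"
    and f: "\<forall>i<k. f i < n" and g: "\<forall>i<k. g i < m"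
  shows "fminor k (map_mat (hom_poly 1) M) f g = hom_poly k (fminor k M f g)"
proof -
  have "map_mat (hom_poly 1) (mat k k (\<lambda>(i, j). M $$ (f i, g j))) =
      mat k k (\<lambda>(i, j). map_mat (hom_poly 1) M $$ (f i, g j))"
    by (rule eq_matI) (use M f g in auto)
  then show ?thesis
    unfolding fminor_def by (subst hom_poly_det) (use deg f g in auto)
qed

lemma hom_poly_fminors_zero:
  assumes M: "M \<in> carrier_mat n m"
    and deg: "\<And>i j. i < n \<Longrightarrow> j < m \<Longrightarrow> Polynomial.degree (M $$ (i, j)) \<le> 1"
    and z: "fminors_in k M {0}"
  shows "fminors_in k (map_mat (hom_poly 1) M) {0}"
proof (rule fminors_inI)
  show "map_mat (hom_poly 1) M \<in> carrier_mat n m" using M by simp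
  fix f g assume fg: "\<forall>i<k. f i < n" "\<forall>i<k. g i < m"
  have "fminor k (map_mat (hom_poly 1) M) f g = hom_poly k (fminor k M f g)"
    by (rule hom_poly_fminor[OF M deg fg])
  also have "fminor k M f g = 0" using fminors_inD[OF z M fg] by simp
  finally show "fminor k (map_mat (hom_poly 1) M) f g \<in> {0}" by simp
qed

lemma hom_poly_1: "hom_poly 1 f = emb (Polynomial.coeff f 0) * v + emb (Polynomial.coeff f 1) * u"
  by (simp add: hom_poly_def)

end

lemma prime_power_cancel:
  fixes v :: "'r::idom"
  assumes v: "prime_elem v" and e: "\<not> v dvd e" and dvd: "e dvd v ^ K * h"
  shows "e dvd h"
  using dvd
proof (induction K)
  case (Suc K)
  then obtain q where q: "v ^ Suc K * h = e * q" by (elim dvdE)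
  then have "v dvd e * q" by (metis dvd_triv_left mult.assoc power_Suc)
  then have "v dvd q" using v e by (simp add: prime_elem_dvd_mult_iff)
  then obtain q' where "q = v * q'" by (elim dvdE)
  then have "v * (v ^ K * h) = v * (e * q')" using q by (simp add: mult_ac)
  then have "v ^ K * h = e * q'" using v by simp
  then have "e dvd v ^ K * h" by (rule dvdI)
  then show ?case by (rule Suc(1))
qed simp

text \<open>The largest index in \<open>I\<close> is at least \<open>card I - 1\<close>, so its
  factor is a multiple of the last factor on the left.\<close>

lemma prod_dvd_of_inj:
  fixes \<phi> :: "nat \<Rightarrow> 'b::comm_semiring_1"
  assumes chain: "\<And>i j. i \<le> j \<Longrightarrow> j < n \<Longrightarrow> \<phi> i dvd \<phi> j"
    and "finite I" "I \<subseteq> {..<n}"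
  shows "(\<Prod>i<card I. \<phi> i) dvd (\<Prod>i\<in>I. \<phi> i)"
  using assms(2,3)
proof (induction "card I" arbitrary: I)
  case (Suc k)
  then have ne: "I \<noteq> {}" by auto
  define m where "m = Max I"
  have m: "m \<in> I" using Suc ne by (simp add: m_def)
  have "card (I - {m}) = k" using Suc m by simp
  then have IH: "(\<Prod>i<k. \<phi> i) dvd (\<Prod>i\<in>I - {m}. \<phi> i)"
    using Suc(1)[of "I - {m}"] Suc(3,4) by auto
  have "I \<subseteq> {..m}" using Suc by (auto simp: m_def)
  then have "card I \<le> card {..m}" by (intro card_mono) auto
  then have "\<phi> k dvd \<phi> m" using chain[of k m] Suc m by auto
  with IH have "(\<Prod>i<k. \<phi> i) * \<phi> k dvd (\<Prod>i\<in>I - {m}. \<phi> i) * \<phi> m" by (rule mult_dvd_mono)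
  also have "(\<Prod>i\<in>I - {m}. \<phi> i) * \<phi> m = (\<Prod>i\<in>I. \<phi> i)"
    using m Suc by (simp add: prod.remove[of I m] mult.commute)
  finally show ?case by (simp add: Suc(2)[symmetric])
qed simp

text \<open>A Leibniz term is zero unless all chosen positions are diagonal, and then it is the
  product over the selected rows. For distinct rows \<open>prod_dvd_of_inj\<close> applies.\<close>

lemma fminors_diag_dvd:
  fixes \<phi> :: "nat \<Rightarrow> 'b::comm_ring_1"
  assumes chain: "\<And>i j. i \<le> j \<Longrightarrow> j < n \<Longrightarrow> \<phi> i dvd \<phi> j"
  shows "fminors_in k (mat_diag n \<phi>) {x. (\<Prod>i<k. \<phi> i) dvd x}"
  unfolding fminors_in_def
proof (intro allI impI)
  fix f g assume "\<forall>i<k. f i < dim_row (mat_diag n \<phi>)" "\<forall>i<k. g i < dim_col (mat_diag n \<phi>)"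
  then have f: "\<And>i. i < k \<Longrightarrow> f i < n" and g: "\<And>i. i < k \<Longrightarrow> g i < n" by simp_all
  show "fminor k (mat_diag n \<phi>) f g \<in> {x. (\<Prod>i<k. \<phi> i) dvd x}"
  proof (cases "inj_on f {..<k}")
    case False
    then show ?thesis by (simp add: fminor_not_inj)
  next
    case True
    let ?M = "mat k k (\<lambda>(i, j). mat_diag n \<phi> $$ (f i, g j))"
    have "(\<Prod>i<card (f ` {..<k}). \<phi> i) dvd (\<Prod>i\<in>f ` {..<k}. \<phi> i)"
    proof (rule prod_dvd_of_inj[where n = n])
      show "\<phi> i dvd \<phi> j" if "i \<le> j" "j < n" for i j by (rule chain[OF that])
    qed (use f in auto)
    then have img: "(\<Prod>i<k. \<phi> i) dvd (\<Prod>i<k. \<phi> (f i))"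
      using True by (simp add: card_image prod.reindex)
    have "(\<Prod>i<k. \<phi> i) dvd signof p * (\<Prod>i = 0..<k. ?M $$ (i, p i))" if p: "p permutes {0..<k}" for p
    proof (rule dvd_mult)
      have pk: "p i < k" if "i < k" for i using permutes_in_image[OF p, of i] that by simp
      have "?M $$ (i, p i) = (if f i = g (p i) then \<phi> (f i) else 0)" if "i < k" for i
        using that pk[OF that] f g by (auto simp: mat_diag_def)
      then have "(\<Prod>i = 0..<k. \<phi> (f i)) dvd (\<Prod>i = 0..<k. ?M $$ (i, p i))"
        by (intro prod_dvd_prod) simp
      then show "(\<Prod>i<k. \<phi> i) dvd (\<Prod>i = 0..<k. ?M $$ (i, p i))"
        using img by (simp only: atLeast0LessThan) (rule dvd_trans)
    qed
    then have "(\<Prod>i<k. \<phi> i) dvd Determinant.det ?M"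
      unfolding det_def'[of ?M k, OF mat_carrier] by (intro dvd_sum) simp
    then show ?thesis by (simp add: fminor_def)
  qed
qed

text \<open>Homogenizing commutes with the gcd up to powers of \<open>v\<close>. A common divisor
  \<open>e\<close> of the homogenized minors divides some homogenization of \<open>d\<close>,
  possibly of too high a degree. The surplus power of \<open>v\<close> can be removed since
  \<open>v\<close> does not divide \<open>e\<close>: the leading principal minor is a characteristic
  polynomial, and its homogenization is \<open>u ^ k\<close> plus a multiple of
  \<open>v\<close>.\<close>

lemma (in homogenizer) gcd_minors:
  fixes N :: "'a mat"
  assumes N: "has_invariants n N \<phi>" and k: "k \<le> n"
    and prime: "\<And>(e::'r) K h. \<not> v dvd e \<Longrightarrow> e dvd v ^ K * h \<Longrightarrow> e dvd h" and vu: "\<And>m. \<not> v dvd u ^ m"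
  defines "d \<equiv> \<Prod>i<k. \<phi> i"
  shows "is_gcd_of (hom_poly (Polynomial.degree d) d) (minors k (map_mat (hom_poly 1) (char_poly_matrix N)))"
proof -
  let ?C = "char_poly_matrix N"
  have Nc: "N \<in> carrier_mat n n" and ch: "invariant_chain n \<phi>" using N by (simp_all add: has_invariants_def)
  then have C: "?C \<in> carrier_mat n n" by simp
  obtain P P' Q Q' where P: "inverse_pair n P P'" and Q: "inverse_pair n Q Q'"
    and eq: "?C = P * mat_diag n \<phi> * Q" using N unfolding has_invariants_def by blast
  have degC: "Polynomial.degree (?C $$ (i, j)) \<le> 1" if "i < n" "j < n" for i j
    unfolding char_poly_matrix_index[OF Nc that] by (simp add: degree_diff_le)
  have degm: "Polynomial.degree (fminor k ?C f g) \<le> k"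
    if "\<forall>i<k. f i < n" "\<forall>i<k. g i < n" for f g
    unfolding fminor_def using degree_det_le[of k "mat k k (\<lambda>(i, j). ?C $$ (f i, g j))" 1] degC that by simp
  have fm: "fminor k (map_mat (hom_poly 1) ?C) f g = hom_poly k (fminor k ?C f g)"
    if "\<forall>i<k. f i < n" "\<forall>i<k. g i < n" for f g
    by (rule hom_poly_fminor[OF C degC that])
  have hC: "map_mat (hom_poly 1) ?C \<in> carrier_mat n n" using C by simp
  have div: "fminors_in k (map_mat (hom_poly 1) ?C) {x. hom_poly (Polynomial.degree d) d dvd x}"
  proof (rule fminors_inI[OF hC])
    fix f g assume fg: "\<forall>i<k. f i < n" "\<forall>i<k. g i < n"
    have "fminors_in k ?C {x. d dvd x}"
      unfolding eq fminors_in_equiv[OF ring_ideal_dvd P Q mat_diag_dim] d_def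
      by (rule fminors_diag_dvd[OF invariant_chainD(1)[OF ch]])
    from fminors_inD[OF this C fg] have "d dvd fminor k ?C f g" by simp
    then obtain q where q: "fminor k ?C f g = d * q" by (elim dvdE)
    have "hom_poly (Polynomial.degree d) d dvd hom_poly k (fminor k ?C f g)"
    proof (cases "fminor k ?C f g = 0")
      case False
      then have "Polynomial.degree d + Polynomial.degree q \<le> k"
        using degm[OF fg] q degree_mult_eq[of d q] by auto
      then have "hom_poly (Polynomial.degree d + (k - Polynomial.degree d)) (d * q) =
          hom_poly (Polynomial.degree d) d * hom_poly (k - Polynomial.degree d) q"
        by (intro hom_poly_mult) auto
      then show ?thesis using \<open>_ \<le> k\<close> by (simp add: q)
    qed simp
    then show "fminor k (map_mat (hom_poly 1) ?C) f g \<in> {x. hom_poly (Polynomial.degree d) d dvd x}"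
      unfolding fm[OF fg] by simp
  qed
  have greatest: "e dvd hom_poly (Polynomial.degree d) d"
    if e: "fminors_in k (map_mat (hom_poly 1) ?C) {x. e dvd x}" for e
  proof -
    \<comment> \<open>The degree bound \<open>K\<close> has to float for this to be an ideal: sums
      are compared at a common higher degree, at the price of powers of \<open>v\<close>.\<close>
    define J where "J = {f. \<exists>K. Polynomial.degree f \<le> K \<and> e dvd hom_poly K f}"
    have J: "ring_ideal J" unfolding ring_ideal_def
    proof (intro conjI ballI allI)
      show "0 \<in> J" by (simp add: J_def)
      fix x assume "x \<in> J"
      then obtain K where K: "Polynomial.degree x \<le> K" "e dvd hom_poly K x" by (auto simp: J_def)
      { fix c :: "'a poly"
        have "hom_poly (Polynomial.degree c + K) (c * x) = hom_poly (Polynomial.degree c) c * hom_poly K x"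
          by (rule hom_poly_mult[OF order.refl K(1)])
        moreover have "Polynomial.degree (c * x) \<le> Polynomial.degree c + K"
          using degree_mult_le[of c x] K(1) by linarith
        ultimately show "c * x \<in> J"
          unfolding J_def using K(2) by (auto intro!: exI[of _ "Polynomial.degree c + K"]) }
      fix y assume "y \<in> J"
      then obtain L where L: "Polynomial.degree y \<le> L" "e dvd hom_poly L y" by (auto simp: J_def)
      have "hom_poly (K + L) (x + y) = v ^ L * hom_poly K x + v ^ K * hom_poly L y"
        using hom_poly_raise[OF K(1), of L] hom_poly_raise[OF L(1), of K]
        by (simp add: hom_poly_add add.commute)
      moreover have "Polynomial.degree (x + y) \<le> K + L"
        using K(1) L(1) by (intro degree_add_le) auto
      ultimately show "x + y \<in> J"
        unfolding J_def using K(2) L(2) by (auto intro!: exI[of _ "K + L"] dvd_add)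
    qed
    have "fminors_in k ?C J"
    proof (rule fminors_inI[OF C])
      fix f g assume fg: "\<forall>i<k. f i < n" "\<forall>i<k. g i < n"
      have "e dvd hom_poly k (fminor k ?C f g)"
        using fminors_inD[OF e hC fg] unfolding fm[OF fg] by simp
      then show "fminor k ?C f g \<in> J" unfolding J_def using degm[OF fg] by blast
    qed
    then have "fminors_in k (mat_diag n \<phi>) J"
      unfolding eq fminors_in_equiv[OF J P Q mat_diag_dim] .
    then have "fminor k (mat_diag n \<phi>) id id \<in> J"
      unfolding fminors_in_def using k by auto
    then have "d \<in> J" using k by (simp add: fminor_diag_id d_def)
    then obtain K where K: "Polynomial.degree d \<le> K" "e dvd hom_poly K d" by (auto simp: J_def)
    have eK: "e dvd v ^ (K - Polynomial.degree d) * hom_poly (Polynomial.degree d) d"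
      using hom_poly_raise[OF order.refl, of d "K - Polynomial.degree d"] K by simp
    define m0 where "m0 = fminor k ?C id id"
    have "mat k k (\<lambda>(i, j). ?C $$ (id i, id j)) = char_poly_matrix (mat k k (\<lambda>(i, j). N $$ (i, j)))"
      by (rule eq_matI) (use k Nc in \<open>auto simp: char_poly_matrix_def\<close>)
    then have "m0 = char_poly (mat k k (\<lambda>(i, j). N $$ (i, j)))"
      by (simp add: m0_def fminor_def char_poly_def)
    then have m0: "Polynomial.coeff m0 k = 1"
      using degree_monic_char_poly[of "mat k k (\<lambda>(i, j). N $$ (i, j))" k] by simp
    have "hom_poly k m0 = (\<Sum>j<k. emb (Polynomial.coeff m0 j) * u ^ j * v ^ (k - j)) + u ^ k"
      unfolding hom_poly_def lessThan_Suc_atMost[symmetric] by (simp add: m0)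
    moreover have "v dvd (\<Sum>j<k. emb (Polynomial.coeff m0 j) * u ^ j * v ^ (k - j))"
      by (intro dvd_sum) (auto intro!: dvd_mult dvd_power)
    ultimately have "\<not> v dvd hom_poly k m0" using vu[of k] by (simp add: dvd_add_right_iff)
    moreover have "e dvd hom_poly k m0"
    proof -
      have ids: "\<forall>i<k. id i < n" using k by simp
      show ?thesis using fminors_inD[OF e hC ids ids] unfolding fm[OF ids ids] m0_def by simp
    qed
    ultimately have "\<not> v dvd e" by (metis dvd_trans)
    then show ?thesis using eK by (rule prime)
  qed
  show ?thesis
    unfolding is_gcd_of_def
    using div greatest unfolding fminors_in_iff_minors[OF ring_ideal_dvd] by (auto simp: subset_iff)
qed

section \<open>Normal rank\<close>

lemma rank_sum_products:
  fixes u v :: "nat \<Rightarrow> nat \<Rightarrow> 'k::field"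
  shows "vec_space.rank n (mat n n (\<lambda>(i, j). \<Sum>l<q. u i l * v l j)) \<le> q"
proof -
  interpret vec_space "TYPE('k)" n .
  show ?thesis
  proof (induction q)
    case 0
    have zero: "mat n n (\<lambda>(i, j). \<Sum>l<0. u i l * v l j) = 0\<^sub>m n n" by (rule eq_matI) auto
    show ?case unfolding zero using rank_0I[of n] by simp
  next
    case (Suc q)
    let ?A = "mat n n (\<lambda>(i, j). \<Sum>l<q. u i l * v l j)"
    let ?B = "mat n n (\<lambda>(i, j). u i q * v q j)"
    have "mat n n (\<lambda>(i, j). \<Sum>l<Suc q. u i l * v l j) = ?A + ?B" by (rule eq_matI) auto
    moreover have "rank (?A + ?B) \<le> rank ?A + rank ?B" by (rule rank_subadditive[of _ n]) auto
    moreover have "rank ?B \<le> 1" by (rule rank_le_1_product_entries[of _ n "\<lambda>i. u i q" "\<lambda>j. v q j"]) auto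
    ultimately show ?case using Suc by simp
  qed
qed

lemma normal_rank_le:
  fixes P :: "'a::field poly mat"
  assumes "rank_le n r P"
  shows "normal_rank P \<le> r"
proof -
  obtain u v where P: "P = mat n n (\<lambda>(i, j). \<Sum>l<r. u i l * v l j)"
    using assms by (auto simp: rank_le_def)
  have hom: "to_fract (\<Sum>l<r. u i l * v l j) = (\<Sum>l<r. to_fract (u i l) * to_fract (v l j))" for i j
    by (induction r) simp_all
  have "map_mat to_fract P = mat n n (\<lambda>(i, j). \<Sum>l<r. to_fract (u i l) * to_fract (v l j))"
    by (rule eq_matI) (auto simp: P hom)
  then show ?thesis
    using rank_sum_products[where n = n and q = r and u = "\<lambda>i l. to_fract (u i l)"
      and v = "\<lambda>l j. to_fract (v l j)"]
    by (simp add: normal_rank_def P)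
qed

lemma normal_rank_less_fminors:
  fixes P :: "'a::field poly mat"
  assumes P: "P \<in> carrier_mat n n" and less: "normal_rank P < k"
  shows "fminors_in k P {0}"
  unfolding fminors_in_iff_minors[OF ring_ideal_zero]
proof
  fix x assume "x \<in> minors k P"
  then obtain I L where IL: "I \<subseteq> {..<n}" "L \<subseteq> {..<n}" "card I = k" "card L = k"
    and x: "x = Determinant.det (submatrix P I L)" using P by (auto simp: minors_def)
  interpret vec_space "TYPE('a poly fract)" n .
  let ?F = "map_mat to_fract P"
  have F: "?F \<in> carrier_mat n n" using P by simp
  have sets: "{i. i < n \<and> i \<in> I} = I" "{i. i < n \<and> i \<in> L} = L" using IL by auto
  have pI: "pick I i < n" and pL: "pick L i < n" if "i < k" for i
    using pick_in_set[of i I] pick_in_set[of i L] IL that by auto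
  have sub: "submatrix ?F I L = map_mat to_fract (submatrix P I L)"
    using P IL sets pI pL by (intro eq_matI) (auto simp: submatrix_def)
  interpret h: comm_ring_hom "to_fract :: 'a poly \<Rightarrow> _" by unfold_locales simp_all
  have "Determinant.det (submatrix ?F I L) = to_fract x" unfolding sub x by (rule h.hom_det)
  moreover have "rank ?F < k" using less P by (simp add: normal_rank_def)
  ultimately have "to_fract x = 0"
    using rank_gt_minor[OF F, of I L] IL sets by (metis leD)
  then show "x \<in> {0}" by simp
qed

section \<open>Rank factorizations from vanishing minors\<close>

lemma fminors_zero_rank_le:
  fixes Z :: "'a::field poly mat"
  assumes Z: "Z \<in> carrier_mat n n" and min: "fminors_in (Suc r) Z {0}"
  obtains E E' S F F' where "inverse_pair n E E'" "inverse_pair n F F'"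
    "Z = E * mat_diag n S * F" "\<And>l. r \<le> l \<Longrightarrow> l < n \<Longrightarrow> S l = 0"
proof -
  obtain E E' F F' S where E: "inverse_pair n E E'" and F: "inverse_pair n F F'"
    and eq: "Z = E * mat_diag n S * F" and ch: "\<And>i j. i \<le> j \<Longrightarrow> j < n \<Longrightarrow> S i dvd S j"
    by (rule smith_normal_form[OF Z]) (rule that)
  have "S l = 0" if "r \<le> l" "l < n" for l
    by (rule smith_zero_tail[OF E F eq _ min that]) (rule ch)
  with E F eq show thesis by (rule that)
qed

text \<open>The Smith form yields a factorization with polynomial entries, where rank over the
  fraction field alone would give fractions.\<close>

lemma rank_le_of_fminors:
  fixes Z :: "'a::field poly mat"
  assumes Z: "Z \<in> carrier_mat n n" and min: "fminors_in (Suc r) Z {0}"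
  shows "rank_le n r Z"
proof -
  obtain E E' S F F' where E: "inverse_pair n E E'" and F: "inverse_pair n F F'"
    and eq: "Z = E * mat_diag n S * F" and S: "\<And>l. r \<le> l \<Longrightarrow> l < n \<Longrightarrow> S l = 0"
    by (rule fminors_zero_rank_le[OF Z min]) (rule that)
  have "rank_le n r (mat_diag n S)"
    by (rule rank_le_rows[of _ _ 0]) (use S in \<open>auto simp: mat_diag_def\<close>)
  then show ?thesis unfolding eq
    by (intro rank_le_mult_left rank_le_mult_right inverse_pairD(1)[OF E] inverse_pairD(1)[OF F])
qed

lemma rank_le_const_mat:
  assumes "rank_le n q Z"
  shows "rank_le n q (const_mat Z)"
proof -
  obtain u v where Z: "Z = mat n n (\<lambda>(i, j). \<Sum>l<q. u i l * v l j)" using assms by (auto simp: rank_le_def)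
  have "[:\<Sum>l<q. u i l * v l j:] = (\<Sum>l<q. [:u i l:] * [:v l j:])" for i j
    by (simp add: sum_pCons_0 mult.commute)
  then have "const_mat Z = mat n n (\<lambda>(i, j). \<Sum>l<q. [:u i l:] * [:v l j:])"
    by (intro eq_matI) (auto simp: Z)
  then show ?thesis unfolding rank_le_def
    by (intro exI[of _ "\<lambda>i l. [:u i l:]"] exI[of _ "\<lambda>l j. [:v l j:]"])
qed

lemma eval_mult:
  fixes A B :: "'b::comm_ring_1 poly mat"
  assumes "A \<in> carrier_mat n m" "B \<in> carrier_mat m p"
  shows "map_mat (\<lambda>f. poly f 0) (A * B) = map_mat (\<lambda>f. poly f 0) A * map_mat (\<lambda>f. poly f 0) B"
proof (rule eq_matI)
  fix i j
  assume "i < dim_row (map_mat (\<lambda>f. poly f 0) A * map_mat (\<lambda>f. poly f 0) B)"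
    "j < dim_col (map_mat (\<lambda>f. poly f 0) A * map_mat (\<lambda>f. poly f 0) B)"
  then have ij: "i < n" "j < p" using assms by auto
  have c: "map_mat (\<lambda>f. poly f 0) A \<in> carrier_mat n m" "map_mat (\<lambda>f. poly f 0) B \<in> carrier_mat m p"
    using assms by auto
  have "(map_mat (\<lambda>f. poly f 0) A * map_mat (\<lambda>f. poly f 0) B) $$ (i, j) = poly ((A * B) $$ (i, j)) 0"
    unfolding mult_mat_index[OF c ij] mult_mat_index[OF assms ij] using ij assms by (simp add: poly_sum)
  then show "map_mat (\<lambda>f. poly f 0) (A * B) $$ (i, j) =
      (map_mat (\<lambda>f. poly f 0) A * map_mat (\<lambda>f. poly f 0) B) $$ (i, j)"
    using ij assms by (simp del: index_mult_mat(1) add: index_mult_mat(2,3))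
qed (use assms in auto)

text \<open>Row reduction over the field, obtained from the Smith form of the constant polynomial
  matrix by evaluating at 0: evaluation preserves the inverse pair and the zero rows.\<close>

lemma rank_le_row_form:
  fixes Z :: "'a::field mat"
  assumes Z: "rank_le n r Z"
  obtains T T' Z0 where "inverse_pair n T T'" "Z0 \<in> carrier_mat n n" "Z = T * Z0"
    "\<And>i j. r \<le> i \<Longrightarrow> i < n \<Longrightarrow> j < n \<Longrightarrow> Z0 $$ (i, j) = 0"
proof -
  let ?e = "map_mat (\<lambda>f :: 'a poly. poly f 0)"
  have cZ: "const_mat Z \<in> carrier_mat n n" using rank_le_carrier[OF Z] by simp
  obtain E E' S F F' where E: "inverse_pair n E E'" and F: "inverse_pair n F F'"
    and eq: "const_mat Z = E * mat_diag n S * F" and S: "\<And>l. r \<le> l \<Longrightarrow> l < n \<Longrightarrow> S l = 0"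
    by (rule fminors_zero_rank_le[OF cZ rank_le_fminors[OF rank_le_const_mat[OF Z] lessI]]) (rule that)
  note c = inverse_pairD(1,2)[OF E] inverse_pairD(1,2)[OF F]
  have one: "?e (1\<^sub>m n) = 1\<^sub>m n" by (rule eq_matI) auto
  have T: "inverse_pair n (?e E) (?e E')"
    unfolding inverse_pair_def
    using c eval_mult[OF c(1,2)] eval_mult[OF c(2,1)] inverse_pairD(3,4)[OF E] one by simp
  have DF: "mat_diag n S * F \<in> carrier_mat n n" using c by simp
  have "const_mat Z = E * (mat_diag n S * F)"
    unfolding eq by (rule assoc_mult_mat[OF c(1) mat_diag_dim c(3)])
  then have "?e (const_mat Z) = ?e E * ?e (mat_diag n S * F)" using eval_mult[OF c(1) DF] by simp
  moreover have "?e (const_mat Z) = Z" by (rule eq_matI) auto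
  moreover have "?e (mat_diag n S * F) $$ (i, j) = 0" if "r \<le> i" "i < n" "j < n" for i j
    using that S[of i] c by (simp add: mat_diag_mult_left[OF c(3)])
  ultimately show thesis using that[OF T, of "?e (mat_diag n S * F)"] DF by simp
qed

text \<open>Put \<open>m = i + r\<close> and \<open>f = \<psi> m\<close>. Since
  \<open>\<psi> l\<close> divides \<open>f\<close> for \<open>l \<le> m\<close>, the matrix
  \<open>f I\<close> is a multiple of \<open>D2\<close> up to a matrix with \<open>n - 1 - m\<close>
  generators. Passing from \<open>D2\<close> to \<open>D1\<close> costs \<open>r\<close> more, in
  total \<open>n - 1 - i\<close>, and \<open>invariant_factor_dvd\<close> returns
  \<open>\<phi> i dvd f\<close>.\<close>

lemma perturbed_invariants_dvd:
  fixes \<phi> \<psi> :: "nat \<Rightarrow> 'a::field poly"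
  assumes P: "inverse_pair n P P'" and Q: "inverse_pair n Q Q'" and D1: "D1 = P * mat_diag n \<phi> * Q"
    and R: "inverse_pair n R R'" and S: "inverse_pair n S S'" and D2: "D2 = R * mat_diag n \<psi> * S"
    and \<phi>: "\<And>i j. i \<le> j \<Longrightarrow> j < n \<Longrightarrow> \<phi> i dvd \<phi> j" and \<psi>: "\<And>i j. i \<le> j \<Longrightarrow> j < n \<Longrightarrow> \<psi> i dvd \<psi> j"
    and Z: "rank_le n r Z" and eq: "D2 = D1 + Z" and i: "i + r < n"
  shows "\<phi> i dvd \<psi> (i + r)"
proof -
  define m where "m = i + r"
  define f where "f = \<psi> m"
  have m: "m < n" using i by (simp add: m_def)
  note c = inverse_pairD(1,2)[OF P] inverse_pairD(1,2)[OF Q] inverse_pairD(1,2)[OF R] inverse_pairD(1,2)[OF S]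
  define x where "x = (\<lambda>l. if l \<le> m then f div \<psi> l else 0)"
  define y where "y = (\<lambda>l. if l \<le> m then 0 else f)"
  have "\<psi> l * x l + y l = f" if "l < n" for l
    using \<psi>[of l m] m by (simp add: x_def y_def f_def)
  then have fI: "mat_diag n (\<lambda>_. f) = mat_diag n \<psi> * mat_diag n x + mat_diag n y"
    unfolding mat_diag_diag by (intro eq_matI) (auto simp: mat_diag_def)
  define W where "W = S' * mat_diag n x * R'"
  have W: "W \<in> carrier_mat n n" unfolding W_def by (rule mult_carrier_mat[of _ n n]) (use c in auto)
  have Y: "rank_le n (n - 1 - m) (mat_diag n y)"
    by (rule rank_le_rows[of _ _ "Suc m"]) (use m in \<open>auto simp: mat_diag_def y_def\<close>)
  define Y' where "Y' = R * mat_diag n y * R'"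
  have Y': "rank_le n (n - 1 - m) Y'" unfolding Y'_def
    by (intro rank_le_mult_right rank_le_mult_left Y c)
  have dc: "mat_diag n g \<in> carrier_mat n n" for g :: "nat \<Rightarrow> 'a poly" by simp
  have Rd: "R * mat_diag n g \<in> carrier_mat n n" for g using c by simp
  have "mat_diag n (\<lambda>_. f) = R * mat_diag n (\<lambda>_. f) * R'"
  proof -
    have "R * mat_diag n (\<lambda>_. f) = mat_diag n (\<lambda>_. f) * R"
      using c by (simp add: mat_diag_mult_left[of R n n] mat_diag_mult_right[of R n n] mult.commute)
    then show ?thesis using inverse_pair_cancel_right(1)[OF R dc] by simp
  qed
  also have "R * mat_diag n (\<lambda>_. f) = R * (mat_diag n \<psi> * mat_diag n x) + R * mat_diag n y"
    unfolding fI by (rule mult_add_distrib_mat[OF c(5) _ dc]) simp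
  also have "(R * (mat_diag n \<psi> * mat_diag n x) + R * mat_diag n y) * R' =
      R * (mat_diag n \<psi> * mat_diag n x) * R' + Y'"
    unfolding Y'_def by (rule add_mult_distrib_mat[OF _ Rd c(6)]) (use c in simp)
  also have "R * (mat_diag n \<psi> * mat_diag n x) * R' = D2 * W"
  proof -
    have SW: "S * W = mat_diag n x * R'"
    proof -
      have "S' * mat_diag n x * R' = S' * (mat_diag n x * R')" by (rule assoc_mult_mat[OF c(8) dc c(6)])
      then show ?thesis unfolding W_def using inverse_pair_cancel(1)[OF S, of "mat_diag n x * R'" n] c by simp
    qed
    have "D2 * W = R * mat_diag n \<psi> * (S * W)" unfolding D2 by (rule assoc_mult_mat[OF Rd c(7) W])
    also have "\<dots> = R * mat_diag n \<psi> * mat_diag n x * R'"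
      unfolding SW by (rule assoc_mult_mat[OF Rd dc c(6), symmetric])
    also have "R * mat_diag n \<psi> * mat_diag n x = R * (mat_diag n \<psi> * mat_diag n x)"
      by (rule assoc_mult_mat[OF c(5) dc dc])
    finally show ?thesis by (rule sym)
  qed
  also have "D2 * W = D1 * W + Z * W"
  proof -
    have "D1 \<in> carrier_mat n n" unfolding D1 by (rule mult_carrier_mat[of _ n n]) (use c in auto)
    then show ?thesis unfolding eq by (rule add_mult_distrib_mat[OF _ rank_le_carrier[OF Z] W])
  qed
  also have "D1 * W + Z * W + Y' = D1 * W + (Z * W + Y')"
  proof (rule assoc_add_mat[of _ n n])
    show "D1 * W \<in> carrier_mat n n" unfolding D1
      by (rule mult_carrier_mat[OF mult_carrier_mat[of _ n n] W]) (use c in auto)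
  qed (use rank_le_carrier[OF Y'] rank_le_carrier[OF rank_le_mult_right[OF Z W]] in auto)
  finally have fin: "mat_diag n (\<lambda>_. f) = D1 * W + (Z * W + Y')" .
  have rk: "rank_le n (r + (n - 1 - m)) (Z * W + Y')"
    by (rule rank_le_add[OF rank_le_mult_right[OF Z W] Y'])
  have "\<phi> (n - 1 - (r + (n - 1 - m))) dvd f"
    by (rule invariant_factor_dvd[OF P Q D1 _ W rk _ fin]) (use \<phi> i in \<open>auto simp: m_def\<close>)
  moreover have "n - 1 - (r + (n - 1 - m)) = i" using i by (simp add: m_def)
  ultimately show ?thesis by (simp add: f_def m_def)
qed

section \<open>Invertible matrices and an auxiliary matrix of prescribed rank\<close>

lemma det_nonzero_inverse_pair:
  fixes A :: "'k::field mat"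
  assumes A: "A \<in> carrier_mat n n" and "Determinant.det A \<noteq> 0"
  obtains B where "inverse_pair n A B"
proof -
  have "A \<in> Units (ring_mat TYPE('k) n undefined)"
    by (rule det_non_zero_imp_unit[OF assms])
  then show thesis using that by (auto simp: Units_def ring_mat_def inverse_pair_def)
qed

lemma invertible_mat_iff_inverse_pair:
  fixes Q :: "'b::comm_ring_1 mat"
  assumes Q: "Q \<in> carrier_mat n n"
  shows "invertible_mat Q \<longleftrightarrow> (\<exists>Q'. inverse_pair n Q Q')"
proof
  assume "invertible_mat Q"
  then obtain B where B: "Q * B = 1\<^sub>m n" "B * Q = 1\<^sub>m (dim_row B)"
    using Q by (auto simp: invertible_mat_def inverts_mat_def)
  have "dim_col (Q * B) = n" "dim_col (B * Q) = dim_row B" unfolding B by simp_all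
  then have "B \<in> carrier_mat n n" using Q by auto
  then show "\<exists>Q'. inverse_pair n Q Q'" using B Q by (auto simp: inverse_pair_def)
next
  assume "\<exists>Q'. inverse_pair n Q Q'"
  then show "invertible_mat Q" using Q
    by (auto simp: invertible_mat_def inverts_mat_def inverse_pair_def)
qed

text \<open>One computation for \<open>Y\<close> (with \<open>c = 0\<close>) and
  \<open>I + Y\<close> (with \<open>c = 1\<close>). All rows but the last give
  \<open>v $ Suc i = - c * v $ i\<close>, so it is enough that \<open>v $ 0 = 0\<close>: for
  \<open>c = 1\<close> the last row reads \<open>- v $ 0 = 0\<close>, for \<open>c = 0\<close> the
  last coordinate is already zero.\<close>

lemma full_cycle_kernel:
  fixes Y :: "'k::field mat"
  assumes n: "n \<ge> 2"
    and Y: "Y = mat n n (\<lambda>(i, j). if i = n - 1 then (if j = 0 \<or> j = n - 1 then - 1 else 0)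
      else if j = Suc i then 1 else 0)"
    and v: "v \<in> carrier_vec n" and c: "c = 0 \<or> c = 1"
    and z: "(c \<cdot>\<^sub>m 1\<^sub>m n + Y) *\<^sub>v v = 0\<^sub>v n"
  shows "v = 0\<^sub>v n"
proof -
  have row: "c * v $ i + (\<Sum>j<n. Y $$ (i, j) * v $ j) = 0" if i: "i < n" for i
  proof -
    have "((c \<cdot>\<^sub>m 1\<^sub>m n + Y) *\<^sub>v v) $ i = (\<Sum>j<n. (c * (if i = j then 1 else 0) + Y $$ (i, j)) * v $ j)"
      using i v Y by (auto simp: scalar_prod_def atLeast0LessThan intro!: sum.cong)
    also have "\<dots> = (\<Sum>j<n. (if j = i then c * v $ j else 0) + Y $$ (i, j) * v $ j)"
      by (intro sum.cong) (auto simp: distrib_right)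
    finally show ?thesis using z i by (simp add: sum.distrib)
  qed
  have step: "v $ Suc i = - c * v $ i" if "Suc i < n" for i
  proof -
    have "(\<Sum>j<n. Y $$ (i, j) * v $ j) = (\<Sum>j<n. if j = Suc i then v $ j else 0)"
      using that by (intro sum.cong) (auto simp: Y)
    then have "c * v $ i + v $ Suc i = 0" using row[of i] that by simp
    then show ?thesis by (simp add: eq_neg_iff_add_eq_0 add.commute)
  qed
  have "(\<Sum>j<n. Y $$ (n - 1, j) * v $ j) =
      (\<Sum>j<n. (if j = 0 then - v $ j else 0) + (if j = n - 1 then - v $ j else 0))"
    using n by (intro sum.cong) (auto simp: Y)
  then have last: "c * v $ (n - 1) + (- v $ 0 - v $ (n - 1)) = 0"
    using row[of "n - 1"] n by (simp add: sum.distrib)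
  have v0: "v $ 0 = 0"
  proof (cases "c = 0")
    case True
    have "v $ (n - 1) = 0" using step[of "n - 2"] n True by (simp add: Suc_diff_Suc numeral_2_eq_2)
    then show ?thesis using last True by simp
  next
    case False
    then show ?thesis using last c by simp
  qed
  have "v $ i = 0" if "i < n" for i
    using that by (induction i) (use v0 step in auto)
  then show ?thesis using v by (intro eq_vecI) auto
qed

text \<open>
  For \<open>r < n\<close> a nilpotent shift works. For \<open>r = n\<close> it is the companion matrix of \<open>x\<^sup>n + x\<^sup>n\<^sup>-\<^sup>1 + 1\<close>, which has
  neither \<open>0\<close> nor \<open>-1\<close> as an eigenvalue over any field; over the field with two elements this fails for
  \<open>n = 1\<close>.
\<close>

lemma unit_plus_rank:
  assumes n: "n \<ge> 2" and r: "r \<le> n"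
  obtains Y W :: "'k::field mat" and f g where "Y \<in> carrier_mat n n" "inverse_pair n (1\<^sub>m n + Y) W"
    "\<And>i j. r \<le> i \<Longrightarrow> i < n \<Longrightarrow> j < n \<Longrightarrow> Y $$ (i, j) = 0"
    "\<forall>i<r. f i < n" "\<forall>i<r. g i < n" "fminor r Y f g \<noteq> 0"
proof (cases "r < n")
  case True
  define Y :: "'k mat" where "Y = mat n n (\<lambda>(i, j). if i < r \<and> j = Suc i then 1 else 0)"
  have Y: "Y \<in> carrier_mat n n" by (simp add: Y_def)
  have IY: "1\<^sub>m n + Y \<in> carrier_mat n n" using Y by simp
  have "Determinant.det (1\<^sub>m n + Y) = prod_list (diag_mat (1\<^sub>m n + Y))"
    by (rule det_upper_triangular[OF _ IY]) (auto simp: upper_triangular_def Y_def)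
  also have "diag_mat (1\<^sub>m n + Y) = map (\<lambda>i. 1) [0..<n]"
    by (auto simp: diag_mat_def Y_def)
  also have "prod_list \<dots> = (1::'k)" by (simp add: map_replicate_const)
  finally obtain W where W: "inverse_pair n (1\<^sub>m n + Y) W"
    using det_nonzero_inverse_pair[OF IY] by (metis zero_neq_one)
  have "mat r r (\<lambda>(i, j). Y $$ (id i, Suc j)) = 1\<^sub>m r"
    by (rule eq_matI) (use True in \<open>auto simp: Y_def\<close>)
  then have "fminor r Y id Suc \<noteq> 0" by (simp add: fminor_def)
  then show thesis
    using that[OF Y W, of id Suc] True by (auto simp: Y_def)
next
  case False
  then have rn: "r = n" using r by simp
  define Y :: "'k mat" where "Y = mat n n (\<lambda>(i, j). if i = n - 1 then (if j = 0 \<or> j = n - 1 then - 1 else 0)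
      else if j = Suc i then 1 else 0)"
  have Y: "Y \<in> carrier_mat n n" by (simp add: Y_def)
  have IY: "1\<^sub>m n + Y \<in> carrier_mat n n" using Y by simp
  have one: "1 \<cdot>\<^sub>m 1\<^sub>m n + Y = 1\<^sub>m n + Y" by (rule eq_matI) (use Y in auto)
  have "Determinant.det (1\<^sub>m n + Y) \<noteq> 0"
    unfolding det_0_iff_vec_prod_zero_field[OF IY]
    using full_cycle_kernel[OF n Y_def, of _ 1] unfolding one by auto
  then obtain W where W: "inverse_pair n (1\<^sub>m n + Y) W"
    using det_nonzero_inverse_pair[OF IY] by blast
  have "0 \<cdot>\<^sub>m 1\<^sub>m n + Y = Y" using Y by (intro eq_matI) auto
  then have "Determinant.det Y \<noteq> 0"
    unfolding det_0_iff_vec_prod_zero_field[OF Y]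
    using full_cycle_kernel[OF n Y_def, of _ 0] by auto
  moreover have "mat n n (\<lambda>(i, j). Y $$ (id i, id j)) = Y" using Y by (intro eq_matI) auto
  ultimately have "fminor r Y id id \<noteq> 0" by (simp add: fminor_def rn)
  then show thesis using that[OF Y W, of id id] rn by auto
qed

section \<open>Pencils in coordinates adapted to a regular point\<close>

text \<open>Linear maps over the field, with \<open>emb\<close> the image of the scalars.
  Coefficient maps, substitutions and homogenizations are all of this kind and therefore commute
  with multiplication by constant matrices.\<close>

definition semilinear :: "('a::field \<Rightarrow> 'r::comm_ring_1) \<Rightarrow> ('a poly \<Rightarrow> 'r) \<Rightarrow> bool" where
  "semilinear emb L \<longleftrightarrow> (\<forall>p q. L (p + q) = L p + L q) \<and> (\<forall>c p. L (smult c p) = emb c * L p)"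

lemma semilinear_sum:
  assumes "semilinear emb L"
  shows "L (\<Sum>x\<in>A. smult (c x) (p x)) = (\<Sum>x\<in>A. emb (c x) * L (p x))"
proof -
  have L: "L (p + q) = L p + L q" "L (smult c p) = emb c * L p" for p q c
    using assms by (auto simp: semilinear_def)
  have "L 0 = 0" using L(1)[of 0 0] by simp
  then show ?thesis by (induction A rule: infinite_finite_induct) (simp_all add: L)
qed

lemma semilinear_mult_left:
  assumes L: "semilinear emb L" and G: "G \<in> carrier_mat n m" and M: "M \<in> carrier_mat m p"
  shows "map_mat L (const_mat G * M) = map_mat emb G * map_mat L M"
proof (rule eq_matI)
  fix i j assume "i < dim_row (map_mat emb G * map_mat L M)" "j < dim_col (map_mat emb G * map_mat L M)"
  then have ij: "i < n" "j < p" using G M by auto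
  have c: "const_mat G \<in> carrier_mat n m" "map_mat emb G \<in> carrier_mat n m" "map_mat L M \<in> carrier_mat m p"
    using G M by auto
  have "(const_mat G * M) $$ (i, j) = (\<Sum>l<m. smult (G $$ (i, l)) (M $$ (l, j)))"
    unfolding mult_mat_index[OF c(1) M ij] using G ij by (intro sum.cong) auto
  then have "L ((const_mat G * M) $$ (i, j)) = (\<Sum>l<m. emb (G $$ (i, l)) * L (M $$ (l, j)))"
    using semilinear_sum[OF L] by simp
  also have "\<dots> = (map_mat emb G * map_mat L M) $$ (i, j)"
    unfolding mult_mat_index[OF c(2,3) ij] using G M ij by (intro sum.cong) auto
  finally show "map_mat L (const_mat G * M) $$ (i, j) = (map_mat emb G * map_mat L M) $$ (i, j)"
    using G M ij by (simp del: index_mult_mat(1) add: index_mult_mat(2,3))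
qed (use G M in auto)

lemma semilinear_mult_right:
  assumes L: "semilinear emb L" and G: "G \<in> carrier_mat m p" and M: "M \<in> carrier_mat n m"
  shows "map_mat L (M * const_mat G) = map_mat L M * map_mat emb G"
proof (rule eq_matI)
  fix i j assume "i < dim_row (map_mat L M * map_mat emb G)" "j < dim_col (map_mat L M * map_mat emb G)"
  then have ij: "i < n" "j < p" using G M by auto
  have c: "const_mat G \<in> carrier_mat m p" "map_mat emb G \<in> carrier_mat m p" "map_mat L M \<in> carrier_mat n m"
    using G M by auto
  have "(M * const_mat G) $$ (i, j) = (\<Sum>l<m. smult (G $$ (l, j)) (M $$ (i, l)))"
    unfolding mult_mat_index[OF M c(1) ij] using G ij by (intro sum.cong) auto
  then have "L ((M * const_mat G) $$ (i, j)) = (\<Sum>l<m. emb (G $$ (l, j)) * L (M $$ (i, l)))"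
    using semilinear_sum[OF L] by simp
  also have "\<dots> = (map_mat L M * map_mat emb G) $$ (i, j)"
    unfolding mult_mat_index[OF c(3,2) ij] using G M ij by (intro sum.cong) (auto simp: mult.commute)
  finally show "map_mat L (M * const_mat G) $$ (i, j) = (map_mat L M * map_mat emb G) $$ (i, j)"
    using G M ij by (simp del: index_mult_mat(1) add: index_mult_mat(2,3))
qed (use G M in auto)

lemma semilinear_add:
  assumes L: "semilinear emb L" and "A \<in> carrier_mat n m" "B \<in> carrier_mat n m"
  shows "map_mat L (A + B) = map_mat L A + map_mat L B"
  by (rule eq_matI) (use assms in \<open>auto simp: semilinear_def\<close>)

context homogenizer
begin

lemma semilinear_hom_poly: "semilinear emb (hom_poly k)"
  by (simp add: semilinear_def hom_poly_add hom_poly_smult)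

lemma emb_sum: "emb (\<Sum>x\<in>A. f x) = (\<Sum>x\<in>A. emb (f x))"
  by (induction A rule: infinite_finite_induct) (simp_all add: emb_add)

lemma hom_poly_char_poly_matrix:
  assumes "N \<in> carrier_mat n n" "i < n" "j < n"
  shows "hom_poly 1 (char_poly_matrix N $$ (i, j)) = emb (if i = j then 1 else 0) * u - emb (N $$ (i, j)) * v"
  unfolding char_poly_matrix_index[OF assms] hom_poly_1 by (simp add: emb_minus)

text \<open>When \<open>map_mat val A\<close> is invertible, \<open>MN\<close> says that
  \<open>N\<close> is minus its inverse times \<open>map_mat co A\<close>; factoring the value at
  the chosen point out of the pencil leaves \<open>u I - v N\<close>.\<close>

lemma pencil_factorization:
  assumes A: "A \<in> carrier_mat n n" and N: "N \<in> carrier_mat n n"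
    and MN: "map_mat val A * N = map_mat (\<lambda>p. - co p) A"
  shows "map_mat (\<lambda>p. emb (val p) * u + emb (co p) * v) A =
    map_mat emb (map_mat val A) * map_mat (hom_poly 1) (char_poly_matrix N)"
proof (rule eq_matI)
  let ?M = "map_mat emb (map_mat val A)" and ?H = "map_mat (hom_poly 1) (char_poly_matrix N)"
  have C: "char_poly_matrix N \<in> carrier_mat n n" using N by simp
  have V: "map_mat val A \<in> carrier_mat n n" and M: "?M \<in> carrier_mat n n" and H: "?H \<in> carrier_mat n n"
    using A N by auto
  fix i j assume "i < dim_row (?M * ?H)" "j < dim_col (?M * ?H)"
  then have ij: "i < n" "j < n" using M H by auto
  have "(?M * ?H) $$ (i, j) =
      (\<Sum>l<n. emb (val (A $$ (i, l)) * (if l = j then 1 else 0)) * u - emb (val (A $$ (i, l)) * N $$ (l, j)) * v)"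
    unfolding mult_mat_index[OF M H ij]
  proof (intro sum.cong refl)
    fix l assume "l \<in> {..<n}"
    then have l: "l < n" by simp
    have "?H $$ (l, j) = emb (if l = j then 1 else 0) * u - emb (N $$ (l, j)) * v"
      unfolding hom_poly_char_poly_matrix[OF N l ij(2), symmetric]
      by (rule index_map_mat(1)) (use l ij(2) C in auto)
    moreover have "?M $$ (i, l) = emb (val (A $$ (i, l)))" using l ij A by simp
    ultimately show "?M $$ (i, l) * ?H $$ (l, j) =
        emb (val (A $$ (i, l)) * (if l = j then 1 else 0)) * u - emb (val (A $$ (i, l)) * N $$ (l, j)) * v"
      by (simp only: emb_mult right_diff_distrib mult.assoc)
  qed
  also have "\<dots> = emb (\<Sum>l<n. val (A $$ (i, l)) * (if l = j then 1 else 0)) * u -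
      emb (\<Sum>l<n. val (A $$ (i, l)) * N $$ (l, j)) * v"
    by (simp only: sum_subtractf emb_sum sum_distrib_right)
  also have "(\<Sum>l<n. val (A $$ (i, l)) * (if l = j then 1 else 0)) =
      (\<Sum>l<n. if l = j then val (A $$ (i, l)) else 0)" by (intro sum.cong) auto
  also have "\<dots> = val (A $$ (i, j))" using ij by simp
  also have "(\<Sum>l<n. val (A $$ (i, l)) * N $$ (l, j)) = (map_mat val A * N) $$ (i, j)"
    unfolding mult_mat_index[OF V N ij] using A ij by (intro sum.cong) auto
  also have "\<dots> = - co (A $$ (i, j))" unfolding MN using A ij by simp
  finally show "map_mat (\<lambda>p. emb (val p) * u + emb (co p) * v) A $$ (i, j) = (?M * ?H) $$ (i, j)"
    using ij A by (simp add: emb_minus del: index_mult_mat(1))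
qed (use A carrier_matD(2)[OF char_poly_matrix_closed[OF N]] in simp_all)

lemma gcd_minors_mult:
  assumes M: "inverse_pair n M M'" and H: "H \<in> carrier_mat n n"
    and gcd: "is_gcd_of d (minors k H)"
  shows "is_gcd_of d (minors k (M * H))"
proof -
  have "fminors_in k (M * H) {x. e dvd x} \<longleftrightarrow> fminors_in k H {x. e dvd x}" for e
    using fminors_in_equiv[OF ring_ideal_dvd M inverse_pair_one H, of k e]
    unfolding right_mult_one_mat[OF mult_carrier_mat[OF inverse_pairD(1)[OF M] H]] .
  then have "(\<forall>x\<in>minors k (M * H). e dvd x) \<longleftrightarrow> (\<forall>x\<in>minors k H. e dvd x)" for e
    unfolding fminors_in_iff_minors[OF ring_ideal_dvd] by (auto simp: subset_iff)
  then show ?thesis using gcd unfolding is_gcd_of_def by simp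
qed

lemma inverse_pair_emb:
  assumes "inverse_pair n P Q"
  shows "inverse_pair n (map_mat emb P) (map_mat emb Q)"
proof -
  have *: "map_mat emb P * map_mat emb Q = 1\<^sub>m n" if "inverse_pair n P Q" for P Q
  proof (rule eq_matI)
    note c = inverse_pairD[OF that]
    have cc: "map_mat emb P \<in> carrier_mat n n" "map_mat emb Q \<in> carrier_mat n n" using c by auto
    fix i j assume "i < dim_row (1\<^sub>m n :: 'r mat)" "j < dim_col (1\<^sub>m n :: 'r mat)"
    then have ij: "i < n" "j < n" by auto
    have "(map_mat emb P * map_mat emb Q) $$ (i, j) = emb ((P * Q) $$ (i, j))"
      unfolding mult_mat_index[OF cc ij] mult_mat_index[OF c(1,2) ij] emb_sum emb_mult
      using c ij by (intro sum.cong) auto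
    then show "(map_mat emb P * map_mat emb Q) $$ (i, j) = 1\<^sub>m n $$ (i, j)" using ij c(3) by simp
  qed (use inverse_pairD[OF that] in auto)
  show ?thesis unfolding inverse_pair_def
    using *[OF assms] *[OF inverse_pair_sym[OF assms]] inverse_pairD(1,2)[OF assms] by simp
qed

end

lemma smult_const_dvd_iff:
  fixes d x :: "'a::field poly poly"
  assumes c: "c \<noteq> 0"
  shows "smult [:c:] d dvd x \<longleftrightarrow> d dvd x" "x dvd smult [:c:] d \<longleftrightarrow> x dvd d"
proof -
  have ci: "[:c:] * [:inverse c:] = 1" using c by (simp add: one_pCons)
  have d_eq: "smult [:inverse c:] (smult [:c:] d) = d"
    unfolding smult_smult mult.commute[of "[:inverse c:]"] ci by simp
  have 1: "d dvd smult [:c:] d" by (rule dvd_smult) simp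
  have "smult [:c:] d dvd smult [:inverse c:] (smult [:c:] d)" by (rule dvd_smult) simp
  then have 2: "smult [:c:] d dvd d" unfolding d_eq .
  show "smult [:c:] d dvd x \<longleftrightarrow> d dvd x" by (rule iffI[OF dvd_trans[OF 1] dvd_trans[OF 2]])
  show "x dvd smult [:c:] d \<longleftrightarrow> x dvd d" by (rule iffI[OF dvd_trans[OF _ 2] dvd_trans[OF _ 1]])
qed

text \<open>The definite description is resolved here: two greatest common divisors differ by a unit
  of \<open>F[t][s]\<close>, which is a constant of the field, and the normalization forces that
  constant to be 1.\<close>

lemma determinantal_divisor_gcd:
  fixes G :: "'a::field poly mat"
  assumes gcd: "is_gcd_of d (minors k (homogenization G))" and d: "d \<noteq> 0" and k: "k \<noteq> 0"
  shows "\<exists>c. c \<noteq> 0 \<and> determinantal_divisor G k = smult [:c:] d"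
proof -
  define c where "c = inverse (lead_coeff (lead_coeff d))"
  have c: "c \<noteq> 0" using d by (simp add: c_def)
  define d' where "d' = smult [:c:] d"
  note unit = smult_const_dvd_iff[OF c]
  have gcd': "is_gcd_of d' (minors k (homogenization G))"
    unfolding is_gcd_of_def d'_def unit(2)
  proof
    show "\<forall>x\<in>minors k (homogenization G). smult [:c:] d dvd x"
      using gcd unfolding is_gcd_of_def unit(1) by (rule conjunct1)
    show "\<forall>e. (\<forall>x\<in>minors k (homogenization G). e dvd x) \<longrightarrow> e dvd d"
      using gcd unfolding is_gcd_of_def by (rule conjunct2)
  qed
  have monic': "monic_wrt_s d'"
    using d c by (simp add: monic_wrt_s_def d'_def c_def lead_coeff_mult)
  have uniq: "e = d'" if e: "is_gcd_of e (minors k (homogenization G))" "monic_wrt_s e" for e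
  proof -
    have "d' dvd e" "e dvd d'" using e(1) gcd' unfolding is_gcd_of_def by simp_all
    then obtain a b where a: "e = d' * a" and b: "d' = e * b" by (elim dvdE)
    have nz: "d' \<noteq> 0" using d c by (simp add: d'_def)
    have "d' * (a * b) = d' * 1" unfolding mult.assoc[symmetric] a[symmetric] mult_1_right by (rule b[symmetric])
    then have ab: "a * b = 1" using nz by (simp only: mult_cancel_left) simp
    have "a dvd 1" using ab[symmetric] by (rule dvdI)
    then obtain a' where a': "a = [:a':]" "a' dvd 1" unfolding is_unit_poly_iff[of a] by blast
    then obtain z where z: "a' = [:z:]" unfolding is_unit_poly_iff[of a'] by blast
    have "lead_coeff (lead_coeff e) = lead_coeff (lead_coeff d') * z"
      unfolding a a' z by (simp add: lead_coeff_mult)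
    then have "z = 1" using e(2) monic' by (simp add: monic_wrt_s_def)
    then show ?thesis using a a' z by (simp add: one_pCons[symmetric])
  qed
  have "determinantal_divisor G k = d'"
    unfolding determinantal_divisor_def if_not_P[OF k]
    by (rule the_equality) (use gcd' monic' uniq in blast)+
  then show ?thesis using c unfolding d'_def by blast
qed

text \<open>
  Linear forms in the pencil variable are written in a basis \<open>u, v\<close> with \<open>v\<close> vanishing at the chosen point:
  \<open>val p\<close> is the coefficient of \<open>u\<close>, the value of \<open>p\<close> at that point, and \<open>co p\<close> is the coefficient of \<open>v\<close>.
  The basis is \<open>(s, t)\<close> at infinity and \<open>(t, s - c t)\<close> at \<open>c\<close>; \<open>u1, v1\<close> are its images under \<open>t = 1\<close>.
\<close>

locale pencil_coords =
  fixes val co :: "'a::field poly \<Rightarrow> 'a" and u1 v1 :: "'a poly" and u v :: "'a poly poly"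
  assumes val_lin: "semilinear (\<lambda>c. c) val" and co_lin: "semilinear (\<lambda>c. c) co"
    and decomp: "Polynomial.degree p \<le> 1 \<Longrightarrow> p = smult (val p) u1 + smult (co p) v1"
    and hom_decomp: "[: [:0, Polynomial.coeff p 0:], [:Polynomial.coeff p 1:] :] =
      smult [:val p:] u + smult [:co p:] v"
    and val_uv: "val u1 = 1" "val v1 = 0"
    and deg_uv: "Polynomial.degree u1 \<le> 1" "Polynomial.degree v1 \<le> 1"
    and v_prime: "prime_elem v" and vu: "\<not> v dvd u"
    and dehom: "\<exists>D. (\<forall>x y. D (x + y) = D x + D y) \<and> (\<forall>x y. D (x * y) = D x * D y) \<and>
      D u = [:0, 1:] \<and> D v = 1 \<and> (\<forall>c. D [:[:c:]:] = [:c:])"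
    and subst_x: "\<exists>\<sigma> \<tau>. \<forall>p. smult (Polynomial.coeff p 0) \<tau> + smult (Polynomial.coeff p 1) \<sigma> = [:co p, val p:]"
    and subst_val: "\<exists>\<sigma> \<tau>. \<forall>p. Polynomial.coeff p 0 * \<tau> + Polynomial.coeff p 1 * \<sigma> = val p"
begin

sublocale h1: homogenizer "\<lambda>c. [:c:]" u1 v1
  by unfold_locales simp_all

sublocale h2: homogenizer "\<lambda>c. [:[:c:]:]" u v
  by unfold_locales simp_all

text \<open>Dehomogenization, a left inverse of homogenizing that preserves divisibility. It is
  chosen from an existence assumption because its shape differs between infinity and a finite
  point.\<close>

definition dh :: "'a poly poly \<Rightarrow> 'a poly" where
  "dh = (SOME D. (\<forall>x y. D (x + y) = D x + D y) \<and> (\<forall>x y. D (x * y) = D x * D y) \<and>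
      D u = [:0, 1:] \<and> D v = 1 \<and> (\<forall>c. D [:[:c:]:] = [:c:]))"

lemma dh: "dh (x + y) = dh x + dh y" "dh (x * y) = dh x * dh y" "dh u = [:0, 1:]" "dh v = 1"
    "dh [:[:c:]:] = [:c:]"
  using someI_ex[OF dehom, folded dh_def] by simp_all

lemma dh_hom_poly:
  assumes "Polynomial.degree f \<le> k"
  shows "dh (h2.hom_poly k f) = f"
  using assms
proof (induction k arbitrary: f)
  case 0
  then obtain c where "f = [:c:]" by (metis degree_eq_zeroE le_zero_eq)
  then show ?case by (simp add: h2.hom_poly_def dh)
next
  case (Suc k)
  obtain c f' where f: "f = pCons c f'" by (cases f)
  then have deg: "Polynomial.degree f' \<le> k" using Suc(2) by (auto split: if_splits)
  have one: "dh (v ^ m) = 1" for m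
  proof (induction m)
    case 0
    show ?case unfolding power_0 one_pCons by (rule dh(5))
  qed (simp add: dh)
  show ?case unfolding f h2.hom_poly_pCons dh one Suc(1)[OF deg] by simp
qed

definition hp :: "'a poly \<Rightarrow> 'a poly poly" where
  "hp f = h2.hom_poly (Polynomial.degree f) f"

lemma hp_dvd: "hp f dvd hp g \<longleftrightarrow> f dvd g"
proof
  assume "hp f dvd hp g"
  then obtain w where "hp g = hp f * w" by (elim dvdE)
  then have "dh (hp g) = dh (hp f) * dh w" by (simp add: dh)
  then show "f dvd g" by (simp add: hp_def dh_hom_poly)
next
  assume "f dvd g"
  then obtain w where g: "g = f * w" by (elim dvdE)
  show "hp f dvd hp g"
  proof (cases "g = 0")
    case False
    then have "Polynomial.degree g = Polynomial.degree f + Polynomial.degree w"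
      using g degree_mult_eq[of f w] by auto
    then have "hp g = hp f * hp w" unfolding hp_def g by (simp add: h2.hom_poly_mult)
    then show ?thesis by simp
  qed (simp add: hp_def)
qed

lemma hp_mult:
  assumes "f \<noteq> 0" "g \<noteq> 0"
  shows "hp (f * g) = hp f * hp g"
  unfolding hp_def degree_mult_eq[OF assms] by (rule h2.hom_poly_mult) simp_all

lemma hp_nonzero: "f \<noteq> 0 \<Longrightarrow> hp f \<noteq> 0"
  using dh_hom_poly[of f "Polynomial.degree f"] dh_hom_poly[of 0 0] by (auto simp: hp_def)

text \<open>\<open>hp\<close> is multiplicative on nonzero polynomials, so the quotient of two
  consecutive determinantal divisors leaves the last factor \<open>\<phi> i\<close>. The constant is
  left undetermined, as it does not affect divisibility.\<close>

lemma hom_invariant_factor_eq: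
  assumes hom: "homogenization A = M * map_mat (h2.hom_poly 1) (char_poly_matrix N)"
    and M: "inverse_pair n M M'" and N: "has_invariants n N \<phi>" and i: "i < n"
  shows "\<exists>c. c \<noteq> 0 \<and> hom_invariant_factor A (Suc i) = smult [:c:] (hp (\<phi> i))"
proof -
  define d where "d = (\<lambda>k. \<Prod>i<k. \<phi> i)"
  have ch: "invariant_chain n \<phi>" and Nc: "N \<in> carrier_mat n n" using N by (simp_all add: has_invariants_def)
  have dnz: "d k \<noteq> 0" if "k \<le> n" for k
    using invariant_chainD(4)[OF ch] that by (auto simp: d_def)
  have not_pow: "\<not> v dvd u ^ m" for m
    using prime_elem_dvd_power[OF v_prime] vu by blast
  have gcd: "is_gcd_of (hp (d k)) (minors k (homogenization A))" if "k \<le> n" for k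
    unfolding hom hp_def d_def
    by (rule h2.gcd_minors_mult[OF M _ h2.gcd_minors[OF N that prime_power_cancel[OF v_prime] not_pow]])
       (use Nc in auto)
  have "\<exists>c. c \<noteq> 0 \<and> determinantal_divisor A k = smult [:c:] (hp (d k))" if "k \<le> n" for k
  proof (cases "k = 0")
    case True
    then show ?thesis
      by (intro exI[of _ 1]) (simp add: determinantal_divisor_def d_def hp_def h2.hom_poly_def)
  next
    case False
    then show ?thesis using determinantal_divisor_gcd[OF gcd[OF that] hp_nonzero[OF dnz[OF that]]] by blast
  qed
  from this[of i] this[of "Suc i"] i obtain a b where a: "a \<noteq> 0" "determinantal_divisor A i = smult [:a:] (hp (d i))"
    and b: "b \<noteq> 0" "determinantal_divisor A (Suc i) = smult [:b:] (hp (d (Suc i)))" by auto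
  have "d (Suc i) = d i * \<phi> i" by (simp add: d_def)
  then have "hp (d (Suc i)) = hp (d i) * hp (\<phi> i)"
    using hp_mult[of "d i" "\<phi> i"] dnz[of i] invariant_chainD(4)[OF ch i] i by simp
  then have eq: "determinantal_divisor A (Suc i) = determinantal_divisor A i * smult [:b / a:] (hp (\<phi> i))"
    using a b by simp
  have nz: "determinantal_divisor A i \<noteq> 0" using a hp_nonzero[OF dnz[of i]] i by simp
  have "hom_invariant_factor A (Suc i) = smult [:b / a:] (hp (\<phi> i))"
    unfolding hom_invariant_factor_def diff_Suc_1 eq by (rule nonzero_mult_div_cancel_left[OF nz])
  then show ?thesis using a b by (intro exI[of _ "b / a"]) simp
qed

text \<open>The linear form under \<open>u = x\<close>, \<open>v = 1\<close>, which turns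
  \<open>u I - v N\<close> into \<open>xI - N\<close>.\<close>

abbreviation "xval \<equiv> \<lambda>p. [:co p, val p:]"

lemma semilinear_xval: "semilinear (\<lambda>c. [:c:]) xval"
  using val_lin co_lin by (simp add: semilinear_def)

text \<open>Three readings of the same factorization: in \<open>F[s]\<close> for the pencil, in
  \<open>F[x]\<close> for comparing Smith forms, and in \<open>F[s,t]\<close> for the homogeneous
  invariant factors.\<close>

lemma pencil_normal_form:
  assumes A: "matrix_pencil n n A" and M: "inverse_pair n (map_mat val A) M'"
  obtains N \<phi> where "has_invariants n N \<phi>"
    "A = const_mat (map_mat val A) * map_mat (h1.hom_poly 1) (char_poly_matrix N)"
    "map_mat xval A = const_mat (map_mat val A) * char_poly_matrix N"
    "\<And>i. i < n \<Longrightarrow> \<exists>c. c \<noteq> 0 \<and> hom_invariant_factor A (Suc i) = smult [:c:] (hp (\<phi> i))"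
proof -
  have Ac: "A \<in> carrier_mat n n" and deg: "Polynomial.degree (A $$ (i, j)) \<le> 1" if "i < n" "j < n" for i j
    using A that by (auto simp: matrix_pencil_def)
  have Ac: "A \<in> carrier_mat n n" using A by (simp add: matrix_pencil_def)
  have coA: "map_mat (\<lambda>p. - co p) A \<in> carrier_mat n n" using Ac by simp
  define N where "N = M' * map_mat (\<lambda>p. - co p) A"
  have N: "N \<in> carrier_mat n n" unfolding N_def by (rule mult_carrier_mat[OF inverse_pairD(2)[OF M] coA])
  have MN: "map_mat val A * N = map_mat (\<lambda>p. - co p) A"
    unfolding N_def by (rule inverse_pair_cancel(1)[OF M coA])
  obtain \<phi> where \<phi>: "has_invariants n N \<phi>" using has_invariants_exists[OF N] by blast
  have 1: "A = const_mat (map_mat val A) * map_mat (h1.hom_poly 1) (char_poly_matrix N)"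
  proof -
    have "A $$ (i, j) = [:val (A $$ (i, j)):] * u1 + [:co (A $$ (i, j)):] * v1" if "i < n" "j < n" for i j
      using decomp[OF deg[OF that]] by simp
    then have "map_mat (\<lambda>p. [:val p:] * u1 + [:co p:] * v1) A = A"
      using Ac by (intro eq_matI) auto
    then show ?thesis using h1.pencil_factorization[OF Ac N MN] by simp
  qed
  have 2: "map_mat xval A = const_mat (map_mat val A) * char_poly_matrix N"
  proof -
    interpret h3: homogenizer "\<lambda>c. [:c:]" "[:0, 1:]" 1 by unfold_locales simp_all
    have "map_mat (h3.hom_poly 1) (char_poly_matrix N) = char_poly_matrix N"
    proof (rule eq_matI)
      fix i j assume "i < dim_row (char_poly_matrix N)" "j < dim_col (char_poly_matrix N)"
      then have ij: "i < n" "j < n" using N by (auto simp: char_poly_matrix_def)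
      then show "map_mat (h3.hom_poly 1) (char_poly_matrix N) $$ (i, j) = char_poly_matrix N $$ (i, j)"
        using h3.hom_poly_char_poly_matrix[OF N ij] char_poly_matrix_index[OF N ij] N
        by (simp add: char_poly_matrix_def)
    qed auto
    moreover have "map_mat (\<lambda>p. [:val p:] * [:0, 1:] + [:co p:] * 1) A = map_mat xval A"
      by (rule eq_matI) auto
    ultimately show ?thesis using h3.pencil_factorization[OF Ac N MN] by simp
  qed
  have 3: "homogenization A = map_mat (\<lambda>c. [:[:c:]:]) (map_mat val A) * map_mat (h2.hom_poly 1) (char_poly_matrix N)"
  proof -
    have "homogenization A = map_mat (\<lambda>p. [:[:val p:]:] * u + [:[:co p:]:] * v) A"
      unfolding homogenization_def hom_decomp by simp
    then show ?thesis using h2.pencil_factorization[OF Ac N MN] by simp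
  qed
  show thesis
    by (rule that[OF \<phi> 1 2 hom_invariant_factor_eq[OF 3 h2.inverse_pair_emb[OF M] \<phi>]])
qed

end

section \<open>Both directions in adapted coordinates\<close>

lemma const_mat_add:
  fixes A B :: "'b::comm_monoid_add mat"
  assumes "A \<in> carrier_mat n m" "B \<in> carrier_mat n m"
  shows "const_mat (A + B) = const_mat A + const_mat B"
  by (rule eq_matI) (use assms in auto)

lemma add_minus_mat_cancel:
  fixes A B C :: "'b::ab_group_add mat"
  assumes "A \<in> carrier_mat n m" "B \<in> carrier_mat n m" "C \<in> carrier_mat n m"
  shows "A + B + (C - B) = A + C"
  by (rule eq_matI) (use assms in auto)

lemma rank_le_uminus:
  assumes "rank_le n q Z"
  shows "rank_le n q (- Z)"
proof -
  obtain u v where Z: "Z = mat n n (\<lambda>(i, j). \<Sum>l<q. u i l * v l j)" using assms by (auto simp: rank_le_def)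
  have "- Z = mat n n (\<lambda>(i, j). \<Sum>l<q. - u i l * v l j)"
    unfolding Z by (rule eq_matI) (auto simp: sum_negf)
  then show ?thesis unfolding rank_le_def by (intro exI[of _ "\<lambda>i l. - u i l"] exI[of _ v])
qed

text \<open>\<open>L\<close> is the substitution of \<open>\<sigma>\<close> for \<open>s\<close> and
  \<open>\<tau>\<close> for \<open>t\<close> in the homogenized pencil, whose minors are homogenized
  minors of \<open>P\<close> and hence zero. This also covers the value at infinity, which no
  evaluation of \<open>s\<close> reaches.\<close>

lemma semilinear_vanishing_minors:
  assumes h: "homogenizer emb"
    and P: "matrix_pencil n n P" and z: "fminors_in k P {0}"
    and L: "\<And>p. emb (Polynomial.coeff p 0) * \<tau> + emb (Polynomial.coeff p 1) * \<sigma> = L p"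
  shows "fminors_in k (map_mat L P) {0}"
proof -
  interpret homogenizer emb \<sigma> \<tau> by (rule h)
  have "hom_poly 1 = L" by (rule ext) (simp only: hom_poly_1 L)
  then show ?thesis
    using hom_poly_fminors_zero[of P n n, OF _ _ z] P by (simp add: matrix_pencil_def)
qed

lemma degree_const_mat_mult_le:
  assumes G: "G \<in> carrier_mat n n" and M: "M \<in> carrier_mat n n"
    and deg: "\<And>i j. i < n \<Longrightarrow> j < n \<Longrightarrow> Polynomial.degree (M $$ (i, j)) \<le> d"
    and ij: "i < n" "j < n"
  shows "Polynomial.degree ((const_mat G * M) $$ (i, j)) \<le> d"
proof -
  have c: "const_mat G \<in> carrier_mat n n" using G by simp
  show ?thesis unfolding mult_mat_index[OF c M ij]
  proof (rule degree_sum_le)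
    fix l assume "l \<in> {..<n}"
    then have l: "l < n" by simp
    have "const_mat G $$ (i, l) * M $$ (l, j) = smult (G $$ (i, l)) (M $$ (l, j))"
      using G ij l by simp
    then show "Polynomial.degree (const_mat G $$ (i, l) * M $$ (l, j)) \<le> d"
      using degree_smult_le[of "G $$ (i, l)" "M $$ (l, j)"] deg[OF l ij(2)] by simp
  qed simp
qed

lemma strictly_equivalentE:
  assumes "strictly_equivalent G H" "G \<in> carrier_mat n n"
  obtains Q Q' R R' where "inverse_pair n Q Q'" "inverse_pair n R R'" "G = const_mat Q * H * const_mat R"
proof -
  obtain Q R where Q: "Q \<in> carrier_mat n n" "invertible_mat Q" and R: "R \<in> carrier_mat n n" "invertible_mat R"
    and G: "G = const_mat Q * H * const_mat R"
    using assms by (auto simp: strictly_equivalent_def)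
  then show thesis using invertible_mat_iff_inverse_pair[of Q n] invertible_mat_iff_inverse_pair[of R n] that by blast
qed

lemma strictly_equivalentI:
  assumes "inverse_pair n Q Q'" "inverse_pair n R R'" "H \<in> carrier_mat n n"
  shows "strictly_equivalent (const_mat Q * H * const_mat R) H"
proof -
  have "invertible_mat Q" "invertible_mat R"
    using invertible_mat_iff_inverse_pair[of Q n] invertible_mat_iff_inverse_pair[of R n]
      assms inverse_pairD(1)[OF assms(1)] inverse_pairD(1)[OF assms(2)] by blast+
  then show ?thesis unfolding strictly_equivalent_def
    using assms(3) inverse_pairD(1)[OF assms(1)] inverse_pairD(1)[OF assms(2)]
    by (intro conjI exI[of _ Q] exI[of _ R]) auto
qed

context pencil_coords
begin

text \<open>Under \<open>xval\<close> the perturbation becomes \<open>D2 = D1 + Z\<close> over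
  \<open>F[x]\<close>, with \<open>D1\<close> and \<open>D2\<close> equivalent to
  \<open>xI - NA\<close> and \<open>xI - NB\<close>. The second divisibility is the first one for
  \<open>D1 = D2 + - Z\<close>.\<close>

lemma perturbation_imp_interlaced:
  assumes A: "matrix_pencil n n A" and P: "matrix_pencil n n P" and B: "matrix_pencil n n B"
    and MA: "inverse_pair n MA MA'" and xA: "map_mat xval A = const_mat MA * char_poly_matrix NA"
    and NA: "has_invariants n NA \<phi>"
    and MB: "inverse_pair n MB MB'" and xB: "map_mat xval B = const_mat MB * char_poly_matrix NB"
    and NB: "has_invariants n NB \<psi>"
    and rank: "normal_rank P \<le> r" and equiv: "strictly_equivalent (A + P) B"
  shows "interlaced n r \<phi> \<psi>"
proof -
  have c: "A \<in> carrier_mat n n" "P \<in> carrier_mat n n" "B \<in> carrier_mat n n"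
    using A P B by (simp_all add: matrix_pencil_def)
  have AP: "A + P \<in> carrier_mat n n" using c by simp
  obtain Q Q' R R' where Q: "inverse_pair n Q Q'" and R: "inverse_pair n R R'"
    and eq: "A + P = const_mat Q * B * const_mat R" by (rule strictly_equivalentE[OF equiv AP])
  obtain P1 P1' Q1 Q1' where P1: "inverse_pair n P1 P1'" and Q1: "inverse_pair n Q1 Q1'"
    and C1: "char_poly_matrix NA = P1 * mat_diag n \<phi> * Q1" using NA unfolding has_invariants_def by blast
  obtain P2 P2' Q2 Q2' where P2: "inverse_pair n P2 P2'" and Q2: "inverse_pair n Q2 Q2'"
    and C2: "char_poly_matrix NB = P2 * mat_diag n \<psi> * Q2" using NB unfolding has_invariants_def by blast
  have cc: "const_mat MA \<in> carrier_mat n n" "const_mat MB \<in> carrier_mat n n"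
      "const_mat Q \<in> carrier_mat n n" "const_mat R \<in> carrier_mat n n"
    using inverse_pairD(1)[OF MA] inverse_pairD(1)[OF MB] inverse_pairD(1)[OF Q] inverse_pairD(1)[OF R] by simp_all
  note pc = inverse_pairD(1)[OF P1] inverse_pairD(1)[OF Q1] inverse_pairD(1)[OF P2] inverse_pairD(1)[OF Q2]
  have assoc4: "W * (U * D * V) = (W * U) * D * V"
    if "W \<in> carrier_mat n n" "U \<in> carrier_mat n n" "D \<in> carrier_mat n n" "V \<in> carrier_mat n n"
    for W U D V :: "'a poly mat"
    using assoc_mult_mat[OF that(1) mult_carrier_mat[OF that(2,3)] that(4)] assoc_mult_mat[OF that(1-3)] by simp
  define D1 where "D1 = map_mat xval A"
  define D2 where "D2 = map_mat xval (A + P)"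
  define Z where "Z = map_mat xval P"
  have D1: "D1 = (const_mat MA * P1) * mat_diag n \<phi> * Q1"
    unfolding D1_def xA C1 by (rule assoc4) (use cc pc in simp_all)
  have "D2 = map_mat xval (const_mat Q * B) * const_mat R"
    unfolding D2_def eq
    by (rule semilinear_mult_right[OF semilinear_xval inverse_pairD(1)[OF R] mult_carrier_mat[OF cc(3) c(3)]])
  also have "map_mat xval (const_mat Q * B) = const_mat Q * map_mat xval B"
    by (rule semilinear_mult_left[OF semilinear_xval inverse_pairD(1)[OF Q] c(3)])
  also have "map_mat xval B = (const_mat MB * P2) * mat_diag n \<psi> * Q2"
    unfolding xB C2 by (rule assoc4) (use cc pc in simp_all)
  also have "const_mat Q * ((const_mat MB * P2) * mat_diag n \<psi> * Q2) =
      (const_mat Q * (const_mat MB * P2)) * mat_diag n \<psi> * Q2"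
    by (rule assoc4) (use cc pc in simp_all)
  also have "\<dots> * const_mat R = (const_mat Q * (const_mat MB * P2)) * mat_diag n \<psi> * (Q2 * const_mat R)"
    by (rule assoc_mult_mat[of _ n n _ n _ n]) (use cc pc in simp_all)
  finally have D2: "D2 = (const_mat Q * (const_mat MB * P2)) * mat_diag n \<psi> * (Q2 * const_mat R)" .
  have D12: "D2 = D1 + Z"
    unfolding D2_def D1_def Z_def by (rule semilinear_add[OF semilinear_xval c(1,2)])
  have Zc: "D1 \<in> carrier_mat n n" "Z \<in> carrier_mat n n" using c by (simp_all add: D1_def Z_def)
  then have D21: "D1 = D2 + - Z" unfolding D12 by (intro eq_matI) auto
  obtain \<sigma> \<tau> where st: "\<And>p. smult (Polynomial.coeff p 0) \<tau> + smult (Polynomial.coeff p 1) \<sigma> = xval p"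
    using subst_x by blast
  have "normal_rank P < Suc r" using rank by simp
  then have "fminors_in (Suc r) P {0}" by (rule normal_rank_less_fminors[OF c(2)])
  then have "fminors_in (Suc r) Z {0}" unfolding Z_def
    by (rule semilinear_vanishing_minors[OF h1.homogenizer_axioms P, where \<sigma> = \<sigma> and \<tau> = \<tau>]) (use st in simp)
  then have rZ: "rank_le n r Z" by (rule rank_le_of_fminors[OF Zc(2)])
  have chains: "invariant_chain n \<phi>" "invariant_chain n \<psi>" using NA NB by (simp_all add: has_invariants_def)
  note i1 = inverse_pair_mult[OF inverse_pair_const_mat[OF MA] P1]
  note i2 = inverse_pair_mult[OF inverse_pair_const_mat[OF Q] inverse_pair_mult[OF inverse_pair_const_mat[OF MB] P2]]
  note i3 = inverse_pair_mult[OF Q2 inverse_pair_const_mat[OF R]]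
  show ?thesis unfolding interlaced_def
  proof (intro allI impI conjI)
    fix i assume i: "i + r < n"
    show "\<phi> i dvd \<psi> (i + r)"
      by (rule perturbed_invariants_dvd[OF i1 Q1 D1 i2 i3 D2 invariant_chainD(1)[OF chains(1)]
        invariant_chainD(1)[OF chains(2)] rZ D12 i])
    show "\<psi> i dvd \<phi> (i + r)"
      by (rule perturbed_invariants_dvd[OF i2 i3 D2 i1 Q1 D1 invariant_chainD(1)[OF chains(2)]
        invariant_chainD(1)[OF chains(1)] rank_le_uminus[OF rZ] D21 i])
  qed
qed

lemma interlaced_imp_perturbation:
  fixes A B :: "'a poly mat"
  defines "H \<equiv> \<lambda>N. map_mat (h1.hom_poly 1) (char_poly_matrix N)"
  assumes n: "n \<ge> 2" "r \<le> n"
    and MA: "inverse_pair n MA MA'" and A: "A = const_mat MA * H NA" and NA: "has_invariants n NA \<phi>"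
    and MB: "inverse_pair n MB MB'" and B: "B = const_mat MB * H NB" and NB: "has_invariants n NB \<psi>"
    and inter: "interlaced n r \<phi> \<psi>"
  shows "\<exists>P. matrix_pencil n n P \<and> normal_rank P = r \<and> strictly_equivalent (A + P) B"
proof -
  have ch: "invariant_chain n \<psi>" and NAc: "NA \<in> carrier_mat n n" and NBc: "NB \<in> carrier_mat n n"
    using NA NB by (simp_all add: has_invariants_def)
  obtain N where N: "has_invariants n N \<psi>" and rk: "rank_le n r (N - NA)"
    using bounded_rank_perturbation[OF NA ch inter] by blast
  have Nc: "N \<in> carrier_mat n n" using N by (simp add: has_invariants_def)
  obtain S S' where S: "inverse_pair n S S'" and NS: "N * S = S * NB"
    by (rule same_invariants_similar[OF N NB])
  obtain T T' Z0 where T: "inverse_pair n T T'" and Z0: "Z0 \<in> carrier_mat n n" and Z: "N - NA = T * Z0"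
    and Z0z: "\<And>i j. r \<le> i \<Longrightarrow> i < n \<Longrightarrow> j < n \<Longrightarrow> Z0 $$ (i, j) = 0"
    by (rule rank_le_row_form[OF rk]) (rule that)
  obtain Y W :: "'a mat" and f g where Y: "Y \<in> carrier_mat n n" and W: "inverse_pair n (1\<^sub>m n + Y) W"
    and Yz: "\<And>i j. r \<le> i \<Longrightarrow> i < n \<Longrightarrow> j < n \<Longrightarrow> Y $$ (i, j) = 0"
    and fg: "\<forall>i<r. f i < n" "\<forall>i<r. g i < n" and Ym: "fminor r Y f g \<noteq> 0"
    by (rule unit_plus_rank[OF n]) (rule that)
  have Hc: "H K \<in> carrier_mat n n" if "K \<in> carrier_mat n n" for K using that by (simp add: H_def)
  have Hi: "H K $$ (i, j) = [:if i = j then 1 else 0:] * u1 - [:K $$ (i, j):] * v1"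
    if "K \<in> carrier_mat n n" "i < n" "j < n" for K i j
    unfolding H_def h1.hom_poly_char_poly_matrix[OF that, symmetric]
    by (rule index_map_mat(1)) (use that carrier_matD[OF char_poly_matrix_closed[OF that(1)]] in simp_all)
  define K where "K = const_mat T' * H N"
  define V where "V = map_mat (\<lambda>c. smult c v1) Z0"
  define G where "G = MA * T"
  have G: "inverse_pair n G (T' * MA')" unfolding G_def by (rule inverse_pair_mult[OF MA T])
  note c = inverse_pairD(1,2)[OF MA] inverse_pairD(1,2)[OF MB] inverse_pairD(1,2)[OF S]
    inverse_pairD(1,2)[OF T] inverse_pairD(1)[OF G]
  have cc: "const_mat MA \<in> carrier_mat n n" "const_mat T \<in> carrier_mat n n" "const_mat T' \<in> carrier_mat n n"
    "const_mat G \<in> carrier_mat n n" "const_mat Y \<in> carrier_mat n n" "const_mat MB' \<in> carrier_mat n n"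
    "const_mat S \<in> carrier_mat n n" "const_mat S' \<in> carrier_mat n n" "const_mat Z0 \<in> carrier_mat n n"
    using c Y Z0 by simp_all
  have Kc: "K \<in> carrier_mat n n" unfolding K_def by (rule mult_carrier_mat[OF cc(3) Hc[OF Nc]])
  have Vc: "V \<in> carrier_mat n n" using Z0 by (simp add: V_def)
  have YK: "const_mat Y * K \<in> carrier_mat n n" by (rule mult_carrier_mat[OF cc(5) Kc])
  define P where "P = const_mat G * (const_mat Y * K - V)"
  have Pc: "P \<in> carrier_mat n n" unfolding P_def by (rule mult_carrier_mat[OF cc(4) minus_carrier_mat[OF Vc]])
  have HNA: "H NA = const_mat T * (K + V)"
  proof -
    have "const_mat T * K = H N"
      unfolding K_def by (rule inverse_pair_cancel(1)[OF inverse_pair_const_mat[OF T] Hc[OF Nc]])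
    then have "const_mat T * (K + V) = H N + const_mat T * V"
      unfolding mult_add_distrib_mat[OF cc(2) Kc Vc] by (rule arg_cong)
    also have "\<dots> = H NA"
    proof (rule eq_matI)
      fix i j assume "i < dim_row (H NA)" "j < dim_col (H NA)"
      then have ij: "i < n" "j < n" using Hc[OF NAc] by auto
      have TV: "const_mat T * V \<in> carrier_mat n n" by (rule mult_carrier_mat[OF cc(2) Vc])
      have "(const_mat T * V) $$ (i, j) = (\<Sum>l<n. smult (T $$ (i, l) * Z0 $$ (l, j)) v1)"
        unfolding mult_mat_index[OF cc(2) Vc ij] by (intro sum.cong) (use c Z0 ij in \<open>auto simp: V_def mult.commute\<close>)
      also have "\<dots> = smult ((T * Z0) $$ (i, j)) v1"
        unfolding mult_mat_index[OF c(7) Z0 ij] by (rule smult_sum[symmetric])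
      also have "(T * Z0) $$ (i, j) = N $$ (i, j) - NA $$ (i, j)" unfolding Z[symmetric] using Nc NAc ij by simp
      finally have "(const_mat T * V) $$ (i, j) = [:N $$ (i, j):] * v1 - [:NA $$ (i, j):] * v1"
        by (simp add: smult_diff_left)
      moreover have "(H N + const_mat T * V) $$ (i, j) = H N $$ (i, j) + (const_mat T * V) $$ (i, j)"
        by (rule index_add_mat(1)) (use TV ij in auto)
      ultimately show "(H N + const_mat T * V) $$ (i, j) = H NA $$ (i, j)"
        unfolding Hi[OF Nc ij] Hi[OF NAc ij] by simp
    qed (use Hc[OF NAc] Hc[OF Nc] cc(2) Vc in auto)
    finally show ?thesis ..
  qed
  have A': "A = const_mat G * (K + V)"
    unfolding A HNA G_def const_mat_mult[OF c(1,7)]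
    by (rule assoc_mult_mat[symmetric, OF cc(1,2) add_carrier_mat[OF Vc]])
  have sum: "A + P = const_mat G * (const_mat (1\<^sub>m n + Y) * K)"
  proof -
    have "A + P = const_mat G * ((K + V) + (const_mat Y * K - V))"
      unfolding A' P_def by (rule mult_add_distrib_mat[symmetric, OF cc(4) add_carrier_mat[OF Vc] minus_carrier_mat[OF Vc]])
    also have "(K + V) + (const_mat Y * K - V) = K + const_mat Y * K"
      by (rule add_minus_mat_cancel[OF Kc Vc YK])
    also have "\<dots> = (1\<^sub>m n + const_mat Y) * K"
      unfolding add_mult_distrib_mat[OF one_carrier_mat cc(5) Kc] left_mult_one_mat[OF Kc] ..
    also have "1\<^sub>m n + const_mat Y = const_mat (1\<^sub>m n + Y)"
      unfolding const_mat_add[OF one_carrier_mat Y] const_mat_one ..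
    finally show ?thesis .
  qed
  \<comment> \<open>A constant similarity passes through \<open>hom_poly\<close>, so
    \<open>u I - v N\<close> differs from \<open>B\<close> only by constant invertible
    factors.\<close>
  have HS: "H N = const_mat S * (const_mat MB' * B) * const_mat S'"
  proof -
    have "char_poly_matrix N * const_mat S = const_mat S * char_poly_matrix NB"
      unfolding char_poly_matrix_const(1)[OF Nc c(5)] char_poly_matrix_const(2)[OF NBc c(5)] NS ..
    then have "map_mat (h1.hom_poly 1) (char_poly_matrix N * const_mat S) =
        map_mat (h1.hom_poly 1) (const_mat S * char_poly_matrix NB)" by (rule arg_cong)
    then have "H N * const_mat S = const_mat S * H NB"
      unfolding H_def semilinear_mult_right[OF h1.semilinear_hom_poly c(5) char_poly_matrix_closed[OF Nc]]
        semilinear_mult_left[OF h1.semilinear_hom_poly c(5) char_poly_matrix_closed[OF NBc]] .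
    then have "H N * const_mat S * const_mat S' = const_mat S * H NB * const_mat S'" by (rule arg_cong)
    then have "H N = const_mat S * H NB * const_mat S'"
      unfolding inverse_pair_cancel_right(1)[OF inverse_pair_const_mat[OF S] Hc[OF Nc]] .
    moreover have "const_mat MB' * B = H NB"
      unfolding B by (rule inverse_pair_cancel(2)[OF inverse_pair_const_mat[OF MB] Hc[OF NBc]])
    ultimately show ?thesis by simp
  qed
  have Bc: "B \<in> carrier_mat n n" unfolding B by (rule mult_carrier_mat[OF _ Hc[OF NBc]]) (use c in simp)
  define Q where "Q = G * ((1\<^sub>m n + Y) * (T' * (S * MB')))"
  note iQ = inverse_pair_mult[OF G inverse_pair_mult[OF W inverse_pair_mult[OF inverse_pair_sym[OF T]
    inverse_pair_mult[OF S inverse_pair_sym[OF MB]]]], folded Q_def]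
  have Wc: "1\<^sub>m n + Y \<in> carrier_mat n n" by (rule inverse_pairD(1)[OF W])
  have equiv: "strictly_equivalent (A + P) B"
  proof -
    have cW: "const_mat (1\<^sub>m n + Y) \<in> carrier_mat n n" using Wc by simp
    note q1 = mult_carrier_mat[OF c(5,4)]
    note q2 = mult_carrier_mat[OF c(8) q1]
    note x1 = mult_carrier_mat[OF cc(7,6)]
    note x2 = mult_carrier_mat[OF cc(3) x1]
    note x3 = mult_carrier_mat[OF cW x2]
    note y1 = mult_carrier_mat[OF cc(7) mult_carrier_mat[OF cc(6) Bc]]
    note y2 = mult_carrier_mat[OF cc(3) y1]
    note y3 = mult_carrier_mat[OF cW y2]
    have Q: "const_mat Q = const_mat G * (const_mat (1\<^sub>m n + Y) * (const_mat T' * (const_mat S * const_mat MB')))"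
      unfolding Q_def const_mat_mult[OF c(9) mult_carrier_mat[OF Wc q2]] const_mat_mult[OF Wc q2]
        const_mat_mult[OF c(8) q1] const_mat_mult[OF c(5,4)] ..
    have "const_mat Q * B * const_mat S' = A + P"
      unfolding sum K_def HS Q assoc_mult_mat[OF cc(4) x3 Bc] assoc_mult_mat[OF cW x2 Bc]
        assoc_mult_mat[OF cc(3) x1 Bc] assoc_mult_mat[OF cc(7,6) Bc] assoc_mult_mat[OF cc(4) y3 cc(8)]
        assoc_mult_mat[OF cW y2 cc(8)] assoc_mult_mat[OF cc(3) y1 cc(8)] ..
    then show ?thesis using strictly_equivalentI[OF iQ inverse_pair_sym[OF S] Bc] by simp
  qed
  have degH: "Polynomial.degree (H N $$ (i, j)) \<le> 1" if "i < n" "j < n" for i j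
    unfolding Hi[OF Nc that] using deg_uv
    by (intro degree_diff_le) (auto intro: order.trans[OF degree_smult_le])
  have degK: "Polynomial.degree (K $$ (i, j)) \<le> 1" if "i < n" "j < n" for i j
    unfolding K_def by (rule degree_const_mat_mult_le[OF c(8) Hc[OF Nc] degH that])
  have degYK: "Polynomial.degree ((const_mat Y * K) $$ (i, j)) \<le> 1" if "i < n" "j < n" for i j
    by (rule degree_const_mat_mult_le[OF Y Kc degK that])
  have degI: "Polynomial.degree ((const_mat Y * K - V) $$ (i, j)) \<le> 1" if "i < n" "j < n" for i j
  proof -
    have "(const_mat Y * K - V) $$ (i, j) = (const_mat Y * K) $$ (i, j) - smult (Z0 $$ (i, j)) v1"
      using that Vc Z0 by (subst index_minus_mat(1)) (auto simp: V_def)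
    then show ?thesis
      using degYK[OF that] order.trans[OF degree_smult_le deg_uv(2)] by (simp only: degree_diff_le)
  qed
  have PP: "matrix_pencil n n P" unfolding matrix_pencil_def
  proof (intro conjI allI impI)
    show "P \<in> carrier_mat n n" by (rule Pc)
    show "Polynomial.degree (P $$ (i, j)) \<le> 1" if "i < n" "j < n" for i j
      unfolding P_def by (rule degree_const_mat_mult_le[OF c(9) minus_carrier_mat[OF Vc] degI that])
  qed
  have le: "normal_rank P \<le> r"
  proof (rule normal_rank_le)
    \<comment> \<open>Both terms live in the same first \<open>r\<close> rows, so their ranks do not
      add up to \<open>2 r\<close>.\<close>
    have "rank_le n r (const_mat Y * K - V)"
    proof (rule rank_le_rows[where s = 0])
      show "const_mat Y * K - V \<in> carrier_mat n n" by (rule minus_carrier_mat[OF Vc])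
      fix i j assume ij: "i < n" "j < n" and "\<not> (0 \<le> i \<and> i < 0 + r)"
      then have r: "r \<le> i" by simp
      have "(const_mat Y * K) $$ (i, j) = 0"
        unfolding mult_mat_index[OF cc(5) Kc ij] by (rule sum.neutral) (use Y Yz[OF r] ij in auto)
      moreover have "V $$ (i, j) = 0" using Z0z[OF r ij] Z0 ij by (simp add: V_def)
      ultimately show "(const_mat Y * K - V) $$ (i, j) = 0"
        using ij Vc by (subst index_minus_mat(1)) auto
    qed
    then show "rank_le n r P" unfolding P_def by (rule rank_le_mult_left[OF _ cc(4)])
  qed
  have ge: "\<not> normal_rank P < r"
  proof
    assume "normal_rank P < r"
    then have z: "fminors_in r P {0}" by (rule normal_rank_less_fminors[OF Pc])
    obtain \<sigma> \<tau> where st: "\<And>p. Polynomial.coeff p 0 * \<tau> + Polynomial.coeff p 1 * \<sigma> = val p"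
      using subst_val by blast
    have "homogenizer (\<lambda>c::'a. c)" by unfold_locales auto
    then have z': "fminors_in r (map_mat val P) {0}" by (rule semilinear_vanishing_minors[OF _ PP z st])
    have id: "map_mat (\<lambda>c. c) M = M" for M :: "'a mat" by (rule eq_matI) auto
    have val: "val (p + q) = val p + val q" "val (smult c p) = c * val p" for p q c
      using val_lin by (simp_all add: semilinear_def)
    have val_diff: "val (p - q) = val p - val q" for p q using val(1)[of "p - q" q] by simp
    have vH: "map_mat val (H N) = 1\<^sub>m n"
    proof (rule eq_matI)
      fix i j assume "i < dim_row (1\<^sub>m n :: 'a mat)" "j < dim_col (1\<^sub>m n :: 'a mat)"
      then have ij: "i < n" "j < n" by auto
      then have "map_mat val (H N) $$ (i, j) = val (H N $$ (i, j))" using Hc[OF Nc] by auto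
      then show "map_mat val (H N) $$ (i, j) = 1\<^sub>m n $$ (i, j)"
        unfolding Hi[OF Nc ij] using ij by (simp add: val_diff val val_uv)
    qed (use Hc[OF Nc] in auto)
    have "map_mat val P = G * map_mat val (const_mat Y * K - V)"
      unfolding P_def semilinear_mult_left[OF val_lin c(9) minus_carrier_mat[OF Vc]] id ..
    also have "map_mat val (const_mat Y * K - V) = map_mat val (const_mat Y * K)"
    proof (rule eq_matI)
      fix i j assume "i < dim_row (map_mat val (const_mat Y * K))" "j < dim_col (map_mat val (const_mat Y * K))"
      then have ij: "i < n" "j < n" using YK by auto
      have "map_mat val (const_mat Y * K - V) $$ (i, j) = val ((const_mat Y * K - V) $$ (i, j))"
        by (rule index_map_mat(1)) (use ij Vc in auto)
      also have "(const_mat Y * K - V) $$ (i, j) = (const_mat Y * K) $$ (i, j) - smult (Z0 $$ (i, j)) v1"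
        using ij Vc Z0 by (subst index_minus_mat(1)) (auto simp: V_def)
      also have "val \<dots> = val ((const_mat Y * K) $$ (i, j))" by (simp only: val_diff val val_uv mult_zero_right diff_0_right)
      also have "\<dots> = map_mat val (const_mat Y * K) $$ (i, j)"
        by (rule index_map_mat(1)[symmetric]) (use ij YK in auto)
      finally show "map_mat val (const_mat Y * K - V) $$ (i, j) = map_mat val (const_mat Y * K) $$ (i, j)" .
    qed (use YK Vc in auto)
    also have "\<dots> = Y * map_mat val K"
      unfolding semilinear_mult_left[OF val_lin Y Kc] id ..
    also have "map_mat val K = T'"
      unfolding K_def semilinear_mult_left[OF val_lin c(8) Hc[OF Nc]] id vH by (rule right_mult_one_mat[OF c(8)])
    also have "G * (Y * T') = G * Y * T'" by (rule assoc_mult_mat[symmetric, OF c(9) Y c(8)])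
    finally have "map_mat val P = G * Y * T'" .
    with z' have "fminors_in r Y {0}"
      using fminors_in_equiv[OF ring_ideal_zero G inverse_pair_sym[OF T] Y] by simp
    from fminors_inD[OF this Y fg] Ym show False by simp
  qed
  show ?thesis using PP le ge equiv by (intro exI[of _ P] conjI) auto
qed

end

lemma (in pencil_coords) perturbation_iff:
  assumes n: "n \<ge> 2" "r \<le> n" and A: "matrix_pencil n n A" and B: "matrix_pencil n n B"
    and dA: "Determinant.det (map_mat val A) \<noteq> 0" and dB: "Determinant.det (map_mat val B) \<noteq> 0"
  shows "(\<exists>P. matrix_pencil n n P \<and> normal_rank P = r \<and> strictly_equivalent (A + P) B) \<longleftrightarrow>
    (\<forall>i. i + r < n \<longrightarrow> hom_invariant_factor A (Suc i) dvd hom_invariant_factor B (Suc (i + r)) \<and>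
       hom_invariant_factor B (Suc i) dvd hom_invariant_factor A (Suc (i + r)))"
    (is "?L \<longleftrightarrow> ?R")
proof -
  have c: "map_mat val A \<in> carrier_mat n n" "map_mat val B \<in> carrier_mat n n"
    using A B by (simp_all add: matrix_pencil_def)
  obtain MA' where MA: "inverse_pair n (map_mat val A) MA'" by (rule det_nonzero_inverse_pair[OF c(1) dA])
  obtain MB' where MB: "inverse_pair n (map_mat val B) MB'" by (rule det_nonzero_inverse_pair[OF c(2) dB])
  obtain NA \<phi> where NA: "has_invariants n NA \<phi>"
    and A1: "A = const_mat (map_mat val A) * map_mat (h1.hom_poly 1) (char_poly_matrix NA)"
    and A2: "map_mat xval A = const_mat (map_mat val A) * char_poly_matrix NA"
    and A3: "\<And>i. i < n \<Longrightarrow> \<exists>c. c \<noteq> 0 \<and> hom_invariant_factor A (Suc i) = smult [:c:] (hp (\<phi> i))"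
    by (rule pencil_normal_form[OF A MA]) (rule that)
  obtain NB \<psi> where NB: "has_invariants n NB \<psi>"
    and B1: "B = const_mat (map_mat val B) * map_mat (h1.hom_poly 1) (char_poly_matrix NB)"
    and B2: "map_mat xval B = const_mat (map_mat val B) * char_poly_matrix NB"
    and B3: "\<And>i. i < n \<Longrightarrow> \<exists>c. c \<noteq> 0 \<and> hom_invariant_factor B (Suc i) = smult [:c:] (hp (\<psi> i))"
    by (rule pencil_normal_form[OF B MB]) (rule that)
  have "?L \<longleftrightarrow> interlaced n r \<phi> \<psi>"
  proof
    assume ?L
    then obtain P where P: "matrix_pencil n n P" "normal_rank P = r" "strictly_equivalent (A + P) B" by blast
    show "interlaced n r \<phi> \<psi>"
      by (rule perturbation_imp_interlaced[OF A P(1) B MA A2 NA MB B2 NB _ P(3)]) (simp add: P(2))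
  next
    assume "interlaced n r \<phi> \<psi>"
    then show ?L by (rule interlaced_imp_perturbation[OF n MA A1 NA MB B1 NB])
  qed
  also have "\<dots> \<longleftrightarrow> ?R"
  proof -
    have *: "hom_invariant_factor A (Suc i) dvd hom_invariant_factor B (Suc j) \<longleftrightarrow> \<phi> i dvd \<psi> j"
        "hom_invariant_factor B (Suc i) dvd hom_invariant_factor A (Suc j) \<longleftrightarrow> \<psi> i dvd \<phi> j"
      if ij: "i < n" "j < n" for i j
      using A3[OF ij(1)] A3[OF ij(2)] B3[OF ij(1)] B3[OF ij(2)]
      by (auto simp: smult_const_dvd_iff hp_dvd)
    show ?thesis unfolding interlaced_def
      by (rule all_cong1) (use * in simp)
  qed
  finally show ?thesis .
qed

section \<open>The coordinates at infinity and at a finite point\<close>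

lemma prime_elem_monic_linear: "prime_elem [:- a, 1 :: 'a::idom:]"
proof (rule prime_elemI)
  show "\<not> [:- a, 1:] dvd 1" unfolding poly_eq_0_iff_dvd[symmetric] by simp
  fix p q assume "[:- a, 1:] dvd p * q"
  then show "[:- a, 1:] dvd p \<or> [:- a, 1:] dvd q" unfolding poly_eq_0_iff_dvd[symmetric] by simp
qed simp

lemma degree_le_1E:
  assumes "Polynomial.degree p \<le> 1"
  obtains a b where "p = [:a, b:]"
proof -
  obtain a q where p: "p = pCons a q" by (cases p)
  then have "Polynomial.degree q = 0" using assms by (auto split: if_splits)
  then show thesis using that p by (metis degree_eq_zeroE)
qed

text \<open>Since \<open>s\<close> is the outer variable, dehomogenizing by \<open>t = 1\<close>
  acts on the coefficients, and \<open>s\<close> becomes the new variable.\<close>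

lemma pencil_coords_infinity:
  "pencil_coords (\<lambda>p :: 'a::field poly. Polynomial.coeff p 1) (\<lambda>p. Polynomial.coeff p 0)
     [:0, 1:] 1 [:0, 1:] [:[:0, 1:]:]"
proof
  let ?D = "map_poly (\<lambda>q :: 'a poly. poly q 1)"
  interpret h: comm_ring_hom "\<lambda>q :: 'a poly. poly q 1" by unfold_locales auto
  interpret H: map_poly_comm_ring_hom "\<lambda>q :: 'a poly. poly q 1" ..
  have "?D [:[:c:]:] = [:c:]" for c by (cases "c = 0") (simp_all add: map_poly_pCons)
  then show "\<exists>D. (\<forall>x y. D (x + y) = D x + D y) \<and> (\<forall>x y. D (x * y) = D x * D y) \<and>
      D [:0, 1:] = [:0, 1 :: 'a:] \<and> D [:[:0, 1:]:] = 1 \<and> (\<forall>c. D [:[:c:]:] = [:c:])"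
    by (intro exI[of _ ?D] conjI allI H.hom_add H.hom_mult) (simp_all add: map_poly_pCons)
  show "p = smult (Polynomial.coeff p 1) [:0, 1:] + smult (Polynomial.coeff p 0) 1"
    if "Polynomial.degree p \<le> 1" for p :: "'a poly"
    by (rule degree_le_1E[OF that]) simp
  have "prime_elem [:0, 1 :: 'a:]" using prime_elem_monic_linear[of "0 :: 'a"] by simp
  then show "prime_elem [:[:0, 1 :: 'a:]:]" by (rule lift_prime_elem_poly)
  show "\<not> [:[:0, 1 :: 'a:]:] dvd [:0, 1:]"
  proof
    assume "[:[:0, 1 :: 'a:]:] dvd [:0, 1:]"
    then have "[:0, 1 :: 'a:] dvd Polynomial.coeff [:0, 1:] 1" unfolding const_poly_dvd_iff by blast
    then have "[:- 0, 1 :: 'a:] dvd 1" by simp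
    then show False unfolding poly_eq_0_iff_dvd[symmetric] by simp
  qed
  show "\<exists>\<sigma> \<tau>. \<forall>p :: 'a poly. smult (Polynomial.coeff p 0) \<tau> + smult (Polynomial.coeff p 1) \<sigma> =
      [:Polynomial.coeff p 0, Polynomial.coeff p 1:]"
    by (rule exI[of _ "[:0, 1:]"], rule exI[of _ 1]) simp
  show "\<exists>\<sigma> \<tau>. \<forall>p :: 'a poly. Polynomial.coeff p 0 * \<tau> + Polynomial.coeff p 1 * \<sigma> = Polynomial.coeff p 1"
    by (rule exI[of _ 1], rule exI[of _ 0]) simp
qed (simp_all add: semilinear_def)

text \<open>A form \<open>a t + b s\<close> equals \<open>(a + b c) t + b (s - c t)\<close>. Solving
  \<open>t = x\<close>, \<open>s - c t = 1\<close> gives \<open>s = 1 + c x\<close>: dehomogenizing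
  evaluates the outer variable there and keeps \<open>t\<close> as \<open>x\<close>, and the same
  pair serves as \<open>\<sigma>\<close> and \<open>\<tau>\<close>.\<close>

lemma pencil_coords_finite:
  fixes c :: "'a::field"
  shows "pencil_coords (\<lambda>p. Polynomial.coeff p 0 + c * Polynomial.coeff p 1) (\<lambda>p. Polynomial.coeff p 1)
     1 [:- c, 1:] [:[:0, 1:]:] [:[:0, - c:], 1:]"
proof
  have v: "[:[:0, - c:], 1:] = [:- [:0, c:], 1:]" by simp
  show "\<exists>D. (\<forall>x y. D (x + y) = D x + D y) \<and> (\<forall>x y. D (x * y) = D x * D y) \<and>
      D [:[:0, 1:]:] = [:0, 1:] \<and> D [:[:0, - c:], 1:] = 1 \<and> (\<forall>c. D [:[:c:]:] = [:c:])"
    by (rule exI[of _ "\<lambda>p. poly p [:1, c:]"]) simp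
  show "p = smult (Polynomial.coeff p 0 + c * Polynomial.coeff p 1) 1 + smult (Polynomial.coeff p 1) [:- c, 1:]"
    if "Polynomial.degree p \<le> 1" for p :: "'a poly"
    by (rule degree_le_1E[OF that]) (simp add: mult.commute)
  show "prime_elem [:[:0, - c:], 1:]" unfolding v by (rule prime_elem_monic_linear)
  show "\<not> [:[:0, - c:], 1:] dvd [:[:0, 1:]:]" unfolding v poly_eq_0_iff_dvd[symmetric] by simp
  show "\<exists>\<sigma> \<tau>. \<forall>p. smult (Polynomial.coeff p 0) \<tau> + smult (Polynomial.coeff p 1) \<sigma> =
      [:Polynomial.coeff p 1, Polynomial.coeff p 0 + c * Polynomial.coeff p 1:]"
    by (rule exI[of _ "[:1, c:]"], rule exI[of _ "[:0, 1:]"]) (simp add: mult.commute)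
  show "\<exists>\<sigma> \<tau>. \<forall>p. Polynomial.coeff p 0 * \<tau> + Polynomial.coeff p 1 * \<sigma> =
      Polynomial.coeff p 0 + c * Polynomial.coeff p 1"
    by (rule exI[of _ c], rule exI[of _ 1]) (simp add: mult.commute)
qed (simp_all add: semilinear_def algebra_simps)

text \<open>A regular pencil has normal rank \<open>n\<close>, so outside the spectrum its value has
  full rank over the closure. At ground points the determinant is the image under
  \<open>to_ac\<close> of one over the field itself, which is then nonzero too.\<close>

lemma regular_pencil_at_det:
  assumes A: "regular_pencil n A" and x: "x \<notin> spectrum_pencil A"
  shows "Determinant.det (pencil_at A x) \<noteq> 0"
proof -
  have Ac: "A \<in> carrier_mat n n" and dA: "Determinant.det A \<noteq> 0"
    using A by (simp_all add: regular_pencil_def matrix_pencil_def)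
  have "Determinant.det (map_mat to_fract A) \<noteq> 0"
  proof -
    interpret h: comm_ring_hom "to_fract :: 'a poly \<Rightarrow> _" by unfold_locales simp_all
    show ?thesis using dA by (simp add: h.hom_det)
  qed
  then have "normal_rank A = n"
    using vec_space.det_rank_iff[of "map_mat to_fract A" n] Ac by (simp add: normal_rank_def)
  then have "n \<le> vec_space.rank n (pencil_at A x)" using x Ac by (simp add: spectrum_pencil_def)
  moreover have xc: "pencil_at A x \<in> carrier_mat n n" using Ac by (cases x) simp_all
  ultimately have "vec_space.rank n (pencil_at A x) = n" using vec_space.rank_le_nc[OF xc] by simp
  then show ?thesis using vec_space.det_rank_iff[OF xc] by simp
qed

lemma det_map_to_ac: "Determinant.det (map_mat to_ac M) = to_ac (Determinant.det M)"
proof -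
  interpret h: comm_ring_hom "to_ac :: 'a \<Rightarrow> _" by unfold_locales simp_all
  show ?thesis by (rule h.hom_det)
qed

lemma regular_pencil_infinity:
  assumes "regular_pencil n A" "Infty \<notin> spectrum_pencil A"
  shows "Determinant.det (map_mat (\<lambda>p. Polynomial.coeff p 1) A) \<noteq> 0"
proof -
  have "pencil_at A Infty = map_mat to_ac (map_mat (\<lambda>p. Polynomial.coeff p 1) A)"
    by (rule eq_matI) auto
  then show ?thesis using regular_pencil_at_det[OF assms] by (auto simp: det_map_to_ac)
qed

lemma regular_pencil_finite:
  assumes A: "regular_pencil n A" and c: "Fin (to_ac c) \<notin> spectrum_pencil A"
  shows "Determinant.det (map_mat (\<lambda>p. Polynomial.coeff p 0 + c * Polynomial.coeff p 1) A) \<noteq> 0"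
proof -
  let ?val = "\<lambda>p. Polynomial.coeff p 0 + c * Polynomial.coeff p 1"
  have "poly (map_poly to_ac p) (to_ac c) = to_ac (?val p)" if "Polynomial.degree p \<le> 1" for p
  proof (rule degree_le_1E[OF that])
    fix a b assume p: "p = [:a, b:]"
    show ?thesis
      unfolding p by (cases "b = 0"; cases "a = 0") (simp_all add: map_poly_pCons)
  qed
  then have "pencil_at A (Fin (to_ac c)) = map_mat to_ac (map_mat ?val A)"
    using A by (intro eq_matI) (auto simp: regular_pencil_def matrix_pencil_def)
  then show ?thesis using regular_pencil_at_det[OF A c] by (auto simp: det_map_to_ac)
qed

theorem theorem3p10:
  fixes A B :: "'a::field poly mat"
    and \<phi> \<psi> :: "int \<Rightarrow> 'a poly poly"
    and n r :: nat
  assumes "n \<ge> 2"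
    and "regular_pencil n A" and "regular_pencil n B"
    and "\<forall>j. 1 \<le> j \<and> j \<le> int n \<longrightarrow> \<phi> j = hom_invariant_factor A (nat j)"
    and "\<forall>j<1. \<phi> j = 1" and "\<forall>j>int n. \<phi> j = 0"
    and "\<forall>j. 1 \<le> j \<and> j \<le> int n \<longrightarrow> \<psi> j = hom_invariant_factor B (nat j)"
    and "\<not> ground_points \<subseteq> spectrum_pencil A \<union> spectrum_pencil B"
    and "r \<le> n"
  shows "(\<exists>P. matrix_pencil n n P \<and> normal_rank P = r \<and> strictly_equivalent (A + P) B)
     \<longleftrightarrow> (\<forall>i. 1 \<le> i \<and> i \<le> int n \<longrightarrow>
            \<phi> (i - int r) dvd \<psi> i \<and> \<psi> i dvd \<phi> (i + int r))"
proof -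
  have A: "matrix_pencil n n A" and B: "matrix_pencil n n B" using assms(2,3) by (simp_all add: regular_pencil_def)
  obtain x where x: "x \<in> ground_points" "x \<notin> spectrum_pencil A" "x \<notin> spectrum_pencil B" using assms(8) by blast
  have "(\<exists>P. matrix_pencil n n P \<and> normal_rank P = r \<and> strictly_equivalent (A + P) B) \<longleftrightarrow>
      (\<forall>i. i + r < n \<longrightarrow> hom_invariant_factor A (Suc i) dvd hom_invariant_factor B (Suc (i + r)) \<and>
        hom_invariant_factor B (Suc i) dvd hom_invariant_factor A (Suc (i + r)))"
  proof (cases x)
    case Infty
    show ?thesis
      by (rule pencil_coords.perturbation_iff[OF pencil_coords_infinity assms(1,9) A B
        regular_pencil_infinity[OF assms(2)] regular_pencil_infinity[OF assms(3)]]) (use x Infty in simp_all)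
  next
    case (Fin y)
    then obtain c where c: "x = Fin (to_ac c)" using x(1) by (auto simp: ground_points_def)
    show ?thesis
      by (rule pencil_coords.perturbation_iff[OF pencil_coords_finite assms(1,9) A B
        regular_pencil_finite[OF assms(2)] regular_pencil_finite[OF assms(3)]]) (use x c in simp_all)
  qed
  also have "\<dots> \<longleftrightarrow> (\<forall>i. 1 \<le> i \<and> i \<le> int n \<longrightarrow>
      \<phi> (i - int r) dvd \<psi> i \<and> \<psi> i dvd \<phi> (i + int r))"
  proof -
    \<comment> \<open>The interlacing counts from 0 and moves the shift to the larger index, while
      the theorem counts from 1 and shifts in both directions. The out-of-range cases hold by the
      conventions: 1 divides everything and everything divides 0.\<close>
    have \<phi>: "\<phi> (int i + 1) = hom_invariant_factor A (Suc i)" and \<psi>: "\<psi> (int i + 1) = hom_invariant_factor B (Suc i)"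
      if "i < n" for i
      using assms(4,7) that by (simp_all add: nat_add_distrib)
    show ?thesis
    proof (intro iffI allI impI)
      fix j assume R: "\<forall>i. i + r < n \<longrightarrow> hom_invariant_factor A (Suc i) dvd hom_invariant_factor B (Suc (i + r)) \<and>
          hom_invariant_factor B (Suc i) dvd hom_invariant_factor A (Suc (i + r))"
        and j: "1 \<le> j \<and> j \<le> int n"
      define i where "i = nat j - 1"
      have i: "j = int i + 1" "i < n" using j by (auto simp: i_def)
      have "\<phi> (j - int r) dvd \<psi> j"
      proof (cases "r \<le> i")
        case True
        then have e: "j - int r = int (i - r) + 1" using i by simp
        have "i - r < n" using i by simp
        show ?thesis unfolding e unfolding i(1) \<phi>[OF \<open>i - r < n\<close>] \<psi>[OF i(2)]
          using R[rule_format, of "i - r"] True i by simp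
      qed (use i assms(5) in simp)
      moreover have "\<psi> j dvd \<phi> (j + int r)"
      proof (cases "i + r < n")
        case True
        have e: "j + int r = int (i + r) + 1" using i by simp
        show ?thesis unfolding e unfolding i(1) \<phi>[OF True] \<psi>[OF i(2)]
          using R[rule_format, OF True] by (rule conjunct2)
      qed (use i assms(6) in simp)
      ultimately show "\<phi> (j - int r) dvd \<psi> j \<and> \<psi> j dvd \<phi> (j + int r)" ..
    next
      fix i assume R: "\<forall>i. 1 \<le> i \<and> i \<le> int n \<longrightarrow> \<phi> (i - int r) dvd \<psi> i \<and> \<psi> i dvd \<phi> (i + int r)"
        and i: "i + r < n"
      have e: "int (i + r) + 1 - int r = int i + 1" "int i + 1 + int r = int (i + r) + 1" by simp_all
      show "hom_invariant_factor A (Suc i) dvd hom_invariant_factor B (Suc (i + r)) \<and>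
          hom_invariant_factor B (Suc i) dvd hom_invariant_factor A (Suc (i + r))"
        using R[rule_format, of "int (i + r) + 1"] R[rule_format, of "int i + 1"] i
          \<phi>[of i] \<phi>[of "i + r"] \<psi>[of i] \<psi>[of "i + r"] unfolding e by simp
    qed
  qed
  finally show ?thesis .
qed

end
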